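(* Let $\varphi:\mathbb{R}^n\to\mathbb{R}$ be a smooth function. Set $V_1=\frac14|\nabla\varphi|^2-\frac12\triangle\varphi$ and $V_2=\frac14|\nabla\varphi|^2+\frac12\triangle\varphi$. (1) The injection $H^1(\mathbb{R}^n,\varphi)\hookrightarrow L^2(\mathbb{R}^n,\varphi)$ is compact if and only if the Schrödinger operator $\mathcal{S}_1=-\triangle+V_1$ on $L^2(\mathbb{R}^n)$ has compact resolvent. (2) The injection $H^1(\mathbb{R}^n,\varphi,\nabla\varphi)\hookrightarrow L^2(\mathbb{R}^n,\varphi)$ is compact if and only if the Schrödinger operator $\mathcal{S}_2=-\triangle+V_2$ on $L^2(\mathbb{R}^n)$ has compact resolvent.
   Context: $L^2(\mathbb{R}^n,\varphi)$ is the space of measurable $f:\mathbb{R}^n\to\mathbb{C}$ with $\|f\|_\varphi^2=\int_{\mathbb{R}^n}|f|^2e^{-\varphi}\,d\lambda<\infty$, where $\lambda$ is Lebesgue measure. $H^1(\mathbb{R}^n,\varphi)$ is the space of $f\in L^2(\mathbb{R}^n,\varphi)$ with distributional derivatives $\frac{\partial f}{\partial x_j}\in L^2(\mathbb{R}^n,\varphi)$ for $1\le j\le n$, with norm $\|f\|_{1,\varphi}^2=\|f\|_\varphi^2+\sum_{j=1}^n\|\frac{\partial f}{\partial x_j}\|_\varphi^2$. With $X_j=\frac{\partial}{\partial x_j}-\frac{\partial\varphi}{\partial x_j}$ (the second term acting by multiplication), $H^1(\mathbb{R}^n,\varphi,\nabla\varphi)$ is the space of $f\in L^2(\mathbb{R}^n,\varphi)$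 with $X_jf\in L^2(\mathbb{R}^n,\varphi)$ (in the sense of distributions) for $1\le j\le n$, with norm $\|f\|_{\varphi,\nabla\varphi}^2=\|f\|_\varphi^2+\sum_{j=1}^n\|X_jf\|_\varphi^2$. The operators $\mathcal{S}_1,\mathcal{S}_2$ are understood as the self-adjoint operators in (unweighted) $L^2(\mathbb{R}^n)$ determined by their action on $\mathcal{C}_0^\infty(\mathbb{R}^n)$ (smooth compactly supported functions). An operator $A$ with spectrum $\sigma(A)$ has compact resolvent if $(A-z)^{-1}$ is compact for one (equivalently all) $z\in\mathbb{C}\setminus\sigma(A)$. *)

theory Defs
  imports "HOL-Analysis.Analysis"
begin

section \<open>Partial derivatives, smooth functions, test functions\<close>

definition partial_deriv :: "'n::finite \<Rightarrow> (real^'n \<Rightarrow> 'b::real_normed_vector) \<Rightarrow> real^'n \<Rightarrow> 'b"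
  where "partial_deriv j f x = vector_derivative (\<lambda>t. f (x + t *\<^sub>R axis j 1)) (at 0)"

primrec C_k :: "nat \<Rightarrow> (real^'n::finite \<Rightarrow> 'b::real_normed_vector) \<Rightarrow> bool"
  where
    "C_k 0 f \<longleftrightarrow> continuous_on UNIV f"
  | "C_k (Suc k) f \<longleftrightarrow> f differentiable_on UNIV \<and> (\<forall>j. C_k k (partial_deriv j f))"

definition smooth :: "(real^'n::finite \<Rightarrow> 'b::real_normed_vector) \<Rightarrow> bool"
  where "smooth f \<longleftrightarrow> (\<forall>k. C_k k f)"

definition test_functions :: "(real^'n::finite \<Rightarrow> complex) set"
  where "test_functions = {\<psi>. smooth \<psi> \<and> compact (closure {x. \<psi> x \<noteq> 0})}"

definition grad :: "(real^'n::finite \<Rightarrow> real) \<Rightarrow> real^'n \<Rightarrow> real^'n"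
  where "grad f x = (\<chi> j. partial_deriv j f x)"

definition laplacian :: "(real^'n::finite \<Rightarrow> 'b::real_normed_vector) \<Rightarrow> real^'n \<Rightarrow> 'b"
  where "laplacian f x = (\<Sum>j\<in>UNIV. partial_deriv j (partial_deriv j f) x)"


section \<open>Spaces of square-integrable functions\<close>

text \<open>Elements of \<open>L\<^sup>2\<close> are represented by functions, not by classes modulo null sets; all
  notions below are invariant under changing the representatives on a null set.\<close>

definition L2 :: "'a measure \<Rightarrow> ('a \<Rightarrow> complex) set"
  where "L2 M = {f \<in> borel_measurable M. integrable M (\<lambda>x. (cmod (f x))\<^sup>2)}"

definition L2_inner :: "'a measure \<Rightarrow> ('a \<Rightarrow> complex) \<Rightarrow> ('a \<Rightarrow> complex) \<Rightarrow> complex"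
  where "L2_inner M f g = (\<integral>x. f x * cnj (g x) \<partial>M)"

definition L2_norm :: "'a measure \<Rightarrow> ('a \<Rightarrow> complex) \<Rightarrow> real"
  where "L2_norm M f = sqrt (\<integral>x. (cmod (f x))\<^sup>2 \<partial>M)"

definition weighted :: "(real^'n::finite \<Rightarrow> real) \<Rightarrow> (real^'n) measure"
  where "weighted \<phi> = density lebesgue (\<lambda>x. ennreal (exp (- \<phi> x)))"


section \<open>Distributions and weighted Sobolev spaces\<close>

text \<open>A distribution is given by its values on test functions; its values elsewhere are irrelevant.\<close>

type_synonym 'n distribution = "(real^'n \<Rightarrow> complex) \<Rightarrow> complex"

definition regular_dist :: "(real^'n::finite \<Rightarrow> complex) \<Rightarrow> 'n distribution"
  where "regular_dist f \<psi> = (\<integral>x. f x * \<psi> x \<partial>lebesgue)"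

definition dist_partial :: "'n::finite \<Rightarrow> 'n distribution \<Rightarrow> 'n distribution"
  where "dist_partial j T \<psi> = - T (partial_deriv j \<psi>)"

definition dist_mult :: "(real^'n::finite \<Rightarrow> real) \<Rightarrow> 'n distribution \<Rightarrow> 'n distribution"
  where "dist_mult a T \<psi> = T (\<lambda>x. complex_of_real (a x) * \<psi> x)"

definition dist_X :: "(real^'n::finite \<Rightarrow> real) \<Rightarrow> 'n \<Rightarrow> 'n distribution \<Rightarrow> 'n distribution"
  where "dist_X \<phi> j T \<psi> = dist_partial j T \<psi> - dist_mult (partial_deriv j \<phi>) T \<psi>"

text \<open>For continuous \<open>\<phi>\<close>, functions in \<open>L2 (weighted \<phi>)\<close> are locally integrable, so they
  define regular distributions.\<close>

definition represents :: "(real^'n::finite \<Rightarrow> complex) \<Rightarrow> 'n distribution \<Rightarrow> bool"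
  where "represents g T \<longleftrightarrow> (\<forall>\<psi>\<in>test_functions. T \<psi> = regular_dist g \<psi>)"

definition dist_in_L2 :: "(real^'n::finite) measure \<Rightarrow> 'n distribution \<Rightarrow> bool"
  where "dist_in_L2 M T \<longleftrightarrow> (\<exists>g\<in>L2 M. represents g T)"

text \<open>The representing function is unique up to null sets, so its norm does not depend on the choice.\<close>

definition dist_rep :: "(real^'n::finite) measure \<Rightarrow> 'n distribution \<Rightarrow> real^'n \<Rightarrow> complex"
  where "dist_rep M T = (SOME g. g \<in> L2 M \<and> represents g T)"

definition H1 :: "(real^'n::finite \<Rightarrow> real) \<Rightarrow> (real^'n \<Rightarrow> complex) set"
  where "H1 \<phi> = {f \<in> L2 (weighted \<phi>).
    \<forall>j. dist_in_L2 (weighted \<phi>) (dist_partial j (regular_dist f))}"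

definition H1_norm :: "(real^'n::finite \<Rightarrow> real) \<Rightarrow> (real^'n \<Rightarrow> complex) \<Rightarrow> real"
  where "H1_norm \<phi> f = sqrt ((L2_norm (weighted \<phi>) f)\<^sup>2 +
    (\<Sum>j\<in>UNIV. (L2_norm (weighted \<phi>)
       (dist_rep (weighted \<phi>) (dist_partial j (regular_dist f))))\<^sup>2))"

definition H1_grad :: "(real^'n::finite \<Rightarrow> real) \<Rightarrow> (real^'n \<Rightarrow> complex) set"
  where "H1_grad \<phi> = {f \<in> L2 (weighted \<phi>).
    \<forall>j. dist_in_L2 (weighted \<phi>) (dist_X \<phi> j (regular_dist f))}"

definition H1_grad_norm :: "(real^'n::finite \<Rightarrow> real) \<Rightarrow> (real^'n \<Rightarrow> complex) \<Rightarrow> real"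
  where "H1_grad_norm \<phi> f = sqrt ((L2_norm (weighted \<phi>) f)\<^sup>2 +
    (\<Sum>j\<in>UNIV. (L2_norm (weighted \<phi>)
       (dist_rep (weighted \<phi>) (dist_X \<phi> j (regular_dist f))))\<^sup>2))"


section \<open>Compact operators\<close>

text \<open>An operator \<open>T\<close> from a space \<open>X\<close> of functions with (semi)norm \<open>N\<close> into \<open>L2 M\<close> is
  compact if it maps bounded sequences to sequences with a convergent subsequence.\<close>

definition compact_operator ::
    "('a \<Rightarrow> complex) set \<Rightarrow> (('a \<Rightarrow> complex) \<Rightarrow> real) \<Rightarrow>
     (('a \<Rightarrow> complex) \<Rightarrow> ('a \<Rightarrow> complex)) \<Rightarrow> 'a measure \<Rightarrow> bool"
  where "compact_operator X N T M \<longleftrightarrow>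
    (\<forall>u :: nat \<Rightarrow> 'a \<Rightarrow> complex. (\<forall>k. u k \<in> X) \<and> bounded (range (\<lambda>k. N (u k))) \<longrightarrow>
       (\<exists>r. \<exists>g\<in>L2 M. strict_mono (r :: nat \<Rightarrow> nat) \<and>
          (\<lambda>k. L2_norm M (\<lambda>x. T (u (r k)) x - g x)) \<longlonglongrightarrow> 0))"


section \<open>Unbounded operators in \<open>L\<^sup>2\<close>\<close>

text \<open>An unbounded operator is given by its graph.\<close>

type_synonym 'a operator = "(('a \<Rightarrow> complex) \<times> ('a \<Rightarrow> complex)) set"

definition densely_defined :: "'a measure \<Rightarrow> 'a operator \<Rightarrow> bool"
  where "densely_defined M A \<longleftrightarrow>
    (\<forall>f\<in>L2 M. \<forall>e>0. \<exists>u\<in>Domain A \<inter> L2 M. L2_norm M (\<lambda>x. f x - u x) < e)"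

definition adjoint_operator :: "'a measure \<Rightarrow> 'a operator \<Rightarrow> 'a operator"
  where "adjoint_operator M A = {(g, h). g \<in> L2 M \<and> h \<in> L2 M \<and>
    (\<forall>(f, k)\<in>A. L2_inner M k g = L2_inner M f h)}"

text \<open>An adjoint graph is contained in \<open>L2 M \<times> L2 M\<close>, linear and closed under changes on null
  sets; it is single-valued modulo null sets if the operator is densely defined. Hence the same
  holds for self-adjoint operators.\<close>

definition self_adjoint :: "'a measure \<Rightarrow> 'a operator \<Rightarrow> bool"
  where "self_adjoint M A \<longleftrightarrow> densely_defined M A \<and> adjoint_operator M A = A"

text \<open>\<open>z\<close> is in the resolvent set if \<open>A - z\<close> maps its domain bijectively onto \<open>L\<^sup>2\<close> with bounded
  inverse. The estimate includes injectivity (modulo null sets).\<close>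

definition resolvent_set :: "'a measure \<Rightarrow> 'a operator \<Rightarrow> complex set"
  where "resolvent_set M A = {z.
    (\<forall>g\<in>L2 M. \<exists>f. (f, \<lambda>x. g x + z * f x) \<in> A) \<and>
    (\<exists>C. \<forall>(f, k)\<in>A. L2_norm M f \<le> C * L2_norm M (\<lambda>x. k x - z * f x))}"

definition spectrum_of :: "'a measure \<Rightarrow> 'a operator \<Rightarrow> complex set"
  where "spectrum_of M A = - resolvent_set M A"

definition resolvent :: "'a operator \<Rightarrow> complex \<Rightarrow> ('a \<Rightarrow> complex) \<Rightarrow> ('a \<Rightarrow> complex)"
  where "resolvent A z g = (SOME f. (f, \<lambda>x. g x + z * f x) \<in> A)"

definition has_compact_resolvent :: "'a measure \<Rightarrow> 'a operator \<Rightarrow> bool"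
  where "has_compact_resolvent M A \<longleftrightarrow>
    (\<exists>z. z \<notin> spectrum_of M A \<and> compact_operator (L2 M) (L2_norm M) (resolvent A z) M)"


section \<open>Schroedinger operators\<close>

definition schrodinger_test :: "(real^'n::finite \<Rightarrow> real) \<Rightarrow> (real^'n) operator"
  where "schrodinger_test V =
    (\<lambda>f. (f, \<lambda>x. - laplacian f x + complex_of_real (V x) * f x)) ` test_functions"

text \<open>The self-adjoint operator determined by \<open>-\<triangle> + V\<close> on test functions. It exists
  and is unique if \<open>V\<close> is continuous and \<open>-\<triangle> + V\<close> is bounded below on test functions
  (essential self-adjointness). This applies to the potentials
  \<open>|\<nabla>\<phi>|\<^sup>2/4 \<mp> \<triangle>\<phi>/2\<close>, for which the operator is
  \<open>\<Sum>\<^sub>j Z\<^sub>j\<^sup>* Z\<^sub>j\<close> with \<open>Z\<^sub>j = \<partial>\<^sub>j \<plusminus> \<partial>\<^sub>j\<phi>/2\<close>.\<close>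

definition schrodinger_operator :: "(real^'n::finite \<Rightarrow> real) \<Rightarrow> (real^'n) operator"
  where "schrodinger_operator V =
    (THE A. self_adjoint lebesgue A \<and> schrodinger_test V \<subseteq> A)"

end

theory Submission
  imports Defs
begin

text \<open>
  Multiplication by \<open>e\<^bsup>-\<phi>/2\<^esup>\<close> maps \<open>L\<^sup>2(\<phi>)\<close> isometrically onto \<open>L\<^sup>2\<close> and turns \<open>\<partial>\<^sub>j\<close> and \<open>X\<^sub>j\<close> into
  \<open>Z\<^sub>j = \<partial>\<^sub>j + \<partial>\<^sub>ja\<close> with \<open>a = \<phi>/2\<close> and \<open>a = -\<phi>/2\<close> respectively. Thus both weighted Sobolev spaces
  become form domains \<open>Q\<close> of operators \<open>\<Sum>\<^sub>j Z\<^sub>j\<^sup>* Z\<^sub>j = -\<triangle> + |\<nabla>a|\<^sup>2 - \<triangle>a\<close>.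

  A solution \<open>u \<in> L\<^sup>2\<close> of \<open>\<Sum>\<^sub>j Z\<^sub>j\<^sup>* Z\<^sub>j u + u = 0\<close> vanishes: its mollifications \<open>v\<close> solve the equation up
  to an error that is small on compact sets, and testing with \<open>\<theta>\<^sup>2v\<close> for a slowly varying cut-off
  \<open>\<theta>\<close> bounds \<open>\<parallel>\<theta>v\<parallel>\<close> by a small multiple of \<open>\<parallel>u\<parallel>\<close>. Hence the adjoint \<open>A\<close> of the operator on test
  functions is self-adjoint, and \<open>R = (A + 1)\<^sup>-\<^sup>1\<close> is the operator with \<open>\<langle>Rg, w\<rangle>\<^sub>Q = \<langle>g, w\<rangle>\<close> for \<open>w \<in> Q\<close>
  given by Riesz representation. If \<open>Q\<close> embeds compactly, then \<open>R\<close> is compact because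
  \<open>\<parallel>Rg\<parallel>\<^sub>Q \<le> \<parallel>g\<parallel>\<close>. Conversely, \<open>\<parallel>w\<parallel>\<^sup>2 = \<langle>Rw, w\<rangle>\<^sub>Q\<close> and \<open>\<parallel>Rw\<parallel>\<^sub>Q\<^sup>2 = \<langle>w, Rw\<rangle>\<close> give
  \<open>\<parallel>w\<parallel>\<^sup>4 \<le> \<parallel>w\<parallel> \<parallel>Rw\<parallel> \<parallel>w\<parallel>\<^sub>Q\<^sup>2\<close>, so that compactness of \<open>R\<close> passes to the embedding.
\<close>

section \<open>Calculus of smooth functions\<close>

text \<open>The potential is not assumed to be bounded below, so semiboundedness enters only through
  the factorization, and uniqueness of the self-adjoint extension has to be proved. The obstacle
  there is regularity: a weak solution \<open>u\<close> is merely square-integrable, so it cannot be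
  cut off and used as a test function itself. Mollification makes the calculation classical at the
  price of a commutator of the potential with the convolution, which is small only on compact sets.
  This fixes the order of choices: first the width of the cut-off, then the radius of the mollifier.
  The form domain is the maximal one, all \<open>u\<close> whose weak \<open>Z_j u\<close> lie in
  \<open>L2\<close>, because the weighted Sobolev spaces are defined by distributions. That it
  belongs to the same operator as the test functions is what the uniqueness statement supplies. The
  shift by 1 turns the form into an inner product that dominates the one of \<open>L2\<close>. Hence
  \<open>-1\<close> is the resolvent point at which everything is computed, and a resolvent identity
  handles any other \<open>z\<close>.\<close>

lemma partial_deriv_eqI:
  assumes "(f has_derivative f') (at x)"
  shows "partial_deriv j f x = f' (axis j 1)"
proof -
  have 1: "((\<lambda>t. x + t *\<^sub>R axis j (1::real)) has_derivative (\<lambda>t. t *\<^sub>R axis j 1)) (at 0)"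
    by (auto intro!: derivative_eq_intros)
  have "((\<lambda>t. f (x + t *\<^sub>R axis j 1)) has_derivative (\<lambda>t. f' (t *\<^sub>R axis j 1))) (at 0)"
    using has_derivative_compose[OF 1, of f f'] assms by simp
  then have "((\<lambda>t. f (x + t *\<^sub>R axis j 1)) has_vector_derivative f' (axis j 1)) (at 0)"
    using has_derivative_linear[OF assms]
    by (simp add: has_vector_derivative_def linear_cmul)
  then show ?thesis
    unfolding partial_deriv_def by (rule vector_derivative_at)
qed

lemma has_derivative_partial_deriv:
  fixes f :: "real^'n::finite \<Rightarrow> 'b::real_normed_vector"
  assumes "f differentiable (at x)"
  shows "(f has_derivative (\<lambda>h. \<Sum>j\<in>UNIV. h $ j *\<^sub>R partial_deriv j f x)) (at x)"
proof -
  obtain f' where f': "(f has_derivative f') (at x)"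
    using assms by (auto simp: differentiable_def)
  have "f' h = (\<Sum>j\<in>UNIV. h $ j *\<^sub>R partial_deriv j f x)" for h
  proof -
    have "f' h = f' (\<Sum>j\<in>UNIV. h $ j *\<^sub>R axis j 1)"
      using basis_expansion[of h] by (simp add: scalar_mult_eq_scaleR)
    also have "\<dots> = (\<Sum>j\<in>UNIV. h $ j *\<^sub>R f' (axis j 1))"
      unfolding linear_sum[OF has_derivative_linear[OF f']]
        linear_cmul[OF has_derivative_linear[OF f']] ..
    finally show ?thesis unfolding partial_deriv_eqI[OF f'] .
  qed
  then have "f' = (\<lambda>h. \<Sum>j\<in>UNIV. h $ j *\<^sub>R partial_deriv j f x)" by auto
  with f' show ?thesis by simp
qed

lemma has_vector_derivative_partial_deriv:
  fixes f :: "real^'n::finite \<Rightarrow> 'b::real_normed_vector"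
  assumes "f differentiable (at (x + t *\<^sub>R axis j 1))"
  shows "((\<lambda>t. f (x + t *\<^sub>R axis j 1)) has_vector_derivative
     partial_deriv j f (x + t *\<^sub>R axis j 1)) (at t)"
proof -
  obtain f' where f': "(f has_derivative f') (at (x + t *\<^sub>R axis j 1))"
    using assms by (auto simp: differentiable_def)
  have 1: "((\<lambda>t. x + t *\<^sub>R axis j (1::real)) has_derivative (\<lambda>t. t *\<^sub>R axis j 1)) (at t)"
    by (auto intro!: derivative_eq_intros)
  have "((\<lambda>t. f (x + t *\<^sub>R axis j 1)) has_derivative (\<lambda>t. f' (t *\<^sub>R axis j 1))) (at t)"
    using has_derivative_compose[OF 1, of f f'] f' by simp
  then show ?thesis
    using has_derivative_linear[OF f'] partial_deriv_eqI[OF f', of j]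
    by (simp add: has_vector_derivative_def linear_cmul)
qed

section \<open>Closure properties of \<open>C_k\<close> and \<open>smooth\<close>\<close>

lemma differentiable_on_UNIV_D: "f differentiable_on UNIV \<Longrightarrow> f differentiable (at x)"
  by (simp add: differentiable_on_def)

text \<open>The product rule leaves one factor undifferentiated, so the induction for products needs
  both factors in the lower class as well. This descent supplies that.\<close>

lemma C_k_lower: "C_k (Suc k) f \<Longrightarrow> C_k k f"
proof (induction k arbitrary: f)
  case 0
  then show ?case by (auto intro: differentiable_imp_continuous_on)
next
  case (Suc k)
  then show ?case by auto
qed

lemma C_k_const: "C_k k (\<lambda>x. c)"
proof (induction k arbitrary: c)
  case (Suc k)
  have "partial_deriv j (\<lambda>x. c) = (\<lambda>x. 0)" for j :: 'a
    by (auto simp: fun_eq_iff partial_deriv_def)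
  then show ?case using Suc by (auto intro!: derivative_intros)
qed auto

lemma partial_deriv_bounded_linear:
  assumes "f differentiable_on UNIV" "bounded_linear L"
  shows "partial_deriv j (\<lambda>x. L (f x)) = (\<lambda>x. L (partial_deriv j f x))"
proof
  fix x
  from assms obtain f' where f': "(f has_derivative f') (at x)"
    by (auto simp: differentiable_on_def differentiable_def)
  have "((\<lambda>x. L (f x)) has_derivative (\<lambda>h. L (f' h))) (at x)"
    by (rule bounded_linear.has_derivative[OF assms(2) f'])
  then show "partial_deriv j (\<lambda>x. L (f x)) x = L (partial_deriv j f x)"
    using partial_deriv_eqI[OF f'] by (simp add: partial_deriv_eqI)
qed

lemma differentiable_on_bounded_linear:
  assumes "f differentiable_on S" "bounded_linear L"
  shows "(\<lambda>x. L (f x)) differentiable_on S"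
  using assms by (auto simp: differentiable_on_def differentiable_def
      intro: bounded_linear.has_derivative)

lemma C_k_bounded_linear:
  assumes "bounded_linear L"
  shows "C_k k f \<Longrightarrow> C_k k (\<lambda>x. L (f x))"
proof (induction k arbitrary: f)
  case 0
  then show ?case using bounded_linear.continuous_on[OF assms] by auto
next
  case (Suc k)
  then show ?case using differentiable_on_bounded_linear[OF _ assms]
    by (auto simp: partial_deriv_bounded_linear[OF _ assms])
qed

lemma partial_deriv_add:
  assumes "f differentiable_on UNIV" "g differentiable_on UNIV"
  shows "partial_deriv j (\<lambda>x. f x + g x) = (\<lambda>x. partial_deriv j f x + partial_deriv j g x)"
proof
  fix x
  from assms obtain f' g' where f': "(f has_derivative f') (at x)" "(g has_derivative g') (at x)"
    by (fastforce simp: differentiable_on_def differentiable_def)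
  show "partial_deriv j (\<lambda>x. f x + g x) x = partial_deriv j f x + partial_deriv j g x"
    using partial_deriv_eqI[OF has_derivative_add[OF f']] f'[THEN partial_deriv_eqI] by simp
qed

lemma C_k_add: "C_k k f \<Longrightarrow> C_k k g \<Longrightarrow> C_k k (\<lambda>x. f x + g x)"
proof (induction k arbitrary: f g)
  case 0
  then show ?case by (auto intro!: continuous_intros)
next
  case (Suc k)
  then show ?case by (auto simp: partial_deriv_add intro!: derivative_intros)
qed

lemma partial_deriv_bilinear:
  assumes "bounded_bilinear b" "f differentiable_on UNIV" "g differentiable_on UNIV"
  shows "partial_deriv j (\<lambda>x. b (f x) (g x)) = 
    (\<lambda>x. b (f x) (partial_deriv j g x) + b (partial_deriv j f x) (g x))"
proof
  fix x
  from assms obtain f' g' where f': "(f has_derivative f') (at x)" "(g has_derivative g') (at x)"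
    by (fastforce simp: differentiable_on_def differentiable_def)
  show "partial_deriv j (\<lambda>x. b (f x) (g x)) x = b (f x) (partial_deriv j g x) + b (partial_deriv j f x) (g x)"
    using partial_deriv_eqI[OF bounded_bilinear.FDERIV[OF assms(1) f']] f'[THEN partial_deriv_eqI] by simp
qed

lemma differentiable_on_bilinear:
  assumes "bounded_bilinear b" "f differentiable_on S" "g differentiable_on S"
  shows "(\<lambda>x. b (f x) (g x)) differentiable_on S"
  using assms bounded_bilinear.FDERIV[OF assms(1)]
  unfolding differentiable_on_def differentiable_def by blast

lemma C_k_bilinear:
  assumes "bounded_bilinear b"
  shows "C_k k f \<Longrightarrow> C_k k g \<Longrightarrow> C_k k (\<lambda>x. b (f x) (g x))"
proof (induction k arbitrary: f g)
  case 0
  then show ?case using bounded_bilinear.continuous_on[OF assms] by auto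
next
  case (Suc k)
  then have "C_k k f" "C_k k g" using C_k_lower by blast+
  with Suc show ?case using differentiable_on_bilinear[OF assms]
    by (auto simp: partial_deriv_bilinear[OF assms] intro!: C_k_add)
qed

lemma smooth_const [simp]: "smooth (\<lambda>x. c)"
  by (simp add: smooth_def C_k_const)

lemma smooth_add: "smooth f \<Longrightarrow> smooth g \<Longrightarrow> smooth (\<lambda>x. f x + g x)"
  by (simp add: smooth_def C_k_add)

lemma smooth_bounded_linear: "bounded_linear L \<Longrightarrow> smooth f \<Longrightarrow> smooth (\<lambda>x. L (f x))"
  by (simp add: smooth_def C_k_bounded_linear)

lemma smooth_bilinear: "bounded_bilinear b \<Longrightarrow> smooth f \<Longrightarrow> smooth g \<Longrightarrow> smooth (\<lambda>x. b (f x) (g x))"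
  by (simp add: smooth_def C_k_bilinear)

lemma smooth_imp_differentiable: "smooth f \<Longrightarrow> f differentiable_on UNIV"
  unfolding smooth_def using C_k.simps(2) by blast

lemma smooth_imp_continuous: "smooth f \<Longrightarrow> continuous_on UNIV f"
  unfolding smooth_def using C_k.simps(1) by blast

lemma smooth_partial_deriv: "smooth f \<Longrightarrow> smooth (partial_deriv j f)"
  unfolding smooth_def using C_k.simps(2) by blast

lemma smooth_mult:
  fixes f g :: "real^'n::finite \<Rightarrow> 'b::real_normed_algebra"
  shows "smooth f \<Longrightarrow> smooth g \<Longrightarrow> smooth (\<lambda>x. f x * g x)"
  by (rule smooth_bilinear[OF bounded_bilinear_mult])

lemma smooth_of_real:
  fixes f :: "real^'n::finite \<Rightarrow> real"
  shows "smooth f \<Longrightarrow> smooth (\<lambda>x. of_real (f x) :: 'b :: {real_normed_algebra_1})"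
  by (rule smooth_bounded_linear[OF bounded_linear_of_real])

lemma smooth_cnj: "smooth f \<Longrightarrow> smooth (\<lambda>x. cnj (f x))"
  by (rule smooth_bounded_linear[OF bounded_linear_cnj])

lemma smooth_minus: "smooth f \<Longrightarrow> smooth (\<lambda>x. - f x)"
  by (rule smooth_bounded_linear[OF bounded_linear_minus[OF bounded_linear_ident]])

lemma smooth_diff: "smooth f \<Longrightarrow> smooth g \<Longrightarrow> smooth (\<lambda>x. f x - g x)"
  using smooth_add[of f "\<lambda>x. - g x"] smooth_minus[of g] by simp

lemma smooth_sum: "(\<And>i. i \<in> I \<Longrightarrow> smooth (f i)) \<Longrightarrow> smooth (\<lambda>x. \<Sum>i\<in>I. f i x)"
  by (induction I rule: infinite_finite_induct) (auto intro: smooth_add)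

lemma smooth_prod:
  fixes f :: "'i \<Rightarrow> real^'n::finite \<Rightarrow> 'b::{real_normed_algebra_1, comm_ring_1}"
  shows "(\<And>i. i \<in> I \<Longrightarrow> smooth (f i)) \<Longrightarrow> smooth (\<lambda>x. \<Prod>i\<in>I. f i x)"
  by (induction I rule: infinite_finite_induct) (auto intro: smooth_mult)

lemma partial_deriv_mult:
  fixes f g :: "real^'n::finite \<Rightarrow> 'b::{real_normed_algebra, comm_ring}"
  assumes "smooth f" "smooth g"
  shows "partial_deriv j (\<lambda>x. f x * g x) = (\<lambda>x. partial_deriv j f x * g x + f x * partial_deriv j g x)"
  using partial_deriv_bilinear[OF bounded_bilinear_mult smooth_imp_differentiable smooth_imp_differentiable, OF assms]
  by (simp add: add.commute)

lemma partial_deriv_of_real: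
  fixes f :: "real^'n::finite \<Rightarrow> real"
  assumes "smooth f"
  shows "partial_deriv j (\<lambda>x. of_real (f x) :: 'b :: {real_normed_algebra_1}) = (\<lambda>x. of_real (partial_deriv j f x))"
  by (rule partial_deriv_bounded_linear[OF smooth_imp_differentiable[OF assms] bounded_linear_of_real])

lemma partial_deriv_cnj:
  assumes "smooth f"
  shows "partial_deriv j (\<lambda>x. cnj (f x)) = (\<lambda>x. cnj (partial_deriv j f x))"
  by (rule partial_deriv_bounded_linear[OF smooth_imp_differentiable[OF assms] bounded_linear_cnj])

lemma partial_deriv_minus:
  assumes "smooth f"
  shows "partial_deriv j (\<lambda>x. - f x) = (\<lambda>x. - (partial_deriv j f x))"
  by (rule partial_deriv_bounded_linear[OF smooth_imp_differentiable[OF assms] bounded_linear_minus[OF bounded_linear_ident]])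

lemma partial_deriv_const [simp]: "partial_deriv j (\<lambda>x. c) = (\<lambda>x. 0)"
  by (auto simp: fun_eq_iff partial_deriv_def)

lemma partial_deriv_cmult:
  fixes f :: "real^'n::finite \<Rightarrow> 'b::{real_normed_algebra, comm_ring}"
  assumes "smooth f"
  shows "partial_deriv j (\<lambda>x. c * f x) = (\<lambda>x. c * partial_deriv j f x)"
  using partial_deriv_mult[OF smooth_const[of c] assms, of j] by simp

section \<open>Chain rules: functions of one real variable, exponentials, affine
  substitutions\<close>

lemma partial_deriv_compose_real:
  assumes "\<And>x. (F has_real_derivative F' x) (at x)" "smooth g"
  shows "partial_deriv j (\<lambda>x. F (g x)) = (\<lambda>x. F' (g x) * partial_deriv j g x)"
    and "(\<lambda>x. F (g x)) differentiable_on UNIV"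
proof -
  have *: "((\<lambda>x. F (g x)) has_derivative (\<lambda>h. F' (g x) * g' h)) (at x)"
    if "(g has_derivative g') (at x)" for g' x
    using has_derivative_compose[OF that, of F "\<lambda>h. F' (g x) * h"] assms(1)[of "g x"]
    by (simp add: has_field_derivative_def)
  show "partial_deriv j (\<lambda>x. F (g x)) = (\<lambda>x. F' (g x) * partial_deriv j g x)"
  proof
    fix x
    from smooth_imp_differentiable[OF assms(2)] obtain g' where g': "(g has_derivative g') (at x)"
      by (auto simp: differentiable_on_def differentiable_def)
    show "partial_deriv j (\<lambda>x. F (g x)) x = F' (g x) * partial_deriv j g x"
      using partial_deriv_eqI[OF *[OF g']] partial_deriv_eqI[OF g'] by simp
  qed
  show "(\<lambda>x. F (g x)) differentiable_on UNIV"
    unfolding differentiable_on_def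
  proof
    fix x
    obtain g' where "(g has_derivative g') (at x)"
      using differentiable_on_UNIV_D[OF smooth_imp_differentiable[OF assms(2)]]
      unfolding differentiable_def by blast
    from differentiableI[OF *[OF this]]
    show "(\<lambda>x. F (g x)) differentiable at x" .
  qed
qed

text \<open>The sequence \<open>F\<close> of successive derivatives stands for a smooth function on
  the line, because \<open>C_k\<close> speaks of functions on \<open>real^'n\<close>. The induction
  runs over all \<open>m\<close> at once, since the chain rule passes from \<open>F m\<close> to
  \<open>F (Suc m)\<close>.\<close>

lemma smooth_compose_real:
  fixes F :: "nat \<Rightarrow> real \<Rightarrow> real"
  assumes F: "\<And>m x. (F m has_real_derivative F (Suc m) x) (at x)" and g: "smooth g"
  shows "smooth (\<lambda>x. F 0 (g x))"
proof -
  have "C_k k (\<lambda>x. F m (g x))" for k m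
  proof (induction k arbitrary: m)
    case 0
    have "continuous_on UNIV (F m)"
      using F by (meson DERIV_continuous continuous_at_imp_continuous_on)
    then have "continuous_on UNIV (\<lambda>x. F m (g x))"
      using smooth_imp_continuous[OF g] by (rule continuous_on_compose2) auto
    then show ?case by simp
  next
    case (Suc k)
    have "C_k k (partial_deriv j g)" for j
      using smooth_partial_deriv[OF g, of j] unfolding smooth_def by blast
    from C_k_bilinear[OF bounded_bilinear_mult Suc this]
    have "C_k k (\<lambda>x. F (Suc m) (g x) * partial_deriv j g x)" for j .
    then show ?case
      unfolding C_k.simps partial_deriv_compose_real(1)[of "F m" "F (Suc m)", OF F g]
      using partial_deriv_compose_real(2)[of "F m" "F (Suc m)", OF F g] by blast
  qed
  then show ?thesis by (simp add: smooth_def)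
qed

lemma smooth_exp: "smooth (g :: real^'n::finite \<Rightarrow> real) \<Longrightarrow> smooth (\<lambda>x. exp (g x))"
  by (rule smooth_compose_real[of "\<lambda>_. exp"]) (auto intro!: derivative_eq_intros)

lemma partial_deriv_exp:
  "smooth (g :: real^'n::finite \<Rightarrow> real) \<Longrightarrow>
    partial_deriv j (\<lambda>x. exp (g x)) = (\<lambda>x. exp (g x) * partial_deriv j g x)"
  by (rule partial_deriv_compose_real) (auto intro!: derivative_eq_intros)

lemma partial_deriv_affine:
  assumes "f differentiable_on UNIV"
  shows "partial_deriv j (\<lambda>x. f (c + s *\<^sub>R x)) = (\<lambda>x. s *\<^sub>R partial_deriv j f (c + s *\<^sub>R x))"
    and "(\<lambda>x. f (c + s *\<^sub>R x)) differentiable_on UNIV"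
proof -
  have *: "((\<lambda>x. f (c + s *\<^sub>R x)) has_derivative (\<lambda>h. f' (s *\<^sub>R h))) (at x)"
    if "(f has_derivative f') (at (c + s *\<^sub>R x))" for f' x
    by (rule has_derivative_compose[where f="\<lambda>x. c + s *\<^sub>R x" and g=f, OF _ that])
      (auto intro!: derivative_eq_intros)
  show "partial_deriv j (\<lambda>x. f (c + s *\<^sub>R x)) = (\<lambda>x. s *\<^sub>R partial_deriv j f (c + s *\<^sub>R x))"
  proof
    fix x
    from assms obtain f' where f': "(f has_derivative f') (at (c + s *\<^sub>R x))"
      by (auto simp: differentiable_on_def differentiable_def)
    show "partial_deriv j (\<lambda>x. f (c + s *\<^sub>R x)) x = s *\<^sub>R partial_deriv j f (c + s *\<^sub>R x)"
      using partial_deriv_eqI[OF *[OF f']] partial_deriv_eqI[OF f'] has_derivative_linear[OF f']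
      by (simp add: linear_cmul)
  qed
  show "(\<lambda>x. f (c + s *\<^sub>R x)) differentiable_on UNIV"
    unfolding differentiable_on_def
  proof
    fix x
    obtain f' where "(f has_derivative f') (at (c + s *\<^sub>R x))"
      using differentiable_on_UNIV_D[OF assms] unfolding differentiable_def by blast
    from differentiableI[OF *[OF this]]
    show "(\<lambda>x. f (c + s *\<^sub>R x)) differentiable at x" .
  qed
qed

lemma smooth_affine:
  assumes "smooth f"
  shows "smooth (\<lambda>x. f (c + s *\<^sub>R x))"
proof -
  have "C_k k f \<Longrightarrow> C_k k (\<lambda>x. f (c + s *\<^sub>R x))" for k
  proof (induction k arbitrary: f)
    case 0
    then have "continuous_on UNIV f" by simp
    then have "continuous_on UNIV (\<lambda>x. f (c + s *\<^sub>R x))"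
      by (rule continuous_on_compose2) (auto intro!: continuous_intros)
    then show ?case by simp
  next
    case (Suc k)
    then have d: "f differentiable_on UNIV" and *: "C_k k (\<lambda>x. partial_deriv j f (c + s *\<^sub>R x))" for j
      by auto
    show ?case
      unfolding C_k.simps partial_deriv_affine(1)[OF d]
      using partial_deriv_affine(2)[OF d] C_k_bounded_linear[OF bounded_linear_scaleR_right *] by blast
  qed
  with assms show ?thesis by (simp add: smooth_def)
qed

lemma smooth_component: "smooth (\<lambda>x :: real^'n::finite. x $ i)"
proof -
  have d: "((\<lambda>x :: real^'n. x $ i) has_derivative (\<lambda>h. h $ i)) (at x)" for x
    using bounded_linear_vec_nth by (rule bounded_linear_imp_has_derivative)
  have p: "partial_deriv j (\<lambda>x :: real^'n. x $ i) = (\<lambda>x. axis j 1 $ i)" for j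
    using partial_deriv_eqI[OF d] by (rule ext)
  have "(\<lambda>x :: real^'n. x $ i) differentiable_on UNIV"
    using d unfolding differentiable_on_def differentiable_def by blast
  \<comment> \<open>At order \<open>Suc k\<close> the claim is immediate, since all first partial
    derivatives are constant; \<open>C_k_lower\<close> then returns to order
    \<open>k\<close>.\<close>
  then have "C_k (Suc k) (\<lambda>x :: real^'n. x $ i)" for k
    unfolding C_k.simps p by (simp only: C_k_const simp_thms)
  then have "C_k k (\<lambda>x :: real^'n. x $ i)" for k
    by (rule C_k_lower)
  then show ?thesis by (simp add: smooth_def)
qed

section \<open>Test functions\<close>

lemma test_functionI:
  assumes "smooth \<psi>" "compact K" "\<And>x. x \<notin> K \<Longrightarrow> \<psi> x = 0"
  shows "\<psi> \<in> test_functions"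
proof -
  have "closure {x. \<psi> x \<noteq> 0} \<subseteq> K"
    using assms by (intro closure_minimal) (auto simp: compact_imp_closed)
  then have "compact (closure {x. \<psi> x \<noteq> 0})"
    using assms(2) by (metis closed_closure compact_Int_closed inf.absorb_iff2)
  with assms show ?thesis by (simp add: test_functions_def)
qed

lemma test_functionE:
  assumes "\<psi> \<in> test_functions"
  obtains R where "R > 0" "smooth \<psi>" "\<And>x. norm x > R \<Longrightarrow> \<psi> x = 0"
proof -
  have "bounded (closure {x. \<psi> x \<noteq> 0})"
    using assms by (simp add: test_functions_def compact_imp_bounded)
  then obtain R where "R > 0" "\<And>x. x \<in> closure {x. \<psi> x \<noteq> 0} \<Longrightarrow> norm x \<le> R"
    by (auto simp: bounded_pos)
  then have "\<psi> x = 0" if "norm x > R" for x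
    using closure_subset[of "{x. \<psi> x \<noteq> 0}"] that by force
  then show ?thesis using assms that[of R] \<open>R > 0\<close> by (auto simp: test_functions_def)
qed

lemma test_function_smooth: "\<psi> \<in> test_functions \<Longrightarrow> smooth \<psi>"
  by (simp add: test_functions_def)

lemma test_function_ballI:
  assumes "smooth \<psi>" "\<And>x. norm x > R \<Longrightarrow> \<psi> x = 0"
  shows "\<psi> \<in> test_functions"
  by (rule test_functionI[where K="cball 0 R"]) (use assms in auto)

lemma test_zero [simp]: "(\<lambda>x. 0) \<in> test_functions"
  by (rule test_function_ballI[where R=1]) auto

lemma test_add: 
  assumes "f \<in> test_functions" "g \<in> test_functions"
  shows "(\<lambda>x. f x + g x) \<in> test_functions"
proof -
  obtain R where "smooth f" "\<And>x. norm x > R \<Longrightarrow> f x = 0" using assms test_functionE by metis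
  moreover obtain S where "smooth g" "\<And>x. norm x > S \<Longrightarrow> g x = 0" using assms test_functionE by metis
  ultimately show ?thesis
    by (intro test_function_ballI[where R="max R S"]) (auto intro: smooth_add)
qed

lemma test_mult:
  assumes "smooth f" "g \<in> test_functions"
  shows "(\<lambda>x. f x * g x) \<in> test_functions"
proof -
  obtain S where "smooth g" "\<And>x. norm x > S \<Longrightarrow> g x = 0" using assms test_functionE by metis
  then show ?thesis using assms(1)
    by (intro test_function_ballI[where R="S"]) (auto intro: smooth_mult)
qed

lemma test_mult2:
  assumes "smooth f" "g \<in> test_functions"
  shows "(\<lambda>x. g x * f x) \<in> test_functions"
  using test_mult[OF assms] by (simp add: mult.commute)

lemma test_cnj:
  assumes "f \<in> test_functions"
  shows "(\<lambda>x. cnj (f x)) \<in> test_functions"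
proof -
  obtain S where "smooth f" "\<And>x. norm x > S \<Longrightarrow> f x = 0" using assms test_functionE by metis
  then show ?thesis
    by (intro test_function_ballI[where R="S"]) (auto intro: smooth_cnj)
qed

lemma test_cmult: "g \<in> test_functions \<Longrightarrow> (\<lambda>x. c * g x) \<in> test_functions"
  by (rule test_mult) auto

lemma test_minus: "g \<in> test_functions \<Longrightarrow> (\<lambda>x. - g x) \<in> test_functions"
  using test_cmult[of g "-1"] by simp

lemma test_diff: "f \<in> test_functions \<Longrightarrow> g \<in> test_functions \<Longrightarrow> (\<lambda>x. f x - g x) \<in> test_functions"
  using test_add[of f "\<lambda>x. - g x"] test_minus[of g] by simp

lemma test_sum: "(\<And>i. i \<in> I \<Longrightarrow> f i \<in> test_functions) \<Longrightarrow> (\<lambda>x. \<Sum>i\<in>I. f i x) \<in> test_functions"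
  by (induction I rule: infinite_finite_induct) (auto intro: test_add)

lemma partial_deriv_eq_0_outside:
  assumes "\<And>x. norm x > R \<Longrightarrow> f x = 0" "norm x > R"
  shows "partial_deriv j f x = 0"
proof -
  have "open {x :: real^'a. norm x > R}"
    by (intro open_Collect_less continuous_intros)
  then have "eventually (\<lambda>y. norm y > R) (nhds x)"
    using assms(2) by (auto simp: eventually_nhds)
  then have "eventually (\<lambda>y. 0 = f y) (nhds x)"
    by eventually_elim (use assms in auto)
  then have "eventually (\<lambda>y. 0 = f y) (at x within UNIV)"
    by (simp add: eventually_nhds_conv_at)
  then have "(f has_derivative (\<lambda>h. 0)) (at x)"
    by (rule has_derivative_transform_eventually[rotated]) (use assms in auto)
  then show ?thesis by (simp add: partial_deriv_eqI)
qed

lemma test_partial_deriv: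
  assumes "f \<in> test_functions"
  shows "partial_deriv j f \<in> test_functions"
proof -
  obtain S where "smooth f" "\<And>x. norm x > S \<Longrightarrow> f x = 0" using assms test_functionE by metis
  then show ?thesis using partial_deriv_eq_0_outside[of S f]
    by (intro test_function_ballI[where R="S"]) (auto intro: smooth_partial_deriv)
qed

text \<open>One lemma for all substitutions used below: translations in difference quotients, the
  reflection \<open>s = -1\<close> in convolution kernels, and dilations with small \<open>s\<close>
  for the slowly varying cut-off.\<close>

lemma test_affine:
  assumes "f \<in> test_functions" "s \<noteq> 0"
  shows "(\<lambda>x. f (c + s *\<^sub>R x)) \<in> test_functions"
proof -
  obtain S where S: "smooth f" "\<And>x. norm x > S \<Longrightarrow> f x = 0" using assms test_functionE by metis
  have "f (c + s *\<^sub>R x) = 0" if "norm x > (S + norm c) / \<bar>s\<bar>" for x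
  proof (rule S(2))
    have "S + norm c < \<bar>s\<bar> * norm x" using that assms(2) by (simp add: field_simps)
    also have "\<bar>s\<bar> * norm x = norm ((c + s *\<^sub>R x) - c)" by simp
    also have "\<dots> \<le> norm (c + s *\<^sub>R x) + norm c" by (rule norm_triangle_ineq4)
    finally show "S < norm (c + s *\<^sub>R x)" by simp
  qed
  then show ?thesis using S
    by (intro test_function_ballI) (auto intro: smooth_affine)
qed

lemma test_bounded:
  assumes "f \<in> test_functions"
  obtains B where "B > 0" "\<And>x. norm (f x) \<le> B"
proof -
  obtain S where S: "smooth f" "\<And>x. norm x > S \<Longrightarrow> f x = 0" using assms test_functionE by metis
  have "compact (f ` cball 0 S)"
    using smooth_imp_continuous[OF S(1)]
    by (intro compact_continuous_image) (auto intro: continuous_on_subset)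
  then obtain B where "B > 0" "\<And>y. y \<in> f ` cball 0 S \<Longrightarrow> norm y \<le> B"
    by (metis compact_imp_bounded bounded_pos)
  then have "norm (f x) \<le> B" for x
    using S(2)[of x] by (cases "norm x > S") auto
  with \<open>B > 0\<close> that show ?thesis by blast
qed

lemma test_measurable [measurable]: "f \<in> test_functions \<Longrightarrow> f \<in> borel_measurable borel"
  by (intro borel_measurable_continuous_onI smooth_imp_continuous test_function_smooth)

section \<open>The Hilbert space of square-integrable functions\<close>

lemma L2D:
  assumes "f \<in> L2 M"
  shows "f \<in> borel_measurable M" "integrable M (\<lambda>x. (cmod (f x))\<^sup>2)"
  using assms by (auto simp: L2_def)

lemma L2_zero [simp]: "(\<lambda>x. 0) \<in> L2 M"
  by (auto simp: L2_def)

lemma L2_add: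
  assumes "f \<in> L2 M" "g \<in> L2 M"
  shows "(\<lambda>x. f x + g x) \<in> L2 M"
proof -
  note [measurable] = L2D(1)[OF assms(1)] L2D(1)[OF assms(2)]
  have "(cmod (f x + g x))\<^sup>2 \<le> 2 * (cmod (f x))\<^sup>2 + 2 * (cmod (g x))\<^sup>2" for x
  proof -
    have "(cmod (f x + g x))\<^sup>2 \<le> (cmod (f x) + cmod (g x))\<^sup>2"
      by (intro power_mono norm_triangle_ineq) auto
    also have "\<dots> \<le> 2 * (cmod (f x))\<^sup>2 + 2 * (cmod (g x))\<^sup>2"
      using sum_squares_bound[of "cmod (f x)" "cmod (g x)"] by (simp add: power2_sum)
    finally show ?thesis .
  qed
  then have "integrable M (\<lambda>x. (cmod (f x + g x))\<^sup>2)"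
    using L2D(2)[OF assms(1)] L2D(2)[OF assms(2)]
    by (intro Bochner_Integration.integrable_bound[where g="\<lambda>x. (cmod (f x + g x))\<^sup>2" and
        f="\<lambda>x. 2 * (cmod (f x))\<^sup>2 + 2 * (cmod (g x))\<^sup>2"]) auto
  then show ?thesis by (auto simp: L2_def)
qed

lemma L2_cmult:
  assumes "f \<in> L2 M"
  shows "(\<lambda>x. c * f x) \<in> L2 M"
  using L2D[OF assms] by (auto simp: L2_def norm_mult power_mult_distrib)

lemma L2_minus: "f \<in> L2 M \<Longrightarrow> (\<lambda>x. - f x) \<in> L2 M"
  using L2_cmult[of f M "-1"] by simp

lemma L2_diff: "f \<in> L2 M \<Longrightarrow> g \<in> L2 M \<Longrightarrow> (\<lambda>x. f x - g x) \<in> L2 M"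
  using L2_add[of f M "\<lambda>x. - g x"] L2_minus[of g M] by simp

lemma L2_sum: "(\<And>i. i \<in> I \<Longrightarrow> f i \<in> L2 M) \<Longrightarrow> (\<lambda>x. \<Sum>i\<in>I. f i x) \<in> L2 M"
  by (induction I rule: infinite_finite_induct) (auto intro: L2_add)

lemma borel_measurable_cnj [measurable (raw)]:
  "f \<in> borel_measurable M \<Longrightarrow> (\<lambda>x. cnj (f x)) \<in> borel_measurable M"
  by (rule measurable_compose[OF _ borel_measurable_continuous_onI]) (auto intro!: continuous_intros)

lemma L2_cnj: "f \<in> L2 M \<Longrightarrow> (\<lambda>x. cnj (f x)) \<in> L2 M"
  by (auto simp: L2_def)

lemma L2_integrable_mult:
  assumes "f \<in> L2 M" "g \<in> L2 M"
  shows "integrable M (\<lambda>x. f x * g x)"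
proof -
  note [measurable] = L2D(1)[OF assms(1)] L2D(1)[OF assms(2)]
  have "norm (f x * g x) \<le> norm ((cmod (f x))\<^sup>2 + (cmod (g x))\<^sup>2)" for x
  proof -
    have "2 * (cmod (f x) * cmod (g x)) \<le> (cmod (f x))\<^sup>2 + (cmod (g x))\<^sup>2"
      using sum_squares_bound[of "cmod (f x)" "cmod (g x)"] by (simp only: mult.assoc)
    moreover have "0 \<le> cmod (f x) * cmod (g x)" by simp
    ultimately show ?thesis unfolding norm_mult real_norm_def by linarith
  qed
  then show ?thesis
    by (intro Bochner_Integration.integrable_bound[OF
          Bochner_Integration.integrable_add[OF L2D(2)[OF assms(1)] L2D(2)[OF assms(2)]]] AE_I2)
      measurable
qed

lemma L2_integrable_inner:
  assumes "f \<in> L2 M" "g \<in> L2 M"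
  shows "integrable M (\<lambda>x. f x * cnj (g x))"
  using L2_integrable_mult[OF assms(1) L2_cnj[OF assms(2)]] .

lemma L2_norm_nonneg: "L2_norm M f \<ge> 0"
  by (simp add: L2_norm_def)

lemma L2_norm_square: "(L2_norm M f)\<^sup>2 = (\<integral>x. (cmod (f x))\<^sup>2 \<partial>M)"
  by (simp add: L2_norm_def)

lemma L2_inner_self: "L2_inner M f f = of_real ((L2_norm M f)\<^sup>2)"
  by (simp add: L2_inner_def L2_norm_square complex_norm_square[symmetric] del: of_real_power)

lemma L2_inner_commute: "L2_inner M f g = cnj (L2_inner M g f)"
  unfolding L2_inner_def by (subst Bochner_Integration.integral_cnj[symmetric]) (simp add: mult.commute)

lemma L2_norm_eq_0_iff:
  assumes "f \<in> L2 M"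
  shows "L2_norm M f = 0 \<longleftrightarrow> (AE x in M. f x = 0)"
  using integral_nonneg_eq_0_iff_AE[OF L2D(2)[OF assms]] by (simp add: L2_norm_def)

lemma L2_norm_cong_AE:
  assumes "f \<in> borel_measurable M" "g \<in> borel_measurable M" "AE x in M. f x = g x"
  shows "L2_norm M f = L2_norm M g"
  unfolding L2_norm_def using assms by (intro arg_cong[where f=sqrt] integral_cong_AE) auto

lemma L2_nn_integral:
  assumes "f \<in> L2 M"
  shows "(\<integral>\<^sup>+x. ennreal ((cmod (f x))\<^sup>2) \<partial>M) = ennreal ((L2_norm M f)\<^sup>2)"
  using nn_integral_eq_integral[OF L2D(2)[OF assms]] by (simp add: L2_norm_square)

lemma L2_nn_integralI:
  assumes "f \<in> borel_measurable M" "(\<integral>\<^sup>+x. ennreal ((cmod (f x))\<^sup>2) \<partial>M) \<le> ennreal c" "c \<ge> 0"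
  shows "f \<in> L2 M" "(L2_norm M f)\<^sup>2 \<le> c"
proof -
  show f: "f \<in> L2 M"
    using assms le_less_trans[OF assms(2)]
    by (auto simp: L2_def intro!: integrableI_nonneg)
  show "(L2_norm M f)\<^sup>2 \<le> c"
    using L2_nn_integral[OF f] assms by simp
qed

text \<open>Riesz-Fischer. A subsequence with rapidly decreasing increments converges almost
  everywhere, and Fatou's lemma turns the Cauchy condition into an estimate of the distance to its
  pointwise limit.\<close>

lemma L2_Cauchy_convergent:
  fixes u :: "nat \<Rightarrow> 'a \<Rightarrow> complex"
  assumes u: "\<And>k. u k \<in> L2 M"
    and Cauchy: "\<And>e. e > 0 \<Longrightarrow> \<exists>N. \<forall>m\<ge>N. \<forall>n\<ge>N. L2_norm M (\<lambda>x. u m x - u n x) < e"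
  obtains g where "g \<in> L2 M" "(\<lambda>k. L2_norm M (\<lambda>x. u k x - g x)) \<longlonglongrightarrow> 0"
proof -
  note [measurable] = L2D(1)[OF u]
  have "\<exists>N. \<forall>k. \<forall>m\<ge>N k. \<forall>n\<ge>N k. L2_norm M (\<lambda>x. u m x - u n x) < (1/2)^k"
    by (intro choice allI Cauchy) auto
  then obtain N where N: "\<And>k m n. m \<ge> N k \<Longrightarrow> n \<ge> N k \<Longrightarrow> L2_norm M (\<lambda>x. u m x - u n x) < (1/2)^k"
    by blast
  \<comment> \<open>The sum makes \<open>r\<close> dominate every \<open>N i\<close> with
    \<open>i \<le> k\<close> although \<open>N\<close> need not be monotone, and the summand
    \<open>k\<close> lets \<open>r\<close> tend to infinity.\<close>
  define r where "r k = (\<Sum>i\<le>k. N i) + k" for k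
  have r_ge: "r k \<ge> N k" "r (Suc k) \<ge> N k" "r k \<ge> k" for k
  proof -
    have "N k \<le> (\<Sum>i\<le>k. N i)" by (rule member_le_sum) auto
    then show "r k \<ge> N k" "r (Suc k) \<ge> N k" "r k \<ge> k" by (auto simp: r_def)
  qed
  \<comment> \<open>The squared increments have integral at most \<open>(1/4)^k\<close>, so the
    weight \<open>2^k\<close> keeps the total finite. Pointwise, finiteness of the sum bounds each
    \<open>d k x\<close> by a constant, which makes the increments decay geometrically with ratio
    \<open>sqrt (1/2)\<close>.\<close>
  define d where "d k x = 2 ^ k * (cmod (u (r (Suc k)) x - u (r k) x))\<^sup>2" for k x
  have [measurable]: "d k \<in> borel_measurable M" for k
    unfolding d_def by measurable
  have int_d: "(\<integral>\<^sup>+x. ennreal (d k x) \<partial>M) \<le> ennreal ((1/2)^k)" for k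
  proof -
    have "(L2_norm M (\<lambda>x. u (r (Suc k)) x - u (r k) x))\<^sup>2 \<le> ((1/2)^k)\<^sup>2"
      using N[of k "r (Suc k)" "r k"] r_ge by (intro power_mono L2_norm_nonneg) (auto intro: less_imp_le)
    then have "2^k * (L2_norm M (\<lambda>x. u (r (Suc k)) x - u (r k) x))\<^sup>2 \<le> 2^k * ((1/2)^k)\<^sup>2"
      by simp
    also have "\<dots> = (1/2)^k"
      by (simp add: power2_eq_square field_simps power_divide)
    finally have *: "2^k * (L2_norm M (\<lambda>x. u (r (Suc k)) x - u (r k) x))\<^sup>2 \<le> (1/2)^k" .
    have "(\<integral>\<^sup>+x. ennreal (d k x) \<partial>M) = ennreal (2^k) * (\<integral>\<^sup>+x. ennreal ((cmod (u (r (Suc k)) x - u (r k) x))\<^sup>2) \<partial>M)"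
      by (subst nn_integral_cmult[symmetric]) (auto simp: d_def ennreal_mult)
    also have "\<dots> = ennreal (2^k * (L2_norm M (\<lambda>x. u (r (Suc k)) x - u (r k) x))\<^sup>2)"
      using L2_nn_integral[OF L2_diff[OF u u], of "r (Suc k)" "r k"]
      by (subst ennreal_mult) auto
    finally show ?thesis using * by (simp add: ennreal_leI)
  qed
  have "(\<integral>\<^sup>+x. (\<Sum>k. ennreal (d k x)) \<partial>M) = (\<Sum>k. \<integral>\<^sup>+x. ennreal (d k x) \<partial>M)"
    by (rule nn_integral_suminf) auto
  also have "\<dots> \<le> (\<Sum>k. ennreal ((1/2)^k))"
    by (intro suminf_le int_d) auto
  also have "\<dots> < \<infinity>"
    by (subst suminf_ennreal2) auto
  finally have "AE x in M. (\<Sum>k. ennreal (d k x)) \<noteq> \<infinity>"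
    by (intro nn_integral_PInf_AE) auto
  then have conv: "AE x in M. convergent (\<lambda>k. u (r k) x)"
  proof eventually_elim
    case (elim x)
    define c where "c = enn2real (\<Sum>k. ennreal (d k x))"
    have "d k x \<le> c" for k
    proof -
      have "ennreal (d k x) \<le> (\<Sum>k. ennreal (d k x))"
        using sum_le_suminf[of "\<lambda>k. ennreal (d k x)" "{k}"] by auto
      also have "\<dots> = ennreal c"
        unfolding c_def using elim by (simp add: top.not_eq_extremum)
      finally show ?thesis by (simp add: c_def ennreal_le_iff)
    qed
    then have "cmod (u (r (Suc k)) x - u (r k) x) \<le> sqrt c * (sqrt (1/2))^k" for k
    proof -
      have "(cmod (u (r (Suc k)) x - u (r k) x))\<^sup>2 \<le> c * (1/2)^k"
        using \<open>d k x \<le> c\<close> by (simp add: d_def field_simps power_divide)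
      then have "sqrt ((cmod (u (r (Suc k)) x - u (r k) x))\<^sup>2) \<le> sqrt (c * (1/2)^k)"
        by (rule real_sqrt_le_mono)
      then show ?thesis by (simp add: real_sqrt_mult real_sqrt_power)
    qed
    then have "summable (\<lambda>k. u (r (Suc k)) x - u (r k) x)"
      by (intro summable_comparison_test[OF _ summable_mult[OF summable_geometric[of "sqrt (1/2)"]]])
        (auto intro!: exI[of _ 0] simp: real_sqrt_less_iff)
    then have "convergent (\<lambda>n. \<Sum>k<n. u (r (Suc k)) x - u (r k) x)"
      by (simp add: summable_iff_convergent)
    then have "convergent (\<lambda>n. u (r n) x - u (r 0) x)"
      unfolding sum_lessThan_telescope[of "\<lambda>k. u (r k) x"] .
    then show ?case
      using convergent_add[OF _ convergent_const[of "u (r 0) x"]] by fastforce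
  qed
  define g where "g x = lim (\<lambda>k. u (r k) x)" for x
  have g_meas [measurable]: "g \<in> borel_measurable M"
    unfolding g_def by (rule borel_measurable_lim_metric) auto
  \<comment> \<open>The inner limit runs along the subsequence, but \<open>m\<close> is any late
    index of the original sequence. Hence the whole sequence converges in norm.\<close>
  have Fatou: "(\<integral>\<^sup>+x. ennreal ((cmod (u m x - g x))\<^sup>2) \<partial>M) \<le> ennreal (e\<^sup>2)"
    if mN: "\<forall>m\<ge>K. \<forall>n\<ge>K. L2_norm M (\<lambda>x. u m x - u n x) < e" and m: "m \<ge> K" for m e K
  proof -
    have "AE x in M. ennreal ((cmod (u m x - g x))\<^sup>2)
        = liminf (\<lambda>k. ennreal ((cmod (u m x - u (r k) x))\<^sup>2))"
      using conv
    proof eventually_elim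
      case (elim x)
      then have "(\<lambda>k. u (r k) x) \<longlonglongrightarrow> g x"
        by (simp add: g_def convergent_LIMSEQ_iff)
      then have "(\<lambda>k. ennreal ((cmod (u m x - u (r k) x))\<^sup>2)) \<longlonglongrightarrow> ennreal ((cmod (u m x - g x))\<^sup>2)"
        by (intro tendsto_intros)
      from lim_imp_Liminf[OF trivial_limit_sequentially this] show ?case ..
    qed
    then have "(\<integral>\<^sup>+x. ennreal ((cmod (u m x - g x))\<^sup>2) \<partial>M) =
        (\<integral>\<^sup>+x. liminf (\<lambda>k. ennreal ((cmod (u m x - u (r k) x))\<^sup>2)) \<partial>M)"
      by (rule nn_integral_cong_AE)
    also have "\<dots> \<le> liminf (\<lambda>k. \<integral>\<^sup>+x. ennreal ((cmod (u m x - u (r k) x))\<^sup>2) \<partial>M)"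
      by (rule nn_integral_liminf) auto
    also have "\<dots> \<le> liminf (\<lambda>k. ennreal (e\<^sup>2))"
    proof (rule Liminf_mono)
      show "\<forall>\<^sub>F k in sequentially. (\<integral>\<^sup>+x. ennreal ((cmod (u m x - u (r k) x))\<^sup>2) \<partial>M) \<le> ennreal (e\<^sup>2)"
        using eventually_ge_at_top[of K]
      proof eventually_elim
        case (elim k)
        then have "L2_norm M (\<lambda>x. u m x - u (r k) x) < e"
          using mN m r_ge(3)[of k] by auto
        then have "(L2_norm M (\<lambda>x. u m x - u (r k) x))\<^sup>2 \<le> e\<^sup>2"
          by (intro power_mono L2_norm_nonneg) auto
        then show ?case using L2_nn_integral[OF L2_diff[OF u u], of m "r k"]
          by (simp add: ennreal_leI)
      qed
    qed
    also have "\<dots> = ennreal (e\<^sup>2)" by (simp add: Liminf_const)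
    finally show ?thesis .
  qed
  have ug: "(\<lambda>x. u m x - g x) \<in> L2 M" "L2_norm M (\<lambda>x. u m x - g x) \<le> e"
    if "\<forall>m\<ge>K. \<forall>n\<ge>K. L2_norm M (\<lambda>x. u m x - u n x) < e" "m \<ge> K" "e > 0" for m e K
  proof -
    show "(\<lambda>x. u m x - g x) \<in> L2 M"
      by (rule L2_nn_integralI(1)[OF _ Fatou[OF that(1,2)]]) auto
    have "(L2_norm M (\<lambda>x. u m x - g x))\<^sup>2 \<le> e\<^sup>2"
      by (rule L2_nn_integralI(2)[OF _ Fatou[OF that(1,2)]]) auto
    then show "L2_norm M (\<lambda>x. u m x - g x) \<le> e"
      using that(3) by (simp add: abs_le_square_iff[symmetric] L2_norm_nonneg)
  qed
  obtain K where K: "\<forall>m\<ge>K. \<forall>n\<ge>K. L2_norm M (\<lambda>x. u m x - u n x) < 1"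
    using Cauchy[of 1] by auto
  have "g \<in> L2 M"
    using L2_diff[OF u[of K] ug(1)[OF K order_refl]] by simp
  moreover have "(\<lambda>k. L2_norm M (\<lambda>x. u k x - g x)) \<longlonglongrightarrow> 0"
  proof (rule LIMSEQ_I)
    fix e :: real assume "e > 0"
    then obtain K where K: "\<forall>m\<ge>K. \<forall>n\<ge>K. L2_norm M (\<lambda>x. u m x - u n x) < e/2"
      using Cauchy[of "e/2"] by auto
    have "norm (L2_norm M (\<lambda>x. u k x - g x) - 0) < e" if "k \<ge> K" for k
      using ug(2)[OF K that] \<open>e > 0\<close> L2_norm_nonneg[of M "\<lambda>x. u k x - g x"] by auto
    then show "\<exists>K. \<forall>k\<ge>K. norm (L2_norm M (\<lambda>x. u k x - g x) - 0) < e" by blast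
  qed
  ultimately show ?thesis using that by blast
qed

text \<open>Passing to classes modulo null sets makes square-integrable functions a type of class
  \<open>real_inner\<close> and \<open>complete_space\<close>, so that limits, closures and product
  Hilbert spaces become available. The relation is partial: a function outside
  \<open>L2 lebesgue\<close> is not even related to itself.\<close>

definition l2_rel :: "('a::euclidean_space \<Rightarrow> complex) \<Rightarrow> ('a \<Rightarrow> complex) \<Rightarrow> bool"
  where "l2_rel f g \<longleftrightarrow> f \<in> L2 lebesgue \<and> g \<in> L2 lebesgue \<and> (AE x in lebesgue. f x = g x)"

quotient_type (overloaded) 'a l2 = "'a::euclidean_space \<Rightarrow> complex" / partial: l2_rel
proof (rule part_equivpI)
  show "\<exists>x. l2_rel x x"
    by (rule exI[of _ "\<lambda>x. 0"]) (auto simp: l2_rel_def)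
  show "symp l2_rel"
    by (auto simp: symp_def l2_rel_def elim: eventually_mono)
  show "transp l2_rel"
  proof (rule transpI)
    fix f g h assume fg: "l2_rel f g" and gh: "l2_rel g h"
    then have "AE x in lebesgue. f x = g x" "AE x in lebesgue. g x = h x"
      by (auto simp: l2_rel_def)
    then have "AE x in lebesgue. f x = h x" by eventually_elim simp
    with fg gh show "l2_rel f h" by (simp add: l2_rel_def)
  qed
qed

instantiation l2 :: (euclidean_space) real_vector
begin

lift_definition zero_l2 :: "'a l2" is "\<lambda>x. 0" by (simp add: l2_rel_def)

lift_definition plus_l2 :: "'a l2 \<Rightarrow> 'a l2 \<Rightarrow> 'a l2" is "\<lambda>f g x. f x + g x"
  by (auto simp: l2_rel_def intro!: L2_add elim: eventually_elim2)

lift_definition minus_l2 :: "'a l2 \<Rightarrow> 'a l2 \<Rightarrow> 'a l2" is "\<lambda>f g x. f x - g x"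
  by (auto simp: l2_rel_def intro!: L2_diff elim: eventually_elim2)

lift_definition uminus_l2 :: "'a l2 \<Rightarrow> 'a l2" is "\<lambda>f x. - f x"
  by (auto simp: l2_rel_def intro!: L2_minus elim: eventually_mono)

lift_definition scaleR_l2 :: "real \<Rightarrow> 'a l2 \<Rightarrow> 'a l2" is "\<lambda>c f x. of_real c * f x"
  by (auto simp: l2_rel_def intro!: L2_cmult elim: eventually_mono)

instance
proof
  fix x y z :: "'a l2" and a b :: real
  show "x + y + z = x + (y + z)"
    by transfer (auto simp: l2_rel_def algebra_simps intro!: L2_add)
  show "x + y = y + x"
    by transfer (auto simp: l2_rel_def algebra_simps intro!: L2_add)
  show "0 + x = x"
    by transfer (auto simp: l2_rel_def)
  show "- x + x = 0"
    by transfer (auto simp: l2_rel_def)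
  show "x - y = x + - y"
    by transfer (auto simp: l2_rel_def intro!: L2_add L2_diff L2_minus)
  show "a *\<^sub>R (x + y) = a *\<^sub>R x + a *\<^sub>R y"
    by transfer (auto simp: l2_rel_def distrib_left intro!: L2_add L2_cmult)
  show "(a + b) *\<^sub>R x = a *\<^sub>R x + b *\<^sub>R x"
    by transfer (auto simp: l2_rel_def distrib_right intro!: L2_add L2_cmult)
  show "a *\<^sub>R b *\<^sub>R x = (a * b) *\<^sub>R x"
    by transfer (auto simp: l2_rel_def mult.assoc intro!: L2_add L2_cmult)
  show "1 *\<^sub>R x = x"
    by transfer (auto simp: l2_rel_def algebra_simps intro!: L2_add)
qed

end

instantiation l2 :: (euclidean_space) real_inner
begin

lift_definition norm_l2 :: "'a l2 \<Rightarrow> real" is "L2_norm lebesgue"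
  by (auto simp: l2_rel_def intro!: L2_norm_cong_AE dest: L2D)

text \<open>The real part of the Hermitian product induces the same norm. Complex identities are
  recovered from real ones by testing with \<open>\<i> * \<eta>\<close> besides
  \<open>\<eta>\<close>.\<close>

lift_definition inner_l2 :: "'a l2 \<Rightarrow> 'a l2 \<Rightarrow> real" is "\<lambda>f g. Re (L2_inner lebesgue f g)"
proof -
  fix f f' g g' :: "'a \<Rightarrow> complex"
  assume "l2_rel f f'" "l2_rel g g'"
  then have *: "f \<in> L2 lebesgue" "g \<in> L2 lebesgue" "f' \<in> L2 lebesgue" "g' \<in> L2 lebesgue"
    "AE x in lebesgue. f x = f' x" "AE x in lebesgue. g x = g' x" by (auto simp: l2_rel_def)
  then have "AE x in lebesgue. f x * cnj (g x) = f' x * cnj (g' x)"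
    by (auto elim: eventually_elim2)
  then show "Re (L2_inner lebesgue f g) = Re (L2_inner lebesgue f' g')"
    unfolding L2_inner_def using *
    by (intro arg_cong[where f=Re] integral_cong_AE borel_measurable_integrable[OF L2_integrable_inner]) auto
qed

definition dist_l2 :: "'a l2 \<Rightarrow> 'a l2 \<Rightarrow> real" where "dist_l2 x y = norm (x - y)"
definition sgn_l2 :: "'a l2 \<Rightarrow> 'a l2" where "sgn_l2 x = x /\<^sub>R norm x"
definition uniformity_l2 :: "('a l2 \<times> 'a l2) filter"
  where "uniformity_l2 = (INF e\<in>{0 <..}. principal {(x, y). dist x y < e})"
definition open_l2 :: "'a l2 set \<Rightarrow> bool"
  where "open_l2 U = (\<forall>x\<in>U. eventually (\<lambda>(x', y). x' = x \<longrightarrow> y \<in> U) uniformity)"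

instance
proof
  fix x y z :: "'a l2" and a :: real and U :: "'a l2 set"
  show "dist x y = norm (x - y)" by (rule dist_l2_def)
  show "sgn x = x /\<^sub>R norm x" by (rule sgn_l2_def)
  show "uniformity = (INF e\<in>{0 <..}. principal {(x, y::'a l2). dist x y < e})" by (rule uniformity_l2_def)
  show "open U = (\<forall>x\<in>U. eventually (\<lambda>(x', y). x' = x \<longrightarrow> y \<in> U) uniformity)" by (rule open_l2_def)
  show "inner x y = inner y x"
    by transfer (metis L2_inner_commute cnj.sel(1))
  show "inner (x + y) z = inner x z + inner y z"
    by transfer (simp add: L2_inner_def l2_rel_def distrib_right L2_integrable_inner)
  show "inner (a *\<^sub>R x) y = a * inner x y"
    by transfer (simp add: L2_inner_def mult.assoc)
  show "0 \<le> inner x x"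
    by transfer (simp add: L2_inner_self)
  show "(inner x x = 0) = (x = 0)"
    by transfer (simp add: L2_inner_self L2_norm_eq_0_iff l2_rel_def)
  show "norm x = sqrt (inner x x)"
    by transfer (simp add: L2_inner_self L2_norm_nonneg)
qed

end

abbreviation cls :: "('a::euclidean_space \<Rightarrow> complex) \<Rightarrow> 'a l2" where "cls \<equiv> abs_l2"

lemma l2_rel_refl: "f \<in> L2 lebesgue \<Longrightarrow> l2_rel f f"
  by (simp add: l2_rel_def)

lemma cls_cases:
  obtains f where "f \<in> L2 lebesgue" "x = cls f"
proof
  show "rep_l2 x \<in> L2 lebesgue"
    using Quotient3_rep_reflp[OF Quotient3_l2, of x] by (simp add: l2_rel_def)
  show "x = cls (rep_l2 x)"
    using Quotient3_abs_rep[OF Quotient3_l2, of x] by simp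
qed

lemma cls_add: "f \<in> L2 lebesgue \<Longrightarrow> g \<in> L2 lebesgue \<Longrightarrow> cls f + cls g = cls (\<lambda>x. f x + g x)"
  by (simp add: plus_l2.abs_eq l2_rel_refl)

lemma cls_diff: "f \<in> L2 lebesgue \<Longrightarrow> g \<in> L2 lebesgue \<Longrightarrow> cls f - cls g = cls (\<lambda>x. f x - g x)"
  by (simp add: minus_l2.abs_eq l2_rel_refl)

lemma cls_scaleR: "f \<in> L2 lebesgue \<Longrightarrow> c *\<^sub>R cls f = cls (\<lambda>x. of_real c * f x)"
  by (simp add: scaleR_l2.abs_eq l2_rel_refl)

lemma cls_zero: "cls (\<lambda>x. 0) = 0"
  by (simp add: zero_l2.abs_eq)

lemma norm_cls: "f \<in> L2 lebesgue \<Longrightarrow> norm (cls f) = L2_norm lebesgue f"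
  by (simp add: norm_l2.abs_eq l2_rel_refl)

lemma inner_cls: "f \<in> L2 lebesgue \<Longrightarrow> g \<in> L2 lebesgue \<Longrightarrow> inner (cls f) (cls g) = Re (L2_inner lebesgue f g)"
  by (simp add: inner_l2.abs_eq l2_rel_refl)

lemma cls_eq_iff:
  assumes "f \<in> L2 lebesgue" "g \<in> L2 lebesgue"
  shows "cls f = cls g \<longleftrightarrow> (AE x in lebesgue. f x = g x)"
  using Quotient3_rel_abs[OF Quotient3_l2] assms Quotient3_rel[OF Quotient3_l2, of f g]
  by (auto simp: l2_rel_def)

instance l2 :: (euclidean_space) complete_space
proof
  fix X :: "nat \<Rightarrow> 'a l2"
  assume X: "Cauchy X"
  have "\<exists>u. \<forall>k. u k \<in> L2 lebesgue \<and> X k = cls (u k)"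
    by (intro choice allI) (metis cls_cases)
  then obtain u where u: "\<And>k. u k \<in> L2 lebesgue" "\<And>k. X k = cls (u k)" by blast
  have "\<exists>N. \<forall>m\<ge>N. \<forall>n\<ge>N. L2_norm lebesgue (\<lambda>x. u m x - u n x) < e" if "e > 0" for e
    using CauchyD[OF X that] by (simp add: u cls_diff norm_cls L2_diff)
  then obtain g where g: "g \<in> L2 lebesgue" "(\<lambda>k. L2_norm lebesgue (\<lambda>x. u k x - g x)) \<longlonglongrightarrow> 0"
    using L2_Cauchy_convergent[of u lebesgue] u(1) by blast
  have "X \<longlonglongrightarrow> cls g"
    by (subst LIM_zero_iff[symmetric], subst tendsto_norm_zero_iff[symmetric])
      (simp add: u g(1) cls_diff norm_cls L2_diff g(2))
  then show "convergent X" by (auto simp: convergent_def)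
qed

section \<open>Orthogonal projection onto a closed subspace\<close>

lemma power2_norm_diff:
  fixes y z :: "'a::real_inner"
  shows "(norm (y - z))\<^sup>2 = (norm y)\<^sup>2 - 2 * inner y z + (norm z)\<^sup>2"
  unfolding power2_norm_eq_inner inner_diff_left inner_diff_right
  by (simp add: inner_commute)

text \<open>A minimizing sequence for the distance is Cauchy by the parallelogram law, because
  midpoints stay in \<open>S\<close>; minimality of its limit forces orthogonality. The lemma yields
  both the Riesz representative in the form domain and the density of test functions.\<close>

lemma orthogonal_projection:
  fixes S :: "'a::{real_inner, complete_space} set"
  assumes "subspace S" "closed S"
  obtains p where "p \<in> S" "\<And>s. s \<in> S \<Longrightarrow> inner (x - p) s = 0"
proof -
  have "S \<noteq> {}" using subspace_0[OF assms(1)] by auto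
  define d where "d = (INF s\<in>S. (norm (x - s))\<^sup>2)"
  have bdd: "bdd_below ((\<lambda>s. (norm (x - s))\<^sup>2) ` S)" by (rule bdd_belowI2[of _ 0]) simp
  have d_le: "d \<le> (norm (x - s))\<^sup>2" if "s \<in> S" for s
    unfolding d_def by (rule cINF_lower[OF bdd that])
  define \<delta> where "\<delta> k = inverse (real (Suc k))" for k
  have \<delta>: "\<delta> k > 0" "\<delta> \<longlonglongrightarrow> 0" for k
    using LIMSEQ_inverse_real_of_nat unfolding \<delta>_def[abs_def] by simp_all
  have "\<exists>s. \<forall>k. s k \<in> S \<and> (norm (x - s k))\<^sup>2 < d + \<delta> k"
  proof (intro choice allI)
    fix k
    show "\<exists>s. s \<in> S \<and> (norm (x - s))\<^sup>2 < d + \<delta> k"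
      using cINF_less_iff[OF \<open>S \<noteq> {}\<close> bdd, of "d + \<delta> k"]
        \<delta>(1)[of k] by (auto simp: d_def[symmetric])
  qed
  then obtain s where s: "\<And>k. s k \<in> S" "\<And>k. (norm (x - s k))\<^sup>2 < d + \<delta> k"
    by blast
  have par: "(norm (s m - s n))\<^sup>2 \<le> 2 * (\<delta> m + \<delta> n)" for m n
  proof -
    have "(1/2) *\<^sub>R (s m + s n) \<in> S"
      using s(1) assms(1) by (intro subspace_scale subspace_add)
    from d_le[OF this] have "4 * d \<le> 4 * (norm (x - (1/2) *\<^sub>R (s m + s n)))\<^sup>2" by simp
    also have "\<dots> = (norm ((x - s m) + (x - s n)))\<^sup>2"
    proof -
      have "(x - s m) + (x - s n) = 2 *\<^sub>R (x - (1/2) *\<^sub>R (s m + s n))"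
        by (simp add: algebra_simps scaleR_2)
      then show ?thesis by (simp add: power_mult_distrib)
    qed
    also have "\<dots> = 2 * (norm (x - s m))\<^sup>2 + 2 * (norm (x - s n))\<^sup>2 - (norm (s m - s n))\<^sup>2"
      by (simp add: power2_norm_eq_inner inner_add_left inner_add_right inner_diff_left
          inner_diff_right inner_commute)
    finally show ?thesis using s(2)[of m] s(2)[of n] by (simp add: algebra_simps)
  qed
  have "Cauchy s"
  proof (rule CauchyI)
    fix e :: real assume "e > 0"
    then obtain N where N: "\<delta> N < e\<^sup>2 / 4"
      using order_tendstoD(2)[OF \<delta>(2), of "e\<^sup>2/4"] by (auto simp: eventually_sequentially)
    have "norm (s m - s n) < e" if "m \<ge> N" "n \<ge> N" for m n
    proof -
      have "\<delta> m \<le> \<delta> N" "\<delta> n \<le> \<delta> N"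
        using that by (auto simp: \<delta>_def intro!: le_imp_inverse_le)
      then have "2 * (\<delta> m + \<delta> n) \<le> 4 * \<delta> N" by simp
      also have "\<dots> < e\<^sup>2" using N by simp
      finally have "(norm (s m - s n))\<^sup>2 < e\<^sup>2" using par[of m n] by (rule le_less_trans[rotated])
      then show ?thesis using \<open>e > 0\<close> by (simp add: power2_less_imp_less)
    qed
    then show "\<exists>M. \<forall>m\<ge>M. \<forall>n\<ge>M. norm (s m - s n) < e" by blast
  qed
  then obtain p where p: "s \<longlonglongrightarrow> p" using Cauchy_convergent convergent_def by blast
  have "p \<in> S" using closed_sequentially[OF assms(2) s(1) p] .
  have "(norm (x - p))\<^sup>2 \<le> d"
  proof (rule LIMSEQ_le)
    show "(\<lambda>k. (norm (x - s k))\<^sup>2) \<longlonglongrightarrow> (norm (x - p))\<^sup>2"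
      by (intro tendsto_intros p)
    have "(\<lambda>k. d + \<delta> k) \<longlonglongrightarrow> d + 0"
      by (intro tendsto_intros \<delta>)
    then show "(\<lambda>k. d + \<delta> k) \<longlonglongrightarrow> d" by simp
    show "\<exists>N. \<forall>n\<ge>N. (norm (x - s n))\<^sup>2 \<le> d + \<delta> n"
      using s(2) by (auto intro: less_imp_le)
  qed
  have orth: "inner (x - p) t = 0" if t: "t \<in> S" for t
  proof (cases "t = 0")
    case False
    \<comment> \<open>This \<open>c\<close> minimizes the norm of \<open>x - p - c t\<close> over
      the line spanned by \<open>t\<close>; any nonzero inner product would strictly reduce the
      distance.\<close>
    define c where "c = inner (x - p) t / inner t t"
    have "p + c *\<^sub>R t \<in> S" using \<open>p \<in> S\<close> t assms(1) by (intro subspace_add subspace_scale)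
    from d_le[OF this] \<open>(norm (x - p))\<^sup>2 \<le> d\<close>
    have "(norm (x - p))\<^sup>2 \<le> (norm ((x - p) - c *\<^sub>R t))\<^sup>2"
      unfolding diff_diff_eq by (rule order_trans[rotated])
    also have "\<dots> = (norm (x - p))\<^sup>2 - 2 * c * inner (x - p) t + c\<^sup>2 * inner t t"
      unfolding power2_norm_diff[of "x - p"] by (simp add: power_mult_distrib power2_norm_eq_inner[of t])
    also have "\<dots> = (norm (x - p))\<^sup>2 - (inner (x - p) t)\<^sup>2 / inner t t"
      using False by (simp add: c_def power2_eq_square field_simps)
    finally have "(inner (x - p) t)\<^sup>2 / inner t t \<le> 0" by simp
    moreover have "0 < inner t t" using False by simp
    ultimately have "(inner (x - p) t)\<^sup>2 \<le> 0" by (simp add: pos_divide_le_eq del: inner_gt_zero_iff)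
    then show ?thesis by simp
  qed simp
  show ?thesis using that[OF \<open>p \<in> S\<close> orth] .
qed

section \<open>A smooth approximation of the indicator function of a box\<close>

text \<open>For \<open>t > 0\<close> the derivative of \<open>p(1/t) exp(-1/t)\<close> is
  \<open>t^(-2) (p - p')(1/t) exp(-1/t)\<close>, which explains the recursion and the factor
  \<open>[:0, 0, 1:]\<close>. Thus \<open>exp_inverse m\<close> is the derivative of order
  \<open>m\<close> of the classical flat function that equals \<open>exp(-1/t)\<close> for
  \<open>t > 0\<close> and vanishes otherwise.\<close>

primrec exp_inverse_poly :: "nat \<Rightarrow> real poly" where
  "exp_inverse_poly 0 = 1"
| "exp_inverse_poly (Suc m) = [:0, 0, 1:] * (exp_inverse_poly m - pderiv (exp_inverse_poly m))"

definition exp_inverse :: "nat \<Rightarrow> real \<Rightarrow> real" where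
  "exp_inverse m t = (if t \<le> 0 then 0 else poly (exp_inverse_poly m) (1 / t) * exp (- (1 / t)))"

lemma poly_exp_tendsto_0: "((\<lambda>s. poly p s * exp (- s)) \<longlongrightarrow> 0) (at_top :: real filter)"
proof -
  have "((\<lambda>s. \<Sum>i\<le>degree p. coeff p i * (s ^ i / exp s)) \<longlongrightarrow> (\<Sum>i\<le>degree p. coeff p i * 0)) at_top"
    by (intro tendsto_intros tendsto_power_div_exp_0)
  moreover have "(\<Sum>i\<le>degree p. coeff p i * (s ^ i / exp s)) = poly p s * exp (- s)" for s
    by (simp add: poly_altdef sum_distrib_right exp_minus divide_inverse mult.assoc)
  ultimately show ?thesis by simp
qed

lemma exp_inverse_deriv: "(exp_inverse m has_real_derivative exp_inverse (Suc m) t) (at t)"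
proof -
  consider "t < 0" | "t > 0" | "t = 0" by linarith
  then show ?thesis
  proof cases
    case 1
    have "((\<lambda>t. 0) has_real_derivative 0) (at t)" by simp
    then have "(exp_inverse m has_real_derivative 0) (at t)"
      by (rule has_field_derivative_transform_within_open[where S="{..<0}"])
        (use 1 in \<open>auto simp: exp_inverse_def\<close>)
    then show ?thesis using 1 by (simp add: exp_inverse_def)
  next
    case 2
    have "((\<lambda>t. poly (exp_inverse_poly m) (1 / t) * exp (- (1 / t))) has_real_derivative
        exp_inverse (Suc m) t) (at t)"
      using 2 by (auto intro!: derivative_eq_intros DERIV_chain2[OF poly_DERIV]
          simp: exp_inverse_def field_simps power2_eq_square)
    then show ?thesis
      by (rule has_field_derivative_transform_within_open[where S="{0<..}"])
        (use 2 in \<open>auto simp: exp_inverse_def\<close>)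
  next
    case 3
    have "((\<lambda>h. (exp_inverse m h - exp_inverse m 0) / h) \<longlongrightarrow> 0) (at 0)"
      unfolding filterlim_split_at
    proof (intro conjI filterlim_split_at)
      show "((\<lambda>h. (exp_inverse m h - exp_inverse m 0) / h) \<longlongrightarrow> 0) (at_left 0)"
        by (rule tendsto_eventually) (auto simp: eventually_at_filter exp_inverse_def)
      \<comment> \<open>With \<open>s = 1/h\<close> the right-hand difference quotient at 0 is
        \<open>s p(s) exp(-s)\<close>. The extra factor \<open>s\<close> from the division by
        \<open>h\<close> is the polynomial \<open>[:0,1:]\<close>.\<close>
      have "((\<lambda>h. poly ([:0,1:] * exp_inverse_poly m) (inverse h) * exp (- (inverse h))) \<longlongrightarrow> 0) (at_right 0)"
        by (rule filterlim_compose[OF poly_exp_tendsto_0 filterlim_inverse_at_top_right])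
      then show "((\<lambda>h. (exp_inverse m h - exp_inverse m 0) / h) \<longlongrightarrow> 0) (at_right 0)"
        by (rule Lim_transform_eventually)
          (auto simp: eventually_at_filter exp_inverse_def field_simps)
    qed
    then show ?thesis using 3 by (simp add: DERIV_def exp_inverse_def)
  qed
qed

abbreviation exp_step :: "real \<Rightarrow> real" where "exp_step \<equiv> exp_inverse 0"

lemma exp_step_simps: "t \<le> 0 \<Longrightarrow> exp_step t = 0" "t > 0 \<Longrightarrow> exp_step t > 0" "0 \<le> exp_step t" "exp_step t \<le> 1"
  by (auto simp: exp_inverse_def)

lemma exp_step_tendsto: "(\<lambda>k. exp_step (real k * t)) \<longlonglongrightarrow> (if t > 0 then 1 else 0)"
proof (cases "t > 0")
  case True
  have "(\<lambda>k. exp (- ((1/t) * inverse (real k)))) \<longlonglongrightarrow> exp (- ((1/t) * 0))"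
    by (intro tendsto_intros lim_inverse_n)
  moreover have "\<forall>\<^sub>F k in sequentially. exp (- ((1/t) * inverse (real k))) = exp_step (real k * t)"
    using eventually_gt_at_top[of 0] by eventually_elim (use True in \<open>auto simp: exp_inverse_def field_simps mult_le_0_iff\<close>)
  ultimately show ?thesis using True by (auto intro: Lim_transform_eventually)
next
  case False
  then have "exp_step (real k * t) = 0" for k by (simp add: exp_step_simps mult_nonneg_nonpos)
  then show ?thesis using False by simp
qed

text \<open>A product of one-dimensional flat steps that is positive exactly on the open box when
  \<open>k > 0\<close>. With \<open>k = 1\<close> it provides mollifiers and cut-offs; for
  \<open>k\<close> tending to infinity it approximates the indicator of the box.\<close>

definition box_bump :: "real \<Rightarrow> real^'n::finite \<Rightarrow> real^'n \<Rightarrow> real^'n \<Rightarrow> real" where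
  "box_bump k a b x = (\<Prod>i\<in>UNIV. exp_step (k * (x $ i - a $ i)) * exp_step (k * (b $ i - x $ i)))"

lemma smooth_exp_step: "smooth g \<Longrightarrow> smooth (\<lambda>x. exp_step (g x))"
  by (rule smooth_compose_real[of exp_inverse, OF exp_inverse_deriv])

lemma smooth_box_bump: "smooth (box_bump k a b)"
  unfolding box_bump_def[abs_def]
  by (intro smooth_prod smooth_mult smooth_exp_step smooth_diff smooth_component smooth_const)

lemma box_bump_bounds: "0 \<le> box_bump k a b x" "box_bump k a b x \<le> 1"
  unfolding box_bump_def by (auto intro!: prod_nonneg prod_le_1 mult_nonneg_nonneg mult_le_one exp_step_simps)

lemma box_bump_eq_0:
  assumes "k \<ge> 0" "x \<notin> box a b"
  shows "box_bump k a b x = 0"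
proof -
  from assms(2) obtain i where "x $ i \<le> a $ i \<or> b $ i \<le> x $ i"
    by (auto simp: mem_box_cart not_less)
  then have "exp_step (k * (x $ i - a $ i)) * exp_step (k * (b $ i - x $ i)) = 0"
    using assms(1) by (auto simp: exp_step_simps mult_nonneg_nonpos)
  then show ?thesis unfolding box_bump_def by (intro prod_zero) auto
qed

lemma box_bump_pos:
  assumes "k > 0" "x \<in> box a b"
  shows "box_bump k a b x > 0"
  using assms unfolding box_bump_def by (auto intro!: prod_pos mult_pos_pos exp_step_simps simp: mem_box_cart)

lemma box_bump_tendsto: "(\<lambda>k. box_bump (real k) a b x) \<longlonglongrightarrow> indicator (box a b) x"
proof (cases "x \<in> box a b")
  case True
  have "(\<lambda>k. box_bump (real k) a b x) \<longlonglongrightarrow> (\<Prod>i\<in>UNIV. (if x $ i - a $ i > 0 then 1 else 0) * (if b $ i - x $ i > 0 then 1 else 0))"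
    unfolding box_bump_def by (intro tendsto_prod tendsto_mult exp_step_tendsto)
  then show ?thesis using True by (simp add: mem_box_cart)
qed (simp add: box_bump_eq_0)

lemma box_bump_test:
  assumes "k \<ge> 0"
  shows "(\<lambda>x. complex_of_real (box_bump k a b x)) \<in> test_functions"
  by (rule test_functionI[where K="cbox a b"])
    (use box_subset_cbox[of a b] assms in \<open>auto intro!: smooth_of_real smooth_box_bump box_bump_eq_0\<close>)

section \<open>Integration by parts\<close>

lemma integral_translation:
  fixes f :: "'a::euclidean_space \<Rightarrow> 'b::{banach, second_countable_topology}"
  assumes [measurable]: "f \<in> borel_measurable borel"
  shows "(\<integral>x. f (c + x) \<partial>lborel) = (\<integral>x. f x \<partial>lborel)"
proof -
  have "(\<integral>x. f x \<partial>lborel) = (\<integral>x. f x \<partial>distr lborel borel ((+) c))"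
    by (simp add: lborel_distr_plus)
  also have "\<dots> = (\<integral>x. f (c + x) \<partial>lborel)"
    by (rule integral_distr) auto
  finally show ?thesis ..
qed

lemma integrable_bounded_support:
  fixes f :: "'a::euclidean_space \<Rightarrow> 'b::{banach, second_countable_topology}"
  assumes "f \<in> borel_measurable borel" "\<And>x. norm x > R \<Longrightarrow> f x = 0" "\<And>x. norm (f x) \<le> B"
  shows "integrable lborel f"
proof (rule Bochner_Integration.integrable_bound)
  show "integrable lborel (\<lambda>x. B * indicator (cball (0::'a) R) x)"
    using emeasure_bounded_finite[of "cball (0::'a) R"]
    by (intro integrable_mult_right integrable_real_indicator) auto
  show "AE x in lborel. norm (f x) \<le> norm (B * indicator (cball 0 R) x)"
  proof (rule AE_I2)
    fix x
    show "norm (f x) \<le> norm (B * indicator (cball 0 R) x)"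
      using assms(2)[of x] order_trans[OF assms(3)[of x] abs_ge_self]
      by (cases "norm x > R") (auto simp: indicator_def)
  qed
qed (use assms in simp)

lemma test_integrable: 
  assumes "f \<in> test_functions"
  shows "integrable lborel f"
proof -
  obtain R where "\<And>x. norm x > R \<Longrightarrow> f x = 0" using assms test_functionE by metis
  moreover obtain B where "\<And>x. norm (f x) \<le> B" using assms test_bounded by metis
  ultimately show ?thesis
    using test_measurable[OF assms] by (rule integrable_bounded_support[rotated])
qed

lemma tendsto_difference_quotient:
  assumes "(f has_vector_derivative v) (at 0)"
  shows "((\<lambda>s. (f s - f 0) /\<^sub>R s) \<longlongrightarrow> v) (at 0)"
proof -
  have "((\<lambda>s. norm (f s - f 0 - s *\<^sub>R v) / norm s) \<longlongrightarrow> 0) (at 0)"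
    using assms by (simp add: has_vector_derivative_def has_derivative_at)
  then have "((\<lambda>s. norm ((f s - f 0) /\<^sub>R s - v)) \<longlongrightarrow> 0) (at 0)"
  proof (rule Lim_transform_eventually)
    have "norm (f s - f 0 - s *\<^sub>R v) / norm s = norm ((f s - f 0) /\<^sub>R s - v)" if "s \<noteq> 0" for s
    proof -
      have "(f s - f 0) /\<^sub>R s - v = (f s - f 0 - s *\<^sub>R v) /\<^sub>R s"
        using that by (simp add: scaleR_diff_right)
      then show ?thesis by (simp add: divide_inverse mult.commute)
    qed
    then show "\<forall>\<^sub>F s in at 0. norm (f s - f 0 - s *\<^sub>R v) / norm s = norm ((f s - f 0) /\<^sub>R s - v)"
      by (simp add: eventually_at_filter)
  qed
  then show ?thesis by (simp add: tendsto_norm_zero_iff LIM_zero_iff)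
qed

text \<open>Difference quotients have integral 0 by translation invariance. They are bounded by the
  supremum of the derivative and live in one fixed ball, so dominated convergence carries this over
  to the derivative.\<close>

lemma integral_partial_deriv:
  assumes f: "f \<in> test_functions"
  shows "(\<integral>x. partial_deriv j f x \<partial>lborel) = 0"
proof -
  note [measurable] = test_measurable[OF f] test_measurable[OF test_partial_deriv[OF f]]
  obtain R where R: "R > 0" "\<And>x. norm x > R \<Longrightarrow> f x = 0" using f test_functionE by metis
  obtain B where B: "\<And>x. norm (partial_deriv j f x) \<le> B"
    using test_bounded[OF test_partial_deriv[OF f]] by metis
  have lip: "norm (f (x + t *\<^sub>R axis j 1) - f x) \<le> B * \<bar>t\<bar>" for x and t :: real
  proof -
    have "norm (f (x + t *\<^sub>R axis j 1) - f (x + 0 *\<^sub>R axis j 1)) \<le> B * norm (t - 0)"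
    proof (rule differentiable_bound[of UNIV])
      fix t :: real
      show "((\<lambda>t. f (x + t *\<^sub>R axis j 1)) has_derivative
          (\<lambda>s. s *\<^sub>R partial_deriv j f (x + t *\<^sub>R axis j 1))) (at t within UNIV)"
        using has_vector_derivative_partial_deriv[OF differentiable_on_UNIV_D[OF
              smooth_imp_differentiable[OF test_function_smooth[OF f]]], where x=x and t=t and j=j]
        by (simp add: has_vector_derivative_def)
      show "onorm (\<lambda>s. s *\<^sub>R partial_deriv j f (x + t *\<^sub>R axis j 1)) \<le> B"
        by (rule onorm_le) (use B in \<open>auto simp: mult.commute[of B] intro!: mult_left_mono\<close>)
    qed auto
    then show ?thesis by simp
  qed
  define t where "t k = inverse (real (Suc k))" for k
  have t: "t k > 0" "t k \<le> 1" for k by (auto simp: t_def inverse_le_1_iff)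
  have "t \<longlonglongrightarrow> 0" unfolding t_def[abs_def] by (rule LIMSEQ_inverse_real_of_nat)
  define q where "q k x = (f (x + t k *\<^sub>R axis j 1) - f x) /\<^sub>R t k" for k x
  have [measurable]: "q k \<in> borel_measurable borel" for k unfolding q_def by measurable
  have "(\<lambda>k. \<integral>x. q k x \<partial>lborel) \<longlonglongrightarrow> (\<integral>x. partial_deriv j f x \<partial>lborel)"
  \<comment> \<open>The radius grows by 1 because the shifts satisfy
    \<open>t k \<le> 1\<close>.\<close>
  proof (rule integral_dominated_convergence[where w="\<lambda>x. B * indicator (cball 0 (R + 1)) x"])
    show "integrable lborel (\<lambda>x. B * indicator (cball (0::real^'a) (R+1)) x)"
      using emeasure_bounded_finite[of "cball (0::real^'a) (R+1)"]
      by (intro integrable_mult_right integrable_real_indicator) auto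
    show "AE x in lborel. (\<lambda>k. q k x) \<longlonglongrightarrow> partial_deriv j f x"
    proof (rule AE_I2)
      fix x
      have "((\<lambda>s. f (x + s *\<^sub>R axis j 1)) has_vector_derivative partial_deriv j f x) (at 0)"
        using has_vector_derivative_partial_deriv[OF differentiable_on_UNIV_D[OF
              smooth_imp_differentiable[OF test_function_smooth[OF f]]], where x=x and t=0 and j=j] by simp
      then have "((\<lambda>s. (f (x + s *\<^sub>R axis j 1) - f x) /\<^sub>R s) \<longlongrightarrow> partial_deriv j f x) (at 0)"
        using tendsto_difference_quotient by fastforce
      moreover have "filterlim t (at 0) sequentially"
        using t(1) \<open>t \<longlonglongrightarrow> 0\<close> by (auto simp: filterlim_at less_imp_neq[OF t(1), symmetric])
      ultimately show "(\<lambda>k. q k x) \<longlonglongrightarrow> partial_deriv j f x"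
        unfolding q_def by (rule filterlim_compose)
    qed
    show "AE x in lborel. norm (q k x) \<le> B * indicator (cball 0 (R + 1)) x" for k
    proof (rule AE_I2)
      fix x
      show "norm (q k x) \<le> B * indicator (cball 0 (R + 1)) x"
      proof (cases "norm x > R + 1")
        case True
        have "norm x \<le> norm (x + t k *\<^sub>R axis j 1) + norm (t k *\<^sub>R axis j (1::real))"
          using norm_triangle_ineq4[of "x + t k *\<^sub>R axis j 1" "t k *\<^sub>R axis j 1"] by simp
        then have "norm (x + t k *\<^sub>R axis j 1) > R" using True t[of k] by simp
        then show ?thesis using True R(2) by (simp add: q_def)
      next
        case False
        have "norm (q k x) = norm (f (x + t k *\<^sub>R axis j 1) - f x) / t k"
          using t(1)[of k] by (simp add: q_def divide_inverse mult.commute del: scaleR_diff_right)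
        also have "\<dots> \<le> B"
          using lip[of x "t k"] t(1)[of k] by (simp add: pos_divide_le_eq)
        finally show ?thesis using False by simp
      qed
    qed
  qed (use \<open>\<And>k. q k \<in> borel_measurable borel\<close> in auto)
  moreover have "(\<integral>x. q k x \<partial>lborel) = 0" for k
  proof -
    have f': "(\<lambda>x. f (t k *\<^sub>R axis j 1 + 1 *\<^sub>R x)) \<in> test_functions"
      by (rule test_affine[OF f]) auto
    have "(\<integral>x. q k x \<partial>lborel) = ((\<integral>x. f (t k *\<^sub>R axis j 1 + x) \<partial>lborel) - (\<integral>x. f x \<partial>lborel)) /\<^sub>R t k"
      unfolding q_def using test_integrable[OF f] test_integrable[OF f']
      by (simp add: add.commute)
    then show ?thesis by (simp add: integral_translation)
  qed
  ultimately show ?thesis by (simp add: LIMSEQ_const_iff)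
qed

lemma integral_by_parts:
  assumes "smooth f" "g \<in> test_functions"
  shows "(\<integral>x. f x * partial_deriv j g x \<partial>lborel) = - (\<integral>x. partial_deriv j f x * g x \<partial>lborel)"
proof -
  have "(\<integral>x. partial_deriv j f x * g x + f x * partial_deriv j g x \<partial>lborel) = 0"
    using integral_partial_deriv[OF test_mult[OF assms], of j]
    by (simp add: partial_deriv_mult[OF assms(1) test_function_smooth[OF assms(2)]])
  moreover have "integrable lborel (\<lambda>x. partial_deriv j f x * g x)"
    by (intro test_integrable test_mult smooth_partial_deriv assms)
  moreover have "integrable lborel (\<lambda>x. f x * partial_deriv j g x)"
    by (intro test_integrable test_mult test_partial_deriv assms)
  ultimately show ?thesis by (simp add: add_eq_0_iff)
qed

section \<open>The fundamental lemma of the calculus of variations\<close>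

text \<open>Positive and negative part of \<open>f\<close>, taken as densities, define measures that
  agree on boxes. Boxes form an intersection-stable generator exhausting the space by sets of finite
  measure, so the measures coincide, and uniqueness of densities makes the two parts equal.\<close>

lemma AE_eq_0_if_integral_box_eq_0:
  fixes f :: "'a::euclidean_space \<Rightarrow> real"
  assumes [measurable]: "f \<in> borel_measurable borel"
    and int: "\<And>a b. integrable lborel (\<lambda>x. indicator (box a b) x * f x)"
    and eq: "\<And>a b. (\<integral>x. indicator (box a b) x * f x \<partial>lborel) = 0"
  shows "AE x in lborel. f x = 0"
proof -
  \<comment> \<open>\<open>ennreal\<close> sends negative numbers to 0, so the two densities are the
    positive and the negative part of \<open>f\<close>.\<close>
  define P where "P = density lborel (\<lambda>x. ennreal (f x))"
  define N where "N = density lborel (\<lambda>x. ennreal (- f x))"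
  \<comment> \<open>\<open>enn2real\<close> maps infinity to 0, hence equality can be lifted back
    only between finite values.\<close>
  have cancel: "x = y" if "x \<noteq> \<infinity>" "y \<noteq> \<infinity>" "enn2real x = enn2real y" for x y :: ennreal
    using that by (cases x; cases y) auto
  have *: "emeasure P (box a b) = emeasure N (box a b) \<and> emeasure P (box a b) \<noteq> \<infinity>" for a b
  proof -
    let ?g = "\<lambda>x. indicator (box a b) x * f x"
    have P: "emeasure P (box a b) = (\<integral>\<^sup>+x. ennreal (?g x) \<partial>lborel)"
      unfolding P_def by (subst emeasure_density) (auto intro!: nn_integral_cong simp: indicator_def)
    have N: "emeasure N (box a b) = (\<integral>\<^sup>+x. ennreal (- ?g x) \<partial>lborel)"
      unfolding N_def by (subst emeasure_density) (auto intro!: nn_integral_cong simp: indicator_def)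
    have fin: "(\<integral>\<^sup>+x. ennreal (?g x) \<partial>lborel) \<noteq> \<infinity>" "(\<integral>\<^sup>+x. ennreal (- ?g x) \<partial>lborel) \<noteq> \<infinity>"
      using int[of a b] by (auto simp: real_integrable_def)
    have "enn2real (\<integral>\<^sup>+x. ennreal (?g x) \<partial>lborel) = enn2real (\<integral>\<^sup>+x. ennreal (- ?g x) \<partial>lborel)"
      using eq[of a b] real_lebesgue_integral_def[OF int[of a b]] by simp
    then have "(\<integral>\<^sup>+x. ennreal (?g x) \<partial>lborel) = (\<integral>\<^sup>+x. ennreal (- ?g x) \<partial>lborel)"
      using cancel[OF fin] by simp
    then show ?thesis using P N fin by simp
  qed
  have "P = N"
  proof (rule measure_eqI_generator_eq[where E="range (\<lambda>(a, b). box a b)" and \<Omega>=UNIV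
        and A="\<lambda>n. box (- real n *\<^sub>R One) (real n *\<^sub>R One)"])
    show "Int_stable (range (\<lambda>(a, b). box a b :: 'a set))"
      by (auto simp: Int_stable_def box_Int_box)
    show "(\<Union>i. box (- real i *\<^sub>R One) (real i *\<^sub>R One) :: 'a set) = UNIV"
      using UN_box_eq_UNIV by simp
    show "emeasure P X = emeasure N X" if "X \<in> range (\<lambda>(a, b). box a b)" for X
      using that * by auto
    show "emeasure P (box (- real i *\<^sub>R One) (real i *\<^sub>R One)) \<noteq> \<infinity>" for i
      using * by blast
  qed (auto simp: P_def N_def borel_eq_box)
  then have "AE x in lborel. ennreal (f x) = ennreal (- f x)"
    unfolding P_def N_def by (subst (asm) sigma_finite_measure.density_unique_iff[OF
          sigma_finite_lborel]) auto
  then show ?thesis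
  proof eventually_elim
    case (elim x)
    then show ?case by (cases "f x \<ge> 0") (auto simp: ennreal_neg ennreal_eq_0_iff dest!: sym[of 0])
  qed
qed

section \<open>Square-integrable functions on Euclidean space\<close>

lemma borel_imp_lebesgue_measurable:
  "f \<in> borel_measurable borel \<Longrightarrow> f \<in> borel_measurable lebesgue"
  by (simp add: measurable_completion)

lemma integral_lebesgue_eq_lborel:
  fixes f :: "'a::euclidean_space \<Rightarrow> 'b::{banach, second_countable_topology}"
  shows "f \<in> borel_measurable borel \<Longrightarrow> (\<integral>x. f x \<partial>lebesgue) = (\<integral>x. f x \<partial>lborel)"
  by (rule integral_completion) simp

lemma L2_lebesgue_iff_lborel:
  fixes f :: "'a::euclidean_space \<Rightarrow> complex"
  assumes "f \<in> borel_measurable borel"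
  shows "f \<in> L2 lebesgue \<longleftrightarrow> f \<in> L2 lborel"
  using assms borel_imp_lebesgue_measurable[OF assms]
  by (simp add: L2_def integrable_completion)

text \<open>Fubini, translations and reflections are carried out with Borel functions on
  \<open>lborel\<close>, whereas the theorem speaks of \<open>lebesgue\<close>. Changing a function
  on a null set mediates between the two.\<close>

lemma L2_lebesgue_borel_representative:
  assumes "u \<in> L2 lebesgue"
  obtains v where "v \<in> borel_measurable borel" "v \<in> L2 lborel" "v \<in> L2 lebesgue"
    "AE x in lebesgue. u x = v x"
proof -
  note [measurable] = L2D(1)[OF assms]
  obtain p where p: "p \<in> borel_measurable lborel" "AE x in lborel. Re (u x) = p x"
    using completion_ex_borel_measurable_real[of "\<lambda>x. Re (u x)" lborel] by auto
  obtain q where q: "q \<in> borel_measurable lborel" "AE x in lborel. Im (u x) = q x"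
    using completion_ex_borel_measurable_real[of "\<lambda>x. Im (u x)" lborel] by auto
  define v where "v x = Complex (p x) (q x)" for x
  have [measurable]: "p \<in> borel_measurable borel" "q \<in> borel_measurable borel" using p q by auto
  have v: "v \<in> borel_measurable borel"
    unfolding v_def Complex_eq by measurable
  have "AE x in lborel. u x = v x"
    using p(2) q(2) by eventually_elim (simp add: v_def complex_eq_iff)
  then have ae: "AE x in lebesgue. u x = v x" by (rule AE_completion)
  note [measurable] = borel_imp_lebesgue_measurable[OF v]
  have "integrable lebesgue (\<lambda>x. (cmod (v x))\<^sup>2)"
    using L2D(2)[OF assms] by (rule integrable_cong_AE_imp) (use ae in auto)
  then have "v \<in> L2 lebesgue" by (simp add: L2_def)
  then show ?thesis using that v ae L2_lebesgue_iff_lborel[OF v] by blast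
qed

lemma test_L2_lborel: "f \<in> test_functions \<Longrightarrow> f \<in> L2 lborel"
proof -
  assume f: "f \<in> test_functions"
  have "integrable lborel (\<lambda>x. f x * cnj (f x))"
    by (intro test_integrable test_mult test_cnj f test_function_smooth)
  then have "integrable lborel (\<lambda>x. Re (f x * cnj (f x)))" by (rule integrable_Re)
  moreover have "Re (f x * cnj (f x)) = (cmod (f x))\<^sup>2" for x
    by (simp add: complex_norm_square[symmetric] del: of_real_power)
  ultimately show ?thesis using test_measurable[OF f] by (simp add: L2_def)
qed

lemma test_L2: "f \<in> test_functions \<Longrightarrow> f \<in> L2 lebesgue"
  using test_L2_lborel L2_lebesgue_iff_lborel test_measurable by blast

lemma indicator_L2:
  assumes "bounded A" "A \<in> sets borel"
  shows "(\<lambda>x. indicator A x :: complex) \<in> L2 (lborel :: 'a::euclidean_space measure)"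
proof -
  have "integrable lborel (\<lambda>x. indicator A x :: real)"
    using emeasure_bounded_finite[OF assms(1)] assms(2) by (intro integrable_real_indicator) auto
  moreover have "(cmod (indicator A x))\<^sup>2 = indicator A x" for x :: 'a by (auto simp: indicator_def)
  ultimately show ?thesis using assms(2) by (simp add: L2_def)
qed

text \<open>The functions \<open>box_bump k\<close> converge to the indicator of the box and are
  dominated by it, so vanishing against test functions passes to vanishing integrals over boxes.
  Real and imaginary part are then treated separately.\<close>

lemma fundamental_lemma_borel:
  assumes u: "u \<in> L2 (lborel :: (real^'n::finite) measure)"
    and 0: "\<And>\<psi>. \<psi> \<in> test_functions \<Longrightarrow> (\<integral>x. u x * \<psi> x \<partial>lborel) = 0"
  shows "AE x in lborel. u x = 0"
proof -
  have [measurable]: "u \<in> borel_measurable borel" using L2D(1)[OF u] by simp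
  have int: "integrable lborel (\<lambda>x. u x * indicator (box a b) x)" for a b
    by (rule L2_integrable_mult[OF u indicator_L2]) auto
  have box: "(\<integral>x. u x * indicator (box a b) x \<partial>lborel) = 0" for a b
  proof -
    have "(\<lambda>k. \<integral>x. u x * of_real (box_bump (real k) a b x) \<partial>lborel)
       \<longlonglongrightarrow> (\<integral>x. u x * indicator (box a b) x \<partial>lborel)"
    proof (rule integral_dominated_convergence[where w="\<lambda>x. norm (u x * indicator (box a b) x)"])
      show "AE x in lborel. (\<lambda>k. u x * of_real (box_bump (real k) a b x)) \<longlonglongrightarrow> u x * indicator (box a b) x"
      proof (rule AE_I2)
        fix x
        have "(\<lambda>k. u x * complex_of_real (box_bump (real k) a b x)) \<longlonglongrightarrow> u x * of_real (indicator (box a b) x)"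
          by (intro tendsto_intros box_bump_tendsto)
        then show "(\<lambda>k. u x * of_real (box_bump (real k) a b x)) \<longlonglongrightarrow> u x * indicator (box a b) x"
          by (cases "x \<in> box a b") simp_all
      qed
      show "AE x in lborel. norm (u x * complex_of_real (box_bump (real k) a b x)) \<le> norm (u x * indicator (box a b) x)" for k
      proof (rule AE_I2)
        fix x
        show "norm (u x * complex_of_real (box_bump (real k) a b x)) \<le> norm (u x * indicator (box a b) x)"
          using box_bump_bounds[of "real k" a b x] box_bump_eq_0[of "real k" x a b]
          by (cases "x \<in> box a b") (auto simp: norm_mult intro!: mult_left_le)
      qed
      show "(\<lambda>x. u x * complex_of_real (box_bump (real k) a b x)) \<in> borel_measurable lborel" for k
        using test_measurable[OF box_bump_test[of "real k" a b]] by simp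
    qed (use int in auto)
    moreover have "(\<integral>x. u x * of_real (box_bump (real k) a b x) \<partial>lborel) = 0" for k
      by (rule 0) (rule box_bump_test, simp)
    ultimately show ?thesis by (simp add: LIMSEQ_const_iff)
  qed
  have "AE x in lborel. Re (u x) = 0"
  proof (rule AE_eq_0_if_integral_box_eq_0)
    fix a b :: "real^'n"
    have eq: "indicator (box a b) x * Re (u x) = Re (u x * indicator (box a b) x)" for x
      by (auto simp: indicator_def)
    show "integrable lborel (\<lambda>x. indicator (box a b) x * Re (u x))"
      unfolding eq using int by (rule integrable_Re)
    show "(\<integral>x. indicator (box a b) x * Re (u x) \<partial>lborel) = 0"
      unfolding eq using integral_Re[OF int[of a b]] box by simp
  qed measurable
  moreover have "AE x in lborel. Im (u x) = 0"
  proof (rule AE_eq_0_if_integral_box_eq_0)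
    fix a b :: "real^'n"
    have eq: "indicator (box a b) x * Im (u x) = Im (u x * indicator (box a b) x)" for x
      by (auto simp: indicator_def)
    show "integrable lborel (\<lambda>x. indicator (box a b) x * Im (u x))"
      unfolding eq using int by (rule integrable_Im)
    show "(\<integral>x. indicator (box a b) x * Im (u x) \<partial>lborel) = 0"
      unfolding eq using integral_Im[OF int[of a b]] box by simp
  qed measurable
  ultimately show ?thesis by eventually_elim (simp add: complex_eq_iff)
qed

section \<open>Convolution with test functions\<close>

lemma test_uniformly_continuous:
  assumes f: "f \<in> test_functions" and "e > 0"
  obtains d where "d > 0" "\<And>x y. norm (x - y) < d \<Longrightarrow> norm (f x - f y) < e"
proof -
  obtain R where R: "R > 0" "smooth f" "\<And>x. norm x > R \<Longrightarrow> f x = 0" using f test_functionE by metis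
  have "uniformly_continuous_on (cball 0 (R + 1)) f"
    using smooth_imp_continuous[OF R(2)]
    by (intro compact_uniformly_continuous) (auto intro: continuous_on_subset)
  then obtain d where d: "d > 0"
    "\<And>x y. x \<in> cball 0 (R+1) \<Longrightarrow> y \<in> cball 0 (R+1) \<Longrightarrow> dist y x < d \<Longrightarrow> dist (f y) (f x) < e"
    unfolding uniformly_continuous_on_def using \<open>e > 0\<close> by metis
  \<comment> \<open>Points at distance below 1 both lie outside the ball of radius \<open>R\<close>
    as soon as one of them leaves the ball of radius \<open>R + 1\<close>; there \<open>f\<close>
    vanishes.\<close>
  have "norm (f x - f y) < e" if xy: "norm (x - y) < min d 1" for x y
  proof (cases "norm x \<le> R + 1 \<and> norm y \<le> R + 1")
    case True
    then show ?thesis using d(2)[of y x] xy by (simp add: dist_norm)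
  next
    case False
    have "norm x \<le> norm (x - y) + norm y" "norm y \<le> norm (x - y) + norm x"
      using norm_triangle_ineq[of "x - y" y] norm_triangle_ineq[of "y - x" x]
      by (simp_all add: norm_minus_commute)
    then have "norm x > R" "norm y > R" using False xy by auto
    then show ?thesis using R(3) \<open>e > 0\<close> by simp
  qed
  then show ?thesis using that[of "min d 1"] d(1) by auto
qed

text \<open>The remainder of the first-order expansion must be uniform in \<open>z\<close>, because
  convolution integrates it over \<open>z\<close>. Uniform continuity of the partial derivatives and
  the mean value inequality give this. The bound \<open>d \<le> 1\<close> later keeps the shifted
  supports in one ball.\<close>

lemma test_uniformly_differentiable:
  fixes f :: "real^'n::finite \<Rightarrow> complex"
  assumes f: "f \<in> test_functions" and "e > 0"
  obtains d where "d > 0" "d \<le> 1"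
    "\<And>z h. norm h < d \<Longrightarrow> norm (f (z + h) - f z - (\<Sum>j\<in>UNIV. h $ j *\<^sub>R partial_deriv j f z)) \<le> e * norm h"
proof -
  \<comment> \<open>Each coordinate of \<open>k\<close> is at most \<open>norm k\<close>, so the sum
    over the coordinates costs a factor equal to the dimension.\<close>
  define e' where "e' = e / real CARD('n)"
  have "e' > 0" using \<open>e > 0\<close> by (simp add: e'_def)
  have "\<exists>d. \<forall>j. d j > 0 \<and> (\<forall>x y. norm (x - y) < d j \<longrightarrow> norm (partial_deriv j f x - partial_deriv j f y) < e')"
    by (intro choice allI) (metis test_uniformly_continuous[OF test_partial_deriv[OF f] \<open>e' > 0\<close>])
  then obtain d where d: "\<And>j. d j > 0"
    "\<And>j x y. norm (x - y) < d j \<Longrightarrow> norm (partial_deriv j f x - partial_deriv j f y) < e'" by blast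
  define D where "D = min 1 (Min (range d))"
  have D: "D > 0" "D \<le> 1" "D \<le> d j" for j
    using d(1) by (auto simp: D_def intro: min.coboundedI2 Min_le)
  let ?f' = "\<lambda>x h. \<Sum>j\<in>UNIV. h $ j *\<^sub>R partial_deriv j f x"
  have "norm (f (z + h) - f z - ?f' z h) \<le> e * norm h" if h: "norm h < D" for z h
  proof -
    have "norm (f (z + h) - f z - ?f' z ((z + h) - z)) \<le> norm ((z + h) - z) * e"
    proof (rule differentiable_bound_linearization[of z "z + h" "ball z D" f "?f'" z e])
      fix t :: real assume "t \<in> {0..1}"
      then have "\<bar>t\<bar> * norm h \<le> 1 * norm h" by (intro mult_right_mono) auto
      with h have "norm (t *\<^sub>R h) < D" by simp
      moreover have "dist z (z + t *\<^sub>R (z + h - z)) = norm (t *\<^sub>R h)"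
        unfolding dist_norm by (metis add_diff_cancel_left' minus_diff_eq norm_minus_cancel)
      ultimately show "z + t *\<^sub>R (z + h - z) \<in> ball z D" unfolding mem_ball by (simp only:)
    next
      fix x
      show "(f has_derivative ?f' x) (at x within ball z D)"
        by (rule has_derivative_at_withinI[OF has_derivative_partial_deriv[OF differentiable_on_UNIV_D[OF
                smooth_imp_differentiable[OF test_function_smooth[OF f]]]]])
    next
      fix x assume "x \<in> ball z D"
      then have x: "norm (x - z) < D" by (simp add: dist_norm norm_minus_commute)
      show "onorm (?f' x - ?f' z) \<le> e"
      proof (rule onorm_le)
        fix k :: "real^'n"
        have "norm ((?f' x - ?f' z) k) = norm (\<Sum>j\<in>UNIV. k $ j *\<^sub>R (partial_deriv j f x - partial_deriv j f z))"
          by (simp add: sum_subtractf scaleR_diff_right)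
        also have "\<dots> \<le> (\<Sum>j\<in>(UNIV::'n set). norm k * e')"
        proof (rule sum_norm_le)
          fix j
          show "norm (k $ j *\<^sub>R (partial_deriv j f x - partial_deriv j f z)) \<le> norm k * e'"
            unfolding norm_scaleR
            using d(2)[OF less_le_trans[OF x D(3)], of j] \<open>e' > 0\<close>
            by (intro mult_mono component_le_norm_cart) auto
        qed
        also have "\<dots> = e * norm k" by (simp add: e'_def)
        finally show "norm ((?f' x - ?f' z) k) \<le> e * norm k" .
      qed
    qed (use D in auto)
    then show ?thesis by (simp add: mult.commute)
  qed
  with D(1,2) that show ?thesis by blast
qed

text \<open>The product of the potential with a square-integrable function need not be
  square-integrable. Local integrability covers it as well and is enough for pairings with test
  functions.\<close>

definition locally_integrable :: "('a::euclidean_space \<Rightarrow> complex) \<Rightarrow> bool" where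
  "locally_integrable u \<longleftrightarrow> u \<in> borel_measurable borel \<and>
    (\<forall>R. integrable lborel (\<lambda>x. u x * indicator (cball 0 R) x))"

lemma L2_locally_integrable:
  "u \<in> L2 lborel \<Longrightarrow> locally_integrable u"
  unfolding locally_integrable_def
  using L2_integrable_mult[OF _ indicator_L2[of "cball 0 _"]] L2D(1) by fastforce

lemma locally_integrable_mult:
  assumes "locally_integrable u" "continuous_on UNIV w"
  shows "locally_integrable (\<lambda>x. w x * u x)"
  unfolding locally_integrable_def
proof (intro conjI allI)
  have [measurable]: "w \<in> borel_measurable borel" "u \<in> borel_measurable borel"
    using assms by (auto simp: locally_integrable_def intro: borel_measurable_continuous_onI)
  show "(\<lambda>x. w x * u x) \<in> borel_measurable borel" by measurable
  fix R
  have "bounded (w ` cball 0 R)"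
    using assms(2) by (intro compact_imp_bounded compact_continuous_image)
      (auto intro: continuous_on_subset)
  then obtain B where B: "\<And>x. x \<in> cball 0 R \<Longrightarrow> norm (w x) \<le> B"
    unfolding bounded_iff by blast
  show "integrable lborel (\<lambda>x. w x * u x * indicator (cball 0 R) x)"
  proof (rule Bochner_Integration.integrable_bound)
    show "integrable lborel (\<lambda>x. of_real B * (u x * indicator (cball 0 R) x))"
      using assms(1) by (auto simp: locally_integrable_def)
    show "AE x in lborel. norm (w x * u x * indicator (cball 0 R) x) \<le> norm (of_real B * (u x * indicator (cball 0 R) x))"
      using B by (intro AE_I2) (auto simp: indicator_def norm_mult intro!: mult_right_mono order_trans[OF _ abs_ge_self])
    show "(\<lambda>x. w x * u x * indicator (cball 0 R) x) \<in> borel_measurable lborel"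
      by (intro borel_measurable_times borel_measurable_indicator) auto
  qed
qed

definition conv :: "(real^'n::finite \<Rightarrow> complex) \<Rightarrow> (real^'n \<Rightarrow> complex) \<Rightarrow> real^'n \<Rightarrow> complex" where
  "conv u \<rho> x = (\<integral>y. u y * \<rho> (x - y) \<partial>lborel)"

text \<open>The supremum of \<open>g\<close> against the local mass of \<open>u\<close>: this one
  estimate controls both the remainder when differentiating a convolution and the error of
  mollification.\<close>

lemma conv_integrable_bound:
  assumes u: "locally_integrable u" and [measurable]: "g \<in> borel_measurable borel"
    and g: "\<And>y. norm y > R \<Longrightarrow> g y = 0" "\<And>y. norm (g y) \<le> B"
  shows "integrable lborel (\<lambda>y. u y * g y)"
    "norm (\<integral>y. u y * g y \<partial>lborel) \<le> B * (\<integral>y. norm (u y * indicator (cball 0 R) y) \<partial>lborel)"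
proof -
  have [measurable]: "u \<in> borel_measurable borel" and
    int: "integrable lborel (\<lambda>y. u y * indicator (cball 0 R) y)"
    using u by (auto simp: locally_integrable_def)
  have *: "norm (u y * g y) \<le> B * norm (u y * indicator (cball 0 R) y)" for y
    using g(1)[of y] g(2)[of y] mult_left_mono[OF g(2)[of y], of "norm (u y)"]
    by (cases "norm y > R") (auto simp: norm_mult mult.commute)
  show 1: "integrable lborel (\<lambda>y. u y * g y)"
  proof (rule Bochner_Integration.integrable_bound)
    show "integrable lborel (\<lambda>y. B * norm (u y * indicator (cball 0 R) y))"
      using int by (intro integrable_mult_right integrable_norm)
  qed (use * order_trans[OF * abs_ge_self] in auto)
  have "norm (\<integral>y. u y * g y \<partial>lborel) \<le> (\<integral>y. norm (u y * g y) \<partial>lborel)"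
    by (rule integral_norm_bound)
  also have "\<dots> \<le> (\<integral>y. B * norm (u y * indicator (cball 0 R) y) \<partial>lborel)"
    by (intro integral_mono integrable_norm 1 integrable_mult_right int *)
  finally show "norm (\<integral>y. u y * g y \<partial>lborel) \<le> B * (\<integral>y. norm (u y * indicator (cball 0 R) y) \<partial>lborel)"
    by simp
qed

lemma test_reflect:
  assumes "f \<in> test_functions"
  shows "(\<lambda>y. f (x - y)) \<in> test_functions"
  using test_affine[OF assms, of "-1" x] by simp

lemma partial_deriv_reflect:
  assumes "smooth f"
  shows "partial_deriv j (\<lambda>y. f (x - y)) = (\<lambda>y. - partial_deriv j f (x - y))"
  using partial_deriv_affine(1)[OF smooth_imp_differentiable[OF assms], of j x "-1"] by simp

lemma locally_integrable_times_test:
  assumes u: "locally_integrable u" and f: "f \<in> test_functions"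
  shows "integrable lborel (\<lambda>y. u y * f y)"
proof -
  obtain R where "\<And>x. norm x > R \<Longrightarrow> f x = 0" using f test_functionE by metis
  moreover obtain B where "\<And>x. norm (f x) \<le> B" using f test_bounded by metis
  ultimately show ?thesis by (rule conv_integrable_bound(1)[OF u test_measurable[OF f]])
qed

text \<open>The Taylor remainder of \<open>\<rho>\<close> is at most \<open>e' * norm h\<close>
  everywhere and, for increments below 1, supported in a ball independent of the increment. Its
  pairing with \<open>u\<close> is therefore at most \<open>e * norm h\<close>.\<close>

lemma conv_has_derivative:
  fixes u :: "real^'n::finite \<Rightarrow> complex"
  assumes u: "locally_integrable u" and \<rho>: "\<rho> \<in> test_functions"
  shows "(conv u \<rho> has_derivative (\<lambda>h. \<Sum>j\<in>UNIV. h $ j *\<^sub>R conv u (partial_deriv j \<rho>) x)) (at x)"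
  unfolding has_derivative_at_alt
proof (intro conjI allI impI)
  show "bounded_linear (\<lambda>h. \<Sum>j\<in>UNIV. h $ j *\<^sub>R conv u (partial_deriv j \<rho>) x)"
    by (intro bounded_linear_sum bounded_linear_scaleR_const bounded_linear_vec_nth)
  fix e :: real assume "e > 0"
  obtain R where R: "R > 0" "\<And>x. norm x > R \<Longrightarrow> \<rho> x = 0" using \<rho> test_functionE by metis
  \<comment> \<open>This radius covers the support of \<open>\<lambda>z. \<rho> (y - z)\<close> for
    every \<open>y\<close> at distance at most 1 from \<open>x\<close>.\<close>
  define K where "K = norm x + 1 + R"
  define I where "I = (\<integral>y. norm (u y * indicator (cball 0 K) y) \<partial>lborel)"
  have "I \<ge> 0" by (simp add: I_def)
  \<comment> \<open>The summand 1 avoids division by zero when \<open>u\<close> vanishes on the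
    ball.\<close>
  define e' where "e' = e / (I + 1)"
  have e': "e' > 0" "e' * I \<le> e"
    using \<open>e > 0\<close> \<open>I \<ge> 0\<close> by (auto simp: e'_def field_simps)
  obtain d where d: "d > 0" "d \<le> 1"
    "\<And>z h. norm h < d \<Longrightarrow> norm (\<rho> (z + h) - \<rho> z - (\<Sum>j\<in>UNIV. h $ j *\<^sub>R partial_deriv j \<rho> z)) \<le> e' * norm h"
    using test_uniformly_differentiable[OF \<rho> e'(1)] by metis
  have int: "integrable lborel (\<lambda>y. u y * f (x' - y))" if "f \<in> test_functions" for f x'
    by (rule locally_integrable_times_test[OF u test_reflect[OF that]])
  have "norm (conv u \<rho> y - conv u \<rho> x - (\<Sum>j\<in>UNIV. (y - x) $ j *\<^sub>R conv u (partial_deriv j \<rho>) x)) \<le> e * norm (y - x)"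
    if y: "norm (y - x) < d" for y
  proof -
    define h where "h = y - x"
    define g where "g z = \<rho> (y - z) - \<rho> (x - z) - (\<Sum>j\<in>UNIV. of_real (h $ j) * partial_deriv j \<rho> (x - z))" for z
    have gt: "g \<in> test_functions"
      unfolding g_def[abs_def]
      by (intro test_diff test_sum test_cmult test_reflect test_partial_deriv \<rho>)
    have "norm (\<integral>z. u z * g z \<partial>lborel) \<le> (e' * norm h) * I"
      unfolding I_def
    proof (rule conv_integrable_bound(2)[OF u test_measurable[OF gt]])
      fix z :: "real^'n" assume z: "norm z > K"
      have "norm z \<le> norm (x - z) + norm x" "norm z \<le> norm (y - z) + norm y"
        using norm_triangle_ineq4[of x "x - z"] norm_triangle_ineq4[of y "y - z"] by simp_all
      moreover have "norm y \<le> norm (y - x) + norm x"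
        using norm_triangle_ineq[of "y - x" x] by simp
      ultimately have "norm (x - z) > R" "norm (y - z) > R"
        using z y d(2) by (auto simp: K_def)
      then show "g z = 0" by (simp add: g_def R(2) partial_deriv_eq_0_outside[of R \<rho>])
    next
      fix z :: "real^'n"
      have "(x - z) + h = y - z" by (simp add: h_def)
      then show "norm (g z) \<le> e' * norm h"
        using d(3)[of h "x - z"] y by (simp add: g_def h_def scaleR_conv_of_real)
    qed
    also have "\<dots> \<le> e * norm h"
      using mult_right_mono[OF e'(2), of "norm h"] by (simp add: mult_ac)
    finally have "norm (\<integral>z. u z * g z \<partial>lborel) \<le> e * norm h" .
    moreover have "(\<integral>z. u z * g z \<partial>lborel) = conv u \<rho> y - conv u \<rho> x - (\<Sum>j\<in>UNIV. h $ j *\<^sub>R conv u (partial_deriv j \<rho>) x)"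
    proof -
      have "(\<lambda>z. u z * g z) = (\<lambda>z. u z * \<rho> (y - z) - u z * \<rho> (x - z) -
          (\<Sum>j\<in>UNIV. of_real (h $ j) * (u z * partial_deriv j \<rho> (x - z))))"
        by (auto simp: g_def algebra_simps sum_distrib_left)
      then show ?thesis
        using int[OF \<rho>] int[OF test_partial_deriv[OF \<rho>]]
        by (simp add: conv_def Bochner_Integration.integral_sum scaleR_conv_of_real)
    qed
    ultimately show ?thesis by (simp add: h_def)
  qed
  with d(1) show "\<exists>d>0. \<forall>y. norm (y - x) < d \<longrightarrow>
      norm (conv u \<rho> y - conv u \<rho> x - (\<Sum>j\<in>UNIV. (y - x) $ j *\<^sub>R conv u (partial_deriv j \<rho>) x)) \<le> e * norm (y - x)"
    by blast
qed

lemma conv_partial_deriv: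
  assumes u: "locally_integrable u" and \<rho>: "\<rho> \<in> test_functions"
  shows "partial_deriv j (conv u \<rho>) = conv u (partial_deriv j \<rho>)"
proof
  fix x
  have "partial_deriv j (conv u \<rho>) x = (\<Sum>i\<in>UNIV. axis j 1 $ i *\<^sub>R conv u (partial_deriv i \<rho>) x)"
    by (rule partial_deriv_eqI[OF conv_has_derivative[OF assms]])
  also have "\<dots> = (\<Sum>i\<in>UNIV. if i = j then conv u (partial_deriv i \<rho>) x else 0)"
    by (intro sum.cong) (auto simp: axis_def)
  finally show "partial_deriv j (conv u \<rho>) x = conv u (partial_deriv j \<rho>) x" by simp
qed

lemma smooth_conv:
  assumes u: "locally_integrable u" and \<rho>: "\<rho> \<in> test_functions"
  shows "smooth (conv u \<rho>)"
proof -
  have diff: "conv u \<rho> differentiable_on UNIV" if "\<rho> \<in> test_functions" for \<rho>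
    using conv_has_derivative[OF u that] unfolding differentiable_on_def differentiable_def by blast
  have "C_k (Suc k) (conv u \<rho>)" for k
    using \<rho>
  proof (induction k arbitrary: \<rho>)
    case 0
    then show ?case
      using differentiable_imp_continuous_on[OF diff[OF test_partial_deriv]]
      by (simp add: diff conv_partial_deriv[OF u])
  next
    case (Suc k)
    then have "C_k (Suc k) (partial_deriv j (conv u \<rho>))" for j
      using Suc.IH[OF test_partial_deriv[OF Suc.prems]] conv_partial_deriv[OF u Suc.prems] by simp
    then show ?case using diff[OF Suc.prems] by (subst C_k.simps) simp
  qed
  from C_k_lower[OF this] show ?thesis by (simp add: smooth_def)
qed

section \<open>The factorized Schroedinger operator\<close>

text \<open>This is the derivative conjugated by an exponential: \<open>exp(a)\<close> times
  \<open>Z_op a j f\<close> is the partial derivative of \<open>exp(a) f\<close>.\<close>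

definition Z_op :: "(real^'n::finite \<Rightarrow> real) \<Rightarrow> 'n \<Rightarrow> (real^'n \<Rightarrow> complex) \<Rightarrow> real^'n \<Rightarrow> complex" where
  "Z_op a j f x = partial_deriv j f x + of_real (partial_deriv j a x) * f x"

definition Z_adj :: "(real^'n::finite \<Rightarrow> real) \<Rightarrow> 'n \<Rightarrow> (real^'n \<Rightarrow> complex) \<Rightarrow> real^'n \<Rightarrow> complex" where
  "Z_adj a j f x = - partial_deriv j f x + of_real (partial_deriv j a x) * f x"

text \<open>The Witten Laplacian on functions.\<close>

definition witten :: "(real^'n::finite \<Rightarrow> real) \<Rightarrow> (real^'n \<Rightarrow> complex) \<Rightarrow> real^'n \<Rightarrow> complex" where
  "witten a f x = (\<Sum>j\<in>UNIV. Z_adj a j (Z_op a j f) x)"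

definition witten_potential :: "(real^'n::finite \<Rightarrow> real) \<Rightarrow> real^'n \<Rightarrow> real" where
  "witten_potential a x = (\<Sum>j\<in>UNIV. (partial_deriv j a x)\<^sup>2 - partial_deriv j (partial_deriv j a) x)"

lemma smooth_Z_op: "smooth a \<Longrightarrow> smooth f \<Longrightarrow> smooth (Z_op a j f)"
  unfolding Z_op_def[abs_def]
  by (intro smooth_add smooth_mult smooth_of_real smooth_partial_deriv)

lemma smooth_Z_adj: "smooth a \<Longrightarrow> smooth f \<Longrightarrow> smooth (Z_adj a j f)"
  unfolding Z_adj_def[abs_def]
  by (intro smooth_add smooth_minus smooth_mult smooth_of_real smooth_partial_deriv)

lemma smooth_witten: "smooth a \<Longrightarrow> smooth f \<Longrightarrow> smooth (witten a f)"
  unfolding witten_def[abs_def] by (intro smooth_sum smooth_Z_op smooth_Z_adj)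

lemma test_Z_op: "smooth a \<Longrightarrow> f \<in> test_functions \<Longrightarrow> Z_op a j f \<in> test_functions"
  unfolding Z_op_def[abs_def]
  by (intro test_add test_mult smooth_of_real smooth_partial_deriv test_partial_deriv)

lemma test_Z_adj: "smooth a \<Longrightarrow> f \<in> test_functions \<Longrightarrow> Z_adj a j f \<in> test_functions"
  unfolding Z_adj_def[abs_def]
  by (intro test_add test_minus test_mult smooth_of_real smooth_partial_deriv test_partial_deriv)

lemma test_witten: "smooth a \<Longrightarrow> f \<in> test_functions \<Longrightarrow> witten a f \<in> test_functions"
  unfolding witten_def[abs_def] by (intro test_sum test_Z_op test_Z_adj)

lemma smooth_witten_potential: "smooth a \<Longrightarrow> smooth (witten_potential a)"
  unfolding witten_potential_def[abs_def] power2_eq_square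
  by (intro smooth_sum smooth_diff smooth_mult smooth_partial_deriv)

text \<open>In the product of the two first-order factors the mixed terms with one derivative of
  \<open>a\<close> and one of \<open>f\<close> cancel. The derivative falling on the coefficient of
  \<open>Z_op\<close> leaves the second derivative of \<open>a\<close>.\<close>

lemma witten_eq:
  assumes a: "smooth a" and f: "smooth f"
  shows "witten a f x = - laplacian f x + of_real (witten_potential a x) * f x"
proof -
  have "Z_adj a j (Z_op a j f) x = - partial_deriv j (partial_deriv j f) x +
      of_real ((partial_deriv j a x)\<^sup>2 - partial_deriv j (partial_deriv j a) x) * f x" for j
  proof -
    let ?aj = "\<lambda>x. complex_of_real (partial_deriv j a x)"
    have s: "smooth ?aj" "smooth (\<lambda>x. ?aj x * f x)" "smooth (partial_deriv j f)"
      using a f by (auto intro!: smooth_of_real smooth_partial_deriv smooth_mult)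
    have "partial_deriv j (Z_op a j f) x = partial_deriv j (partial_deriv j f) x +
        (of_real (partial_deriv j (partial_deriv j a) x) * f x + ?aj x * partial_deriv j f x)"
      unfolding Z_op_def[abs_def]
      by (simp add: partial_deriv_add[OF s(3,2)[THEN smooth_imp_differentiable]]
          partial_deriv_mult[OF s(1) f] partial_deriv_of_real[OF smooth_partial_deriv[OF a]])
    then show ?thesis by (simp add: Z_adj_def Z_op_def algebra_simps power2_eq_square)
  qed
  then show ?thesis
    unfolding witten_def laplacian_def witten_potential_def of_real_sum sum_distrib_right
      sum_negf[symmetric] sum.distrib[symmetric] by (intro sum.cong refl)
qed

text \<open>Pairings are bilinear here, which keeps conjugates out of the calculus; as
  \<open>a\<close> is real, transpose and formal adjoint coincide. Compact support is asked of one
  factor only, since the mollified solution to be used for \<open>f\<close> is just smooth.\<close>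

lemma Z_op_transpose:
  assumes a: "smooth a" and f: "smooth f" and g: "g \<in> test_functions"
  shows "(\<integral>x. Z_op a j f x * g x \<partial>lborel) = (\<integral>x. f x * Z_adj a j g x \<partial>lborel)"
proof -
  let ?aj = "\<lambda>x. complex_of_real (partial_deriv j a x)"
  have s: "smooth ?aj" using a by (intro smooth_of_real smooth_partial_deriv)
  have i: "integrable lborel (\<lambda>x. partial_deriv j f x * g x)" "integrable lborel (\<lambda>x. f x * partial_deriv j g x)"
    "integrable lborel (\<lambda>x. f x * (?aj x * g x))"
    by (intro test_integrable test_mult smooth_partial_deriv test_partial_deriv f g s)+
  have "(\<integral>x. Z_op a j f x * g x \<partial>lborel) = (\<integral>x. partial_deriv j f x * g x + f x * (?aj x * g x) \<partial>lborel)"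
    by (simp add: Z_op_def algebra_simps)
  also have "\<dots> = (\<integral>x. - (f x * partial_deriv j g x) + f x * (?aj x * g x) \<partial>lborel)"
    using i integral_by_parts[OF f g, of j] by simp
  also have "\<dots> = (\<integral>x. f x * Z_adj a j g x \<partial>lborel)"
    by (simp add: Z_adj_def algebra_simps)
  finally show ?thesis .
qed

lemma Z_adj_eq_minus: "smooth a \<Longrightarrow> Z_adj a j f x = - Z_op (\<lambda>x. - a x) j f x"
  by (simp add: Z_adj_def Z_op_def partial_deriv_minus)

lemma Z_op_eq_minus: "smooth a \<Longrightarrow> Z_op a j f x = - Z_adj (\<lambda>x. - a x) j f x"
  by (simp add: Z_adj_def Z_op_def partial_deriv_minus)

text \<open>Replacing \<open>a\<close> by \<open>-a\<close> interchanges the two operators up to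
  sign, which reduces this to the previous transposition rule.\<close>

lemma Z_adj_transpose:
  assumes a: "smooth a" and f: "smooth f" and g: "g \<in> test_functions"
  shows "(\<integral>x. Z_adj a j f x * g x \<partial>lborel) = (\<integral>x. f x * Z_op a j g x \<partial>lborel)"
  using Z_op_transpose[OF smooth_minus[OF a] f g, of j]
  by (simp add: Z_adj_eq_minus[OF a] Z_op_eq_minus[OF a])

lemma witten_transpose:
  assumes a: "smooth a" and f: "smooth f" and g: "g \<in> test_functions"
  shows "(\<integral>x. witten a f x * g x \<partial>lborel) = (\<Sum>j\<in>UNIV. \<integral>x. Z_op a j f x * Z_op a j g x \<partial>lborel)"
proof -
  have i: "integrable lborel (\<lambda>x. Z_adj a j (Z_op a j f) x * g x)" for j
    by (intro test_integrable test_mult smooth_Z_op smooth_Z_adj a f g)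
  have "(\<integral>x. witten a f x * g x \<partial>lborel) = (\<integral>x. (\<Sum>j\<in>UNIV. Z_adj a j (Z_op a j f) x * g x) \<partial>lborel)"
    by (simp add: witten_def sum_distrib_right)
  also have "\<dots> = (\<Sum>j\<in>UNIV. \<integral>x. Z_adj a j (Z_op a j f) x * g x \<partial>lborel)"
    by (rule Bochner_Integration.integral_sum) (rule i)
  finally show ?thesis by (simp add: Z_adj_transpose[OF a smooth_Z_op[OF a f] g])
qed

text \<open>The localization formula: up to the error \<open>|\<nabla>\<theta>|\<^sup>2 |v|\<^sup>2\<close>, the operator may be
  tested against \<open>\<theta>\<^sup>2 v\<close> as if it acted on \<open>\<theta> v\<close>.\<close>

lemma witten_localization:
  assumes a: "smooth a" and v: "smooth v" and \<theta>: "smooth \<theta>" "(\<lambda>x. complex_of_real (\<theta> x)) \<in> test_functions"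
  shows "- (\<integral>x. (\<Sum>j\<in>UNIV. (partial_deriv j \<theta> x)\<^sup>2) * (cmod (v x))\<^sup>2 \<partial>lborel)
    \<le> Re (\<integral>x. witten a v x * (of_real (\<theta> x) * of_real (\<theta> x) * cnj (v x)) \<partial>lborel)"
proof -
  let ?c = "\<lambda>x. complex_of_real (\<theta> x)"
  let ?cj = "\<lambda>j x. complex_of_real (partial_deriv j \<theta> x)"
  have cj: "partial_deriv j ?c = ?cj j" for j by (rule partial_deriv_of_real[OF \<theta>(1)])
  have cjt: "?cj j \<in> test_functions" for j using test_partial_deriv[OF \<theta>(2), of j] by (simp add: cj)
  define \<eta> where "\<eta> x = ?c x * ?c x * cnj (v x)" for x
  have s: "smooth ?c" "smooth (\<lambda>x. ?c x * ?c x)" "smooth (\<lambda>x. cnj (v x))"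
    using \<theta>(1) v by (auto intro!: smooth_of_real smooth_mult smooth_cnj)
  have \<eta>t: "\<eta> \<in> test_functions"
    unfolding \<eta>_def[abs_def] by (intro test_mult2[OF s(3)] test_mult[OF s(1)] \<theta>(2))
  have Z\<eta>: "Z_op a j \<eta> x = ?c x * ?c x * cnj (Z_op a j v x) + 2 * ?c x * ?cj j x * cnj (v x)" for j x
    unfolding \<eta>_def[abs_def] Z_op_def partial_deriv_mult[OF s(2,3)] partial_deriv_mult[OF s(1,1)]
      cj partial_deriv_cnj[OF v]
    by (simp add: algebra_simps)
  \<comment> \<open>Completing the square: with the gradient term added, the right-hand side becomes
    the squared modulus of \<open>Z_j\<close> applied to \<open>\<theta> v\<close>, which is
    nonnegative.\<close>
  have pw: "- ((partial_deriv j \<theta> x)\<^sup>2 * (cmod (v x))\<^sup>2) \<le> Re (Z_op a j v x * Z_op a j \<eta> x)" for j x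
  proof -
    have "Re (Z_op a j v x * Z_op a j \<eta> x) + (partial_deriv j \<theta> x)\<^sup>2 * (cmod (v x))\<^sup>2
      = (cmod (?c x * Z_op a j v x + ?cj j x * v x))\<^sup>2"
      unfolding Z\<eta> cmod_power2 by (simp add: algebra_simps power2_eq_square)
    then show ?thesis by (smt (verit) zero_le_power2)
  qed
  have i1: "integrable lborel (\<lambda>x. Z_op a j v x * Z_op a j \<eta> x)" for j
    by (intro test_integrable test_mult test_Z_op smooth_Z_op a v \<eta>t)
  have i2: "integrable lborel (\<lambda>x. (partial_deriv j \<theta> x)\<^sup>2 * (cmod (v x))\<^sup>2)" for j
  proof -
    have "integrable lborel (\<lambda>x. (v x * cnj (v x)) * (?cj j x * ?cj j x))"
      by (intro test_integrable test_mult smooth_mult v s(3) cjt test_function_smooth)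
    then have "integrable lborel (\<lambda>x. Re ((v x * cnj (v x)) * (?cj j x * ?cj j x)))"
      by (rule integrable_Re)
    moreover have "Re ((v x * cnj (v x)) * (?cj j x * ?cj j x)) = (partial_deriv j \<theta> x)\<^sup>2 * (cmod (v x))\<^sup>2" for x
      unfolding cmod_power2 by (simp add: algebra_simps power2_eq_square)
    ultimately show ?thesis by simp
  qed
  have "- (\<integral>x. (\<Sum>j\<in>UNIV. (partial_deriv j \<theta> x)\<^sup>2) * (cmod (v x))\<^sup>2 \<partial>lborel)
      = (\<Sum>j\<in>UNIV. \<integral>x. - ((partial_deriv j \<theta> x)\<^sup>2 * (cmod (v x))\<^sup>2) \<partial>lborel)"
    using i2 by (simp add: sum_distrib_right Bochner_Integration.integral_sum sum_negf)
  also have "\<dots> \<le> (\<Sum>j\<in>UNIV. \<integral>x. Re (Z_op a j v x * Z_op a j \<eta> x) \<partial>lborel)"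
    by (intro sum_mono integral_mono integrable_minus i2 integrable_Re i1 pw)
  also have "\<dots> = Re (\<integral>x. witten a v x * \<eta> x \<partial>lborel)"
    unfolding witten_transpose[OF a v \<eta>t] by (simp only: integral_Re[OF i1] Re_sum)
  finally show ?thesis by (simp add: \<eta>_def)
qed

section \<open>Mollification\<close>

lemma mollifier_exists:
  assumes "\<epsilon> > 0"
  obtains m :: "real^'n::finite \<Rightarrow> real" where
    "(\<lambda>x. complex_of_real (m x)) \<in> test_functions" "\<And>x. m x \<ge> 0"
    "\<And>x. norm x > \<epsilon> \<Longrightarrow> m x = 0" "(\<integral>\<^sup>+x. ennreal (m x) \<partial>lborel) = 1"
    "continuous_on UNIV m"
proof -
  \<comment> \<open>The Euclidean norm is at most the sum of the absolute coordinates, so a box of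
    half-width \<open>\<epsilon>\<close> divided by the dimension fits into the ball of radius
    \<open>\<epsilon>\<close>.\<close>
  define \<delta> where "\<delta> = \<epsilon> / real CARD('n)"
  have \<delta>: "\<delta> > 0" using assms by (simp add: \<delta>_def)
  let ?a = "(\<chi> i. - \<delta>) :: real^'n" and ?b = "(\<chi> i. \<delta>) :: real^'n"
  define b where "b = box_bump 1 ?a ?b"
  have bt: "(\<lambda>x. complex_of_real (b x)) \<in> test_functions"
    unfolding b_def by (rule box_bump_test) simp
  have b0: "b x \<ge> 0" for x unfolding b_def by (rule box_bump_bounds)
  have bs: "b x = 0" if "norm x > \<epsilon>" for x
    unfolding b_def
  proof (rule box_bump_eq_0)
    show "x \<notin> box ?a ?b"
    proof
      assume "x \<in> box ?a ?b"
      then have "\<bar>x $ i\<bar> \<le> \<delta>" for i by (auto simp: mem_box_cart abs_le_iff intro: less_imp_le)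
         (metis less_imp_le minus_less_iff)
      then have "(\<Sum>i\<in>UNIV. \<bar>x $ i\<bar>) \<le> (\<Sum>i\<in>(UNIV::'n set). \<delta>)" by (intro sum_mono)
      then have "norm x \<le> \<epsilon>" using norm_le_l1_cart[of x] by (simp add: \<delta>_def)
      with that show False by simp
    qed
  qed simp
  have bc: "continuous_on UNIV b" unfolding b_def by (rule smooth_imp_continuous[OF smooth_box_bump])
  then have [measurable]: "b \<in> borel_measurable borel" by (rule borel_measurable_continuous_onI)
  have "integrable lborel (\<lambda>x. Re (complex_of_real (b x)))"
    by (rule integrable_Re[OF test_integrable[OF bt]])
  then have ib: "integrable lborel b" by simp
  define c where "c = (\<integral>x. b x \<partial>lborel)"
  \<comment> \<open>A zero integral would make the bump vanish almost everywhere, but it is positive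
    on a nonempty open box, which is not negligible.\<close>
  have "c \<noteq> 0"
  proof
    assume "c = 0"
    then have "AE x in lborel. b x = 0"
      using integral_nonneg_eq_0_iff_AE[OF ib] b0 by (simp add: c_def)
    then have "AE x in lborel. x \<notin> box ?a ?b"
      by eventually_elim (use box_bump_pos[of 1 _ ?a ?b] in \<open>force simp: b_def\<close>)
    then have "emeasure lborel (box ?a ?b) = 0"
      by (subst (asm) AE_iff_measurable[of "box ?a ?b"]) auto
    moreover have "0 \<in> box ?a ?b" using \<delta> by (simp add: mem_box_cart)
    ultimately show False
      using open_not_negligible[of "box ?a ?b"]
      by (auto simp: negligible_iff_null_sets null_sets_completion_iff2 null_sets_def)
  qed
  moreover have "c \<ge> 0" unfolding c_def by (rule Bochner_Integration.integral_nonneg) (rule b0)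
  ultimately have c: "c > 0" by simp
  have nn: "(\<integral>\<^sup>+x. ennreal (b x / c) \<partial>lborel) = 1"
    using c b0 ib by (subst nn_integral_eq_integral) (auto simp: c_def)
  show ?thesis
  proof (rule that[of "\<lambda>x. b x / c"])
    show "(\<lambda>x. complex_of_real (b x / c)) \<in> test_functions"
      using test_cmult[OF bt, of "of_real (1 / c)"] by simp
  qed (use b0 bs nn bc c in \<open>auto intro!: continuous_intros\<close>)
qed

section \<open>Estimates for convolution with a mollifier\<close>

lemma nn_integral_translation:
  fixes f :: "'a::euclidean_space \<Rightarrow> ennreal"
  assumes [measurable]: "f \<in> borel_measurable borel"
  shows "(\<integral>\<^sup>+x. f (x - c) \<partial>lborel) = (\<integral>\<^sup>+x. f x \<partial>lborel)"
proof -
  have "(\<integral>\<^sup>+x. f x \<partial>lborel) = (\<integral>\<^sup>+x. f x \<partial>distr lborel borel ((+) (- c)))"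
    by (simp add: lborel_distr_plus)
  also have "\<dots> = (\<integral>\<^sup>+x. f (- c + x) \<partial>lborel)"
    by (rule nn_integral_distr) auto
  finally show ?thesis by simp
qed

lemma nn_integral_reflection:
  fixes f :: "'a::euclidean_space \<Rightarrow> ennreal"
  assumes [measurable]: "f \<in> borel_measurable borel"
  shows "(\<integral>\<^sup>+y. f (x - y) \<partial>lborel) = (\<integral>\<^sup>+x. f x \<partial>lborel)"
proof -
  have "lborel = distr lborel borel (\<lambda>y. x - y)"
    using lborel_affine[of "-1" x] by (simp add: density_1)
  then have "(\<integral>\<^sup>+x. f x \<partial>lborel) = (\<integral>\<^sup>+x. f x \<partial>distr lborel borel (\<lambda>y. x - y))"
    by (rule arg_cong)
  also have "\<dots> = (\<integral>\<^sup>+y. f (x - y) \<partial>lborel)"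
    by (rule nn_integral_distr) auto
  finally show ?thesis ..
qed

text \<open>Splitting the kernel as \<open>sqrt m * sqrt m\<close> and using Cauchy-Schwarz against
  the unit mass of \<open>m\<close> bounds \<open>S^2\<close> by the convolution of
  \<open>|u|^2\<close> with \<open>m\<close>; Tonelli integrates this. The function \<open>S\<close>
  dominates the mollification of \<open>u\<close> and, up to a small factor, the commutator error,
  so one bound serves both.\<close>

lemma young:
  fixes u :: "real^'n::finite \<Rightarrow> complex" and m :: "real^'n \<Rightarrow> real"
  assumes u: "u \<in> L2 lborel" and mt: "(\<lambda>x. complex_of_real (m x)) \<in> test_functions"
    and m0: "\<And>x. m x \<ge> 0" and m1: "(\<integral>\<^sup>+x. ennreal (m x) \<partial>lborel) = 1" and mc: "continuous_on UNIV m"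
  defines "S \<equiv> \<lambda>x. \<integral>y. cmod (u y) * m (x - y) \<partial>lborel"
  shows "integrable lborel (\<lambda>x. (S x)\<^sup>2)" "(\<integral>x. (S x)\<^sup>2 \<partial>lborel) \<le> (\<integral>x. (cmod (u x))\<^sup>2 \<partial>lborel)"
    "integrable lborel (\<lambda>y. cmod (u y) * m (x - y))" "S x \<ge> 0"
proof -
  have [measurable]: "u \<in> borel_measurable borel" "m \<in> borel_measurable borel"
    using L2D(1)[OF u] borel_measurable_continuous_onI[OF mc] by auto
  have int: "integrable lborel (\<lambda>y. cmod (u y) * m (x - y))" for x
  proof -
    have "integrable lborel (\<lambda>y. u y * complex_of_real (m (x - y)))"
      by (rule locally_integrable_times_test[OF L2_locally_integrable[OF u] test_reflect[OF mt]])
    from integrable_norm[OF this] show ?thesis by (simp add: norm_mult m0)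
  qed
  show "integrable lborel (\<lambda>y. cmod (u y) * m (x - y))" by (rule int)
  have S0: "S x \<ge> 0" for x unfolding S_def by (intro Bochner_Integration.integral_nonneg) (simp add: m0)
  show "S x \<ge> 0" by (rule S0)
  have [measurable]: "S \<in> borel_measurable borel"
    unfolding S_def by measurable
  have S2: "ennreal ((S x)\<^sup>2) \<le> (\<integral>\<^sup>+y. ennreal ((cmod (u y))\<^sup>2) * ennreal (m (x - y)) \<partial>lborel)" for x
  proof -
    have "ennreal ((S x)\<^sup>2) = (\<integral>\<^sup>+y. ennreal (cmod (u y) * m (x - y)) \<partial>lborel)\<^sup>2"
    proof -
      have "ennreal (S x) = (\<integral>\<^sup>+y. ennreal (cmod (u y) * m (x - y)) \<partial>lborel)"
        unfolding S_def using nn_integral_eq_integral[OF int[of x]] m0 by simp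
      then show ?thesis using S0[of x] by (simp add: ennreal_power[symmetric])
    qed
    also have "\<dots> = (\<integral>\<^sup>+y. ennreal (cmod (u y) * sqrt (m (x - y))) * ennreal (sqrt (m (x - y))) \<partial>lborel)\<^sup>2"
      using m0 by (simp add: ennreal_mult[symmetric] mult.assoc)
    also have "\<dots> \<le> (\<integral>\<^sup>+y. (ennreal (cmod (u y) * sqrt (m (x - y))))\<^sup>2 \<partial>lborel) *
        (\<integral>\<^sup>+y. (ennreal (sqrt (m (x - y))))\<^sup>2 \<partial>lborel)"
      by (rule Cauchy_Schwarz_nn_integral) measurable
    also have "(\<integral>\<^sup>+y. (ennreal (sqrt (m (x - y))))\<^sup>2 \<partial>lborel) = 1"
      using m0 m1 nn_integral_reflection[of "\<lambda>y. ennreal (m y)" x] by (simp add: ennreal_power)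
    also have "(\<integral>\<^sup>+y. (ennreal (cmod (u y) * sqrt (m (x - y))))\<^sup>2 \<partial>lborel) =
        (\<integral>\<^sup>+y. ennreal ((cmod (u y))\<^sup>2) * ennreal (m (x - y)) \<partial>lborel)"
      using m0 by (simp add: ennreal_power power_mult_distrib ennreal_mult[symmetric])
    finally show ?thesis by simp
  qed
  have "(\<integral>\<^sup>+x. ennreal ((S x)\<^sup>2) \<partial>lborel) \<le>
      (\<integral>\<^sup>+x. (\<integral>\<^sup>+y. ennreal ((cmod (u y))\<^sup>2) * ennreal (m (x - y)) \<partial>lborel) \<partial>lborel)"
    by (rule nn_integral_mono) (rule S2)
  also have "\<dots> = (\<integral>\<^sup>+y. (\<integral>\<^sup>+x. ennreal ((cmod (u y))\<^sup>2) * ennreal (m (x - y)) \<partial>lborel) \<partial>lborel)"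
    by (rule lborel_pair.Fubini'[symmetric]) measurable
  also have "\<dots> = (\<integral>\<^sup>+y. ennreal ((cmod (u y))\<^sup>2) \<partial>lborel)"
    using nn_integral_translation[of "\<lambda>x. ennreal (m x)"] m1 by (simp add: nn_integral_cmult)
  also have "\<dots> = ennreal (\<integral>x. (cmod (u x))\<^sup>2 \<partial>lborel)"
    by (rule nn_integral_eq_integral) (use L2D(2)[OF u] in auto)
  finally have le: "(\<integral>\<^sup>+x. ennreal ((S x)\<^sup>2) \<partial>lborel) \<le> ennreal (\<integral>x. (cmod (u x))\<^sup>2 \<partial>lborel)" .
  show i: "integrable lborel (\<lambda>x. (S x)\<^sup>2)"
    using le by (intro integrableI_nonneg) (auto intro: le_less_trans)
  show "(\<integral>x. (S x)\<^sup>2 \<partial>lborel) \<le> (\<integral>x. (cmod (u x))\<^sup>2 \<partial>lborel)"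
    using le nn_integral_eq_integral[OF i] by simp
qed

text \<open>By Fubini the mollifier moves from \<open>u\<close> onto \<open>\<psi>\<close>. The
  averaged function \<open>k\<close> differs from \<open>\<psi>\<close> by at most the modulus of
  continuity \<open>\<omega>\<close>, and only inside the ball of radius
  \<open>R + 1\<close>.\<close>

lemma mollification_weak_error:
  fixes u :: "real^'n::finite \<Rightarrow> complex" and m :: "real^'n \<Rightarrow> real"
  assumes u: "locally_integrable u" and mt: "(\<lambda>x. complex_of_real (m x)) \<in> test_functions"
    and m0: "\<And>x. m x \<ge> 0" and m1: "(\<integral>\<^sup>+x. ennreal (m x) \<partial>lborel) = 1"
    and ms: "\<And>x. norm x > \<epsilon> \<Longrightarrow> m x = 0" "\<epsilon> \<le> 1"
    and \<psi>: "\<psi> \<in> test_functions" "\<And>x. norm x > R \<Longrightarrow> \<psi> x = 0"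
    and \<omega>: "\<And>x y. norm (x - y) \<le> \<epsilon> \<Longrightarrow> norm (\<psi> x - \<psi> y) \<le> \<omega>"
  shows "norm ((\<integral>x. conv u (\<lambda>x. of_real (m x)) x * \<psi> x \<partial>lborel) - (\<integral>x. u x * \<psi> x \<partial>lborel))
    \<le> \<omega> * (\<integral>y. norm (u y * indicator (cball 0 (R + 1)) y) \<partial>lborel)"
proof -
  let ?M = "\<lambda>x. complex_of_real (m x)"
  have "continuous_on UNIV (\<lambda>x. Re (?M x))"
    by (intro continuous_on_Re smooth_imp_continuous test_function_smooth mt)
  then have [measurable]: "m \<in> borel_measurable borel" by (simp add: borel_measurable_continuous_onI)
  have [measurable]: "u \<in> borel_measurable borel" "\<psi> \<in> borel_measurable borel"
    using u test_measurable[OF \<psi>(1)] by (auto simp: locally_integrable_def)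
  have cb [measurable]: "cball (0::real^'n) (R + 1) \<in> sets borel" by simp
  define k where "k y = (\<integral>x. ?M (x - y) * \<psi> x \<partial>lborel)" for y
  have [measurable]: "k \<in> borel_measurable borel" unfolding k_def by measurable
  \<comment> \<open>Truncation makes \<open>u\<close> integrable, as Fubini requires. It does not
    change the integrand: if \<open>y\<close> lies outside this ball, then \<open>x - y\<close>
    leaves the support of \<open>m\<close> or \<open>x\<close> leaves that of \<open>\<psi>\<close>,
    because \<open>\<epsilon> \<le> 1\<close>.\<close>
  define u1 where "u1 y = u y * indicator (cball 0 (R + 1)) y" for y
  have u1i: "integrable lborel u1" using u unfolding locally_integrable_def u1_def by blast
  have [measurable]: "u1 \<in> borel_measurable borel" using borel_measurable_integrable[OF u1i] by simp
  have far: "m (x - y) = 0 \<or> \<psi> x = 0" if "norm y > R + 1" for x y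
  proof (rule ccontr)
    assume "\<not> ?thesis"
    then have "norm (x - y) \<le> \<epsilon>" "norm x \<le> R" using ms(1)[of "x - y"] \<psi>(2)[of x] by force+
    moreover have "norm y \<le> norm (x - y) + norm x" using norm_triangle_ineq4[of x "x - y"] by simp
    ultimately show False using that ms(2) by simp
  qed
  have eq: "u y * ?M (x - y) * \<psi> x = u1 y * (?M (x - y) * \<psi> x)" for x y
    using far[of y x] by (cases "norm y > R + 1") (auto simp: u1_def)
  obtain Bm where Bm: "Bm > 0" "\<And>x. norm (?M x) \<le> Bm" using test_bounded[OF mt] by metis
  obtain Bp where Bp: "Bp > 0" "\<And>x. norm (\<psi> x) \<le> Bp" using test_bounded[OF \<psi>(1)] by metis
  have yint: "integrable lborel (\<lambda>y. u1 y * (?M (x - y) * \<psi> x))" for x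
  proof (rule Bochner_Integration.integrable_bound)
    show "integrable lborel (\<lambda>y. of_real (Bm * Bp) * u1 y)" using u1i by simp
    show "AE y in lborel. norm (u1 y * (?M (x - y) * \<psi> x)) \<le> norm (of_real (Bm * Bp) * u1 y)"
    proof (rule AE_I2)
      fix y
      have "norm (?M (x - y)) * norm (\<psi> x) \<le> Bm * Bp"
        using Bm(1) by (intro mult_mono Bm Bp) auto
      from mult_left_mono[OF this norm_ge_zero[of "u1 y"]]
      show "norm (u1 y * (?M (x - y) * \<psi> x)) \<le> norm (of_real (Bm * Bp) * u1 y)"
        using Bm(1) Bp(1) by (simp add: norm_mult mult_ac)
    qed
  qed measurable
  have pair: "integrable (lborel \<Otimes>\<^sub>M lborel) (\<lambda>(x, y). u1 y * (?M (x - y) * \<psi> x))"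
  proof (rule lborel_pair.Fubini_integrable)
    show "integrable lborel (\<lambda>x. \<integral>y. norm (case (x, y) of (x, y) \<Rightarrow> u1 y * (?M (x - y) * \<psi> x)) \<partial>lborel)"
    proof (rule integrable_bounded_support[where R=R and B="Bm * Bp * (\<integral>y. norm (u1 y) \<partial>lborel)"])
      fix x :: "real^'n"
      have "norm (\<integral>y. norm (u1 y * (?M (x - y) * \<psi> x)) \<partial>lborel) \<le> (\<integral>y. Bm * Bp * norm (u1 y) \<partial>lborel)"
      proof -
        have "(\<integral>y. norm (u1 y * (?M (x - y) * \<psi> x)) \<partial>lborel) \<le> (\<integral>y. Bm * Bp * norm (u1 y) \<partial>lborel)"
        proof (intro integral_mono integrable_norm yint integrable_mult_right u1i)
          fix y
          have "norm (?M (x - y)) * norm (\<psi> x) \<le> Bm * Bp"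
            using Bm(1) by (intro mult_mono Bm Bp) auto
          from mult_left_mono[OF this norm_ge_zero[of "u1 y"]]
          show "norm (u1 y * (?M (x - y) * \<psi> x)) \<le> Bm * Bp * norm (u1 y)"
            by (simp add: norm_mult mult_ac)
        qed
        moreover have "0 \<le> (\<integral>y. norm (u1 y * (?M (x - y) * \<psi> x)) \<partial>lborel)" by simp
        ultimately show ?thesis by simp
      qed
      then show "norm (\<integral>y. norm (case (x, y) of (x, y) \<Rightarrow> u1 y * (?M (x - y) * \<psi> x)) \<partial>lborel)
          \<le> Bm * Bp * (\<integral>y. norm (u1 y) \<partial>lborel)" by simp
    qed (use \<psi>(2) in auto)
    show "AE x in lborel. integrable lborel (\<lambda>y. case (x, y) of (x, y) \<Rightarrow> u1 y * (?M (x - y) * \<psi> x))"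
      using yint by simp
  qed measurable
  have mint: "integrable lborel (\<lambda>x. ?M (x - y))" for y
    using test_integrable[OF test_affine[OF mt, of 1 "- y"]] by simp
  have mone: "(\<integral>x. m (x - y) \<partial>lborel) = 1" for y
    using nn_integral_translation[of "\<lambda>x. ennreal (m x)" y] m1
    by (subst integral_eq_nn_integral) (auto simp: m0)
  have mi: "integrable lborel (\<lambda>x. m (x - y))" for y
    using integrable_Re[OF mint[of y]] by simp
  have "(\<integral>x. conv u ?M x * \<psi> x \<partial>lborel) = (\<integral>x. (\<integral>y. u1 y * (?M (x - y) * \<psi> x) \<partial>lborel) \<partial>lborel)"
    unfolding conv_def by (simp only: eq[symmetric] integral_mult_left_zero)
  also have "\<dots> = (\<integral>y. (\<integral>x. u1 y * (?M (x - y) * \<psi> x) \<partial>lborel) \<partial>lborel)"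
    by (rule lborel_pair.Fubini_integral[symmetric]) (rule pair)
  also have "\<dots> = (\<integral>y. u y * k y \<partial>lborel)"
    by (simp only: eq[symmetric] mult.assoc integral_mult_right_zero k_def)
  finally have 1: "(\<integral>x. conv u ?M x * \<psi> x \<partial>lborel) = (\<integral>y. u y * k y \<partial>lborel)" .
  have k\<psi>: "norm (k y - \<psi> y) \<le> \<omega>" for y
  proof -
    have ti: "integrable lborel (\<lambda>x. ?M (x - y) * \<psi> x)"
      using test_affine[OF mt, of 1 "- y"]
      by (intro test_integrable test_mult[OF _ \<psi>(1)] test_function_smooth) simp
    have "\<psi> y = (\<integral>x. ?M (x - y) * \<psi> y \<partial>lborel)"
      using mone[of y] by simp
    then have "k y - \<psi> y = (\<integral>x. ?M (x - y) * \<psi> x - ?M (x - y) * \<psi> y \<partial>lborel)"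
      using mint[of y] ti by (simp add: k_def)
    also have "\<dots> = (\<integral>x. ?M (x - y) * (\<psi> x - \<psi> y) \<partial>lborel)" by (simp add: right_diff_distrib)
    also have "norm \<dots> \<le> (\<integral>x. m (x - y) * \<omega> \<partial>lborel)"
    proof (rule Bochner_Integration.integral_norm_bound_integral)
      fix x
      show "norm (?M (x - y) * (\<psi> x - \<psi> y)) \<le> m (x - y) * \<omega>"
        using ms(1)[of "x - y"] \<omega>[of x y] m0[of "x - y"]
        by (cases "norm (x - y) > \<epsilon>") (auto simp: norm_mult intro!: mult_left_mono)
      show "integrable lborel (\<lambda>x. ?M (x - y) * (\<psi> x - \<psi> y))"
        unfolding right_diff_distrib using ti mint[of y] by simp
    qed (use mi in simp)
    also have "\<dots> = \<omega>" using mone[of y] by simp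
    finally show ?thesis .
  qed
  have k\<psi>0: "k y - \<psi> y = 0" if "norm y > R + 1" for y
  proof -
    have "?M (x - y) * \<psi> x = 0" for x using far[OF that, of x] by auto
    then have "k y = (\<integral>x. 0 \<partial>(lborel :: (real^'n) measure))"
      unfolding k_def by (intro Bochner_Integration.integral_cong refl)
    then have "k y = 0" by simp
    then show ?thesis using \<psi>(2)[of y] that by simp
  qed
  have ui: "integrable lborel (\<lambda>y. u y * \<psi> y)" by (rule locally_integrable_times_test[OF u \<psi>(1)])
  have di: "integrable lborel (\<lambda>y. u y * (k y - \<psi> y))"
    by (rule conv_integrable_bound(1)[OF u _ k\<psi>0 k\<psi>]) measurable
  have "(\<integral>y. u y * k y \<partial>lborel) = (\<integral>y. u y * (k y - \<psi> y) + u y * \<psi> y \<partial>lborel)"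
    by (simp add: right_diff_distrib)
  also have "\<dots> = (\<integral>y. u y * (k y - \<psi> y) \<partial>lborel) + (\<integral>y. u y * \<psi> y \<partial>lborel)"
    by (rule Bochner_Integration.integral_add[OF di ui])
  finally have "(\<integral>x. conv u ?M x * \<psi> x \<partial>lborel) - (\<integral>x. u x * \<psi> x \<partial>lborel) = (\<integral>y. u y * (k y - \<psi> y) \<partial>lborel)"
    using 1 by simp
  also have "norm \<dots> \<le> \<omega> * (\<integral>y. norm (u y * indicator (cball 0 (R + 1)) y) \<partial>lborel)"
    by (rule conv_integrable_bound(2)[OF u _ k\<psi>0 k\<psi>]) measurable
  finally show ?thesis .
qed

lemma L2_Holder:
  assumes f: "f \<in> L2 M" and g: "g \<in> L2 M"
  shows "(\<integral>x. cmod (f x) * cmod (g x) \<partial>M) \<le> L2_norm M f * L2_norm M g"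
proof -
  note [measurable] = L2D(1)[OF f] L2D(1)[OF g]
  have i: "integrable M (\<lambda>x. cmod (f x) * cmod (g x))"
    using integrable_norm[OF L2_integrable_mult[OF f g]] by (simp add: norm_mult)
  have "ennreal ((\<integral>x. cmod (f x) * cmod (g x) \<partial>M)\<^sup>2) =
      (\<integral>\<^sup>+x. ennreal (cmod (f x)) * ennreal (cmod (g x)) \<partial>M)\<^sup>2"
    using nn_integral_eq_integral[OF i] by (simp add: ennreal_power ennreal_mult)
  also have "\<dots> \<le> (\<integral>\<^sup>+x. (ennreal (cmod (f x)))\<^sup>2 \<partial>M) * (\<integral>\<^sup>+x. (ennreal (cmod (g x)))\<^sup>2 \<partial>M)"
    by (rule Cauchy_Schwarz_nn_integral) measurable
  also have "\<dots> = ennreal ((L2_norm M f * L2_norm M g)\<^sup>2)"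
    using L2_nn_integral[OF f] L2_nn_integral[OF g]
    by (simp add: ennreal_power power_mult_distrib ennreal_mult)
  finally have "(\<integral>x. cmod (f x) * cmod (g x) \<partial>M)\<^sup>2 \<le> (L2_norm M f * L2_norm M g)\<^sup>2"
    by simp
  then show ?thesis
    by (rule power2_le_imp_le) (simp add: L2_norm_nonneg)
qed

section \<open>Essential self-adjointness\<close>

text \<open>The mollification \<open>v\<close> solves the equation up to the commutator
  \<open>r\<close> of the potential with the convolution. Testing with \<open>\<theta>^2\<close>
  times the conjugate of \<open>v\<close>, the localization formula costs at most \<open>G\<close>
  times the integral of \<open>S^2\<close> and the commutator at most \<open>\<delta>\<close> times
  it; \<open>young\<close> then returns to \<open>u\<close>.\<close>

lemma witten_mollified_estimate:
  fixes u :: "real^'n::finite \<Rightarrow> complex" and m \<theta> :: "real^'n \<Rightarrow> real"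
  assumes a: "smooth a" and u: "u \<in> L2 lborel"
    and eq: "\<And>\<eta>. \<eta> \<in> test_functions \<Longrightarrow> (\<integral>x. u x * (witten a \<eta> x + \<eta> x) \<partial>lborel) = 0"
    and mt: "(\<lambda>x. complex_of_real (m x)) \<in> test_functions"
    and m0: "\<And>x. m x \<ge> 0" and m1: "(\<integral>\<^sup>+x. ennreal (m x) \<partial>lborel) = 1"
    and mc: "continuous_on UNIV m"
    and ms: "\<And>x. norm x > \<epsilon> \<Longrightarrow> m x = 0"
    and \<theta>: "smooth \<theta>" "(\<lambda>x. complex_of_real (\<theta> x)) \<in> test_functions" "\<And>x. \<bar>\<theta> x\<bar> \<le> 1"
    and G: "\<And>x. (\<Sum>j\<in>UNIV. (partial_deriv j \<theta> x)\<^sup>2) \<le> G"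
    and \<delta>0: "\<delta> \<ge> 0"
    and \<delta>: "\<And>x y. \<theta> x \<noteq> 0 \<Longrightarrow> norm (x - y) \<le> \<epsilon> \<Longrightarrow> \<bar>witten_potential a x - witten_potential a y\<bar> \<le> \<delta>"
  shows "(\<integral>x. (\<theta> x)\<^sup>2 * (cmod (conv u (\<lambda>x. of_real (m x)) x))\<^sup>2 \<partial>lborel) \<le> (\<delta> + G) * (\<integral>x. (cmod (u x))\<^sup>2 \<partial>lborel)"
proof -
  let ?M = "\<lambda>x. complex_of_real (m x)"
  let ?V = "witten_potential a"
  define v where "v = conv u ?M"
  note lu = L2_locally_integrable[OF u]
  have vs: "smooth v" unfolding v_def by (rule smooth_conv[OF lu mt])
  define S where "S x = (\<integral>y. cmod (u y) * m (x - y) \<partial>lborel)" for x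
  note yg = young[OF u mt m0 m1 mc, folded S_def]
  have Vc: "continuous_on UNIV (\<lambda>x. complex_of_real (?V x))"
    by (intro smooth_imp_continuous smooth_of_real smooth_witten_potential a)
  note luV = locally_integrable_mult[OF lu Vc]
  have lapl: "laplacian v x = (\<integral>y. (of_real (?V y) * u y) * ?M (x - y) \<partial>lborel) + v x" for x
  proof -
    \<comment> \<open>The reflected and translated mollifier is itself a test function. Inserting it
      in the weak equation for \<open>u\<close> yields a pointwise equation for \<open>v\<close> at
      \<open>x\<close>.\<close>
    define \<eta> where "\<eta> y = ?M (x - y)" for y
    have \<eta>t: "\<eta> \<in> test_functions" unfolding \<eta>_def[abs_def] by (rule test_reflect[OF mt])
    have dd: "partial_deriv j (partial_deriv j \<eta>) y = partial_deriv j (partial_deriv j ?M) (x - y)" for j y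
    proof -
      have s: "smooth (partial_deriv j ?M)" by (rule smooth_partial_deriv[OF test_function_smooth[OF mt]])
      have "partial_deriv j \<eta> = (\<lambda>y. - partial_deriv j ?M (x - y))"
        unfolding \<eta>_def[abs_def] by (rule partial_deriv_reflect[OF test_function_smooth[OF mt]])
      then have "partial_deriv j (partial_deriv j \<eta>) = (\<lambda>y. - partial_deriv j (\<lambda>y. partial_deriv j ?M (x - y)) y)"
        using partial_deriv_minus[OF smooth_affine[OF s, of x "-1"]] by simp
      then show ?thesis by (simp add: partial_deriv_reflect[OF s])
    qed
    have lt: "laplacian \<eta> \<in> test_functions"
      unfolding laplacian_def[abs_def] by (intro test_sum test_partial_deriv \<eta>t)
    have i1: "integrable lborel (\<lambda>y. u y * laplacian \<eta> y)" "integrable lborel (\<lambda>y. u y * \<eta> y)"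
      by (intro locally_integrable_times_test[OF lu] lt \<eta>t)+
    have i2: "integrable lborel (\<lambda>y. of_real (?V y) * u y * \<eta> y)"
      by (intro locally_integrable_times_test[OF luV] \<eta>t)
    have "0 = (\<integral>y. u y * (witten a \<eta> y + \<eta> y) \<partial>lborel)" using eq[OF \<eta>t] by simp
    also have "\<dots> = (\<integral>y. - (u y * laplacian \<eta> y) + (of_real (?V y) * u y * \<eta> y + u y * \<eta> y) \<partial>lborel)"
      by (simp add: witten_eq[OF a test_function_smooth[OF \<eta>t]] algebra_simps)
    also have "\<dots> = - (\<integral>y. u y * laplacian \<eta> y \<partial>lborel) + ((\<integral>y. of_real (?V y) * u y * \<eta> y \<partial>lborel) + (\<integral>y. u y * \<eta> y \<partial>lborel))"
      using i1 i2 by simp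
    finally have 1: "(\<integral>y. u y * laplacian \<eta> y \<partial>lborel) = (\<integral>y. of_real (?V y) * u y * \<eta> y \<partial>lborel) + v x"
      by (simp add: v_def conv_def \<eta>_def)
    have "laplacian v x = (\<Sum>j\<in>UNIV. conv u (partial_deriv j (partial_deriv j ?M)) x)"
      unfolding laplacian_def v_def
      by (simp only: conv_partial_deriv[OF lu mt] conv_partial_deriv[OF lu test_partial_deriv[OF mt]])
    also have "\<dots> = (\<Sum>j\<in>UNIV. \<integral>y. u y * partial_deriv j (partial_deriv j \<eta>) y \<partial>lborel)"
      by (simp only: conv_def dd)
    also have "\<dots> = (\<integral>y. u y * laplacian \<eta> y \<partial>lborel)"
      unfolding laplacian_def sum_distrib_left
      by (rule Bochner_Integration.integral_sum[symmetric])
        (intro locally_integrable_times_test[OF lu] test_partial_deriv \<eta>t)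
    finally show ?thesis using 1 by (simp add: \<eta>_def)
  qed
  define r where "r x = witten a v x + v x" for x
  have rs: "smooth r" unfolding r_def[abs_def] by (intro smooth_add smooth_witten a vs)
  \<comment> \<open>The Laplacian and the zeroth-order term commute with convolution and drop out.
    Only the variation of the potential over the support of the mollifier remains.\<close>
  have r: "r x = (\<integral>y. u y * (of_real (?V x - ?V y) * ?M (x - y)) \<partial>lborel)" for x
  proof -
    have i: "integrable lborel (\<lambda>y. of_real (?V y) * u y * ?M (x - y))" "integrable lborel (\<lambda>y. u y * ?M (x - y))"
      by (intro locally_integrable_times_test[OF luV] locally_integrable_times_test[OF lu] test_reflect[OF mt])+
    have "r x = of_real (?V x) * v x - (\<integral>y. (of_real (?V y) * u y) * ?M (x - y) \<partial>lborel)"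
      by (simp add: r_def witten_eq[OF a vs] lapl)
    also have "\<dots> = (\<integral>y. of_real (?V x) * (u y * ?M (x - y)) - (of_real (?V y) * u y) * ?M (x - y) \<partial>lborel)"
      using i by (simp add: v_def conv_def)
    finally show ?thesis by (simp add: algebra_simps)
  qed
  have v_le: "cmod (v x) \<le> S x" for x
  proof -
    have "cmod (v x) \<le> (\<integral>y. norm (u y * ?M (x - y)) \<partial>lborel)"
      unfolding v_def conv_def by (rule integral_norm_bound)
    then show ?thesis by (simp add: S_def norm_mult m0)
  qed
  \<comment> \<open>Off the support of \<open>\<theta>\<close> the potential may oscillate without
    control, but there the test function vanishes.\<close>
  have r_le: "cmod (r x) \<le> \<delta> * S x" if "\<theta> x \<noteq> 0" for x
  proof -
    have "cmod (r x) \<le> (\<integral>y. norm (u y * (of_real (?V x - ?V y) * ?M (x - y))) \<partial>lborel)"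
      unfolding r by (rule integral_norm_bound)
    also have "\<dots> \<le> (\<integral>y. \<delta> * (cmod (u y) * m (x - y)) \<partial>lborel)"
    proof (rule integral_mono')
      show "integrable lborel (\<lambda>y. \<delta> * (cmod (u y) * m (x - y)))"
        by (rule integrable_mult_right) (rule yg(3))
      fix y
      show *: "norm (u y * (of_real (?V x - ?V y) * ?M (x - y))) \<le> \<delta> * (cmod (u y) * m (x - y))"
      proof (cases "norm (x - y) > \<epsilon>")
        case False
        then have "\<bar>?V x - ?V y\<bar> * (cmod (u y) * m (x - y)) \<le> \<delta> * (cmod (u y) * m (x - y))"
          using \<delta>[OF that, of y] m0[of "x - y"] by (intro mult_right_mono) auto
        moreover have "norm (u y * (of_real (?V x - ?V y) * ?M (x - y))) = \<bar>?V x - ?V y\<bar> * (cmod (u y) * m (x - y))"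
          unfolding norm_mult norm_of_real using m0[of "x - y"] by simp
        ultimately show ?thesis by simp
      qed (simp add: ms)
      show "0 \<le> \<delta> * (cmod (u y) * m (x - y))" by (rule order_trans[OF norm_ge_zero *])
    qed
    finally show ?thesis by (simp add: S_def)
  qed
  let ?t = "\<lambda>x. complex_of_real (\<theta> x)"
  let ?w = "\<lambda>x. ?t x * ?t x * cnj (v x)"
  have wt: "?w \<in> test_functions"
    by (intro test_mult2[OF smooth_cnj[OF vs]] test_mult[OF test_function_smooth[OF \<theta>(2)]] \<theta>(2))
  have iv: "integrable lborel (\<lambda>x. v x * ?w x)" and ir: "integrable lborel (\<lambda>x. r x * ?w x)"
    and iw: "integrable lborel (\<lambda>x. witten a v x * ?w x)"
    by (intro test_integrable test_mult smooth_witten a vs rs wt)+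
  have vw: "Re (v x * ?w x) = (\<theta> x)\<^sup>2 * (cmod (v x))\<^sup>2" for x
    unfolding cmod_power2 by (simp add: algebra_simps power2_eq_square)
  have S_nonneg: "S x \<ge> 0" for x by (rule yg(4))
  have \<theta>1: "(\<theta> x)\<^sup>2 \<le> 1" for x using \<theta>(3)[of x] by (simp add: abs_square_le_1)
  have bound_r: "Re (r x * ?w x) \<le> \<delta> * (S x)\<^sup>2" for x
  proof (cases "\<theta> x = 0")
    case True
    then show ?thesis using \<delta>0 by simp
  next
    case False
    have "Re (r x * ?w x) \<le> cmod (r x) * cmod (?w x)"
      using complex_Re_le_cmod[of "r x * ?w x"] by (simp only: norm_mult)
    also have "cmod (?w x) = (\<theta> x)\<^sup>2 * cmod (v x)"
      by (simp add: norm_mult power2_eq_square)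
    also have "cmod (r x) * ((\<theta> x)\<^sup>2 * cmod (v x)) \<le> (\<delta> * S x) * (1 * S x)"
      using r_le[OF False] v_le[of x] \<theta>1[of x] order_trans[OF norm_ge_zero r_le[OF False]]
      by (intro mult_mono) auto
    finally show ?thesis by (simp add: power2_eq_square)
  qed
  have "(\<integral>x. (\<theta> x)\<^sup>2 * (cmod (v x))\<^sup>2 \<partial>lborel) = (\<integral>x. Re (v x * ?w x) \<partial>lborel)"
    by (simp only: vw)
  also have "\<dots> = (\<integral>x. Re (r x * ?w x) - Re (witten a v x * ?w x) \<partial>lborel)"
    by (intro Bochner_Integration.integral_cong refl) (simp add: r_def algebra_simps)
  also have "\<dots> = (\<integral>x. Re (r x * ?w x) \<partial>lborel) - (\<integral>x. Re (witten a v x * ?w x) \<partial>lborel)"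
    by (rule Bochner_Integration.integral_diff[OF integrable_Re[OF ir] integrable_Re[OF iw]])
  finally have e1: "(\<integral>x. (\<theta> x)\<^sup>2 * (cmod (v x))\<^sup>2 \<partial>lborel) =
      (\<integral>x. Re (r x * ?w x) \<partial>lborel) - (\<integral>x. Re (witten a v x * ?w x) \<partial>lborel)" .
  have e2: "(\<integral>x. Re (witten a v x * ?w x) \<partial>lborel) = Re (\<integral>x. witten a v x * ?w x \<partial>lborel)"
    by (rule integral_Re[OF iw])
  have e3: "(\<integral>x. Re (r x * ?w x) \<partial>lborel) \<le> (\<integral>x. \<delta> * (S x)\<^sup>2 \<partial>lborel)"
    by (intro integral_mono integrable_Re ir integrable_mult_right yg(1) bound_r)
  have "- Re (\<integral>x. witten a v x * ?w x \<partial>lborel) \<le> (\<integral>x. (\<Sum>j\<in>UNIV. (partial_deriv j \<theta> x)\<^sup>2) * (cmod (v x))\<^sup>2 \<partial>lborel)"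
    using witten_localization[OF a vs \<theta>(1,2)] by simp
  also have "\<dots> \<le> (\<integral>x. G * (S x)\<^sup>2 \<partial>lborel)"
  proof (rule integral_mono')
    fix x
    show "(\<Sum>j\<in>UNIV. (partial_deriv j \<theta> x)\<^sup>2) * (cmod (v x))\<^sup>2 \<le> G * (S x)\<^sup>2"
      using v_le[of x] order_trans[OF sum_nonneg G] by (intro mult_mono G power_mono) auto
    then show "0 \<le> G * (S x)\<^sup>2"
      by (rule order_trans[rotated]) (intro mult_nonneg_nonneg sum_nonneg; simp)
  qed (intro integrable_mult_right yg(1))
  finally have e4: "- Re (\<integral>x. witten a v x * ?w x \<partial>lborel) \<le> G * (\<integral>x. (S x)\<^sup>2 \<partial>lborel)" by simp
  have "(\<integral>x. (\<theta> x)\<^sup>2 * (cmod (v x))\<^sup>2 \<partial>lborel) \<le> (\<delta> + G) * (\<integral>x. (S x)\<^sup>2 \<partial>lborel)"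
    using e3 e4 unfolding e1 e2 distrib_right by simp
  also have "\<dots> \<le> (\<delta> + G) * (\<integral>x. (cmod (u x))\<^sup>2 \<partial>lborel)"
    using order_trans[OF sum_nonneg G[of 0]] \<delta>0 by (intro mult_left_mono yg(2)) auto
  finally show ?thesis unfolding v_def .
qed

text \<open>The cut-off is at least a fixed \<open>c > 0\<close> on the support of
  \<open>\<psi>\<close>, however much it is dilated. So the small norm of \<open>\<theta> v\<close>
  controls the pairing of \<open>v\<close> with \<open>\<psi>\<close>, and the weak mollification
  error passes to \<open>u\<close>. Both contributions are multiples of an arbitrary
  \<open>t > 0\<close>.\<close>

theorem witten_kernel_trivial:
  fixes u :: "real^'n::finite \<Rightarrow> complex"
  assumes a: "smooth a" and u: "u \<in> L2 lborel"
    and eq: "\<And>\<eta>. \<eta> \<in> test_functions \<Longrightarrow> (\<integral>x. u x * (witten a \<eta> x + \<eta> x) \<partial>lborel) = 0"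
  shows "AE x in lborel. u x = 0"
proof (rule fundamental_lemma_borel[OF u])
  fix \<psi> :: "real^'n \<Rightarrow> complex" assume \<psi>: "\<psi> \<in> test_functions"
  obtain R where R: "R > 0" "\<And>x. norm x > R \<Longrightarrow> \<psi> x = 0" using \<psi> test_functionE by metis
  define b where "b = box_bump 1 ((\<chi> i. - 1) :: real^'n) (\<chi> i. 1)"
  have bs: "smooth b" unfolding b_def by (rule smooth_box_bump)
  have bt: "(\<lambda>x. complex_of_real (b x)) \<in> test_functions" unfolding b_def by (rule box_bump_test) simp
  have b01: "0 \<le> b x" "b x \<le> 1" for x unfolding b_def by (rule box_bump_bounds)+
  \<comment> \<open>Half the value at the origin is a lower bound of \<open>b\<close> on a whole
    ball; dilation only enlarges that ball.\<close>
  define c where "c = b 0 / 2"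
  have c: "c > 0" unfolding c_def b_def using box_bump_pos[of 1 0 "\<chi> i. - 1" "\<chi> i. 1"]
    by (simp add: mem_box_cart)
  have "\<exists>d>0. \<forall>x. norm x \<le> d \<longrightarrow> b x \<ge> c"
  proof -
    have "isCont b 0" using smooth_imp_continuous[OF bs] by (simp add: continuous_on_eq_continuous_at)
    then have "\<forall>\<^sub>F x in nhds 0. b x > c"
      using order_tendstoD(1)[of b "b 0" "nhds 0" c] c by (simp add: c_def isCont_def tendsto_at_iff_tendsto_nhds)
    then obtain d where "d > 0" "\<And>x. dist x 0 < d \<Longrightarrow> b x > c" unfolding eventually_nhds_metric by blast
    then show ?thesis by (intro exI[of _ "d/2"]) (auto intro: less_imp_le)
  qed
  then obtain d where d: "d > 0" "\<And>x. norm x \<le> d \<Longrightarrow> b x \<ge> c" by blast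
  have "\<exists>B. \<forall>j. B j > 0 \<and> (\<forall>x. \<bar>partial_deriv j b x\<bar> \<le> B j)"
  proof (intro choice allI)
    fix j
    obtain B where "B > 0" "\<And>x. norm (partial_deriv j (\<lambda>x. complex_of_real (b x)) x) \<le> B"
      using test_bounded[OF test_partial_deriv[OF bt]] by metis
    then show "\<exists>B. B > 0 \<and> (\<forall>x. \<bar>partial_deriv j b x\<bar> \<le> B)"
      by (auto simp: partial_deriv_of_real[OF bs])
  qed
  then obtain B where B: "\<And>j. B j > 0" "\<And>j x. \<bar>partial_deriv j b x\<bar> \<le> B j" by blast
  define Q where "Q = (\<Sum>j\<in>UNIV. (B j)\<^sup>2)"
  have Q: "Q \<ge> 0" unfolding Q_def by (intro sum_nonneg) simp
  define N where "N = (\<integral>x. (cmod (u x))\<^sup>2 \<partial>lborel)"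
  have N: "N \<ge> 0" by (simp add: N_def)
  define I where "I = (\<integral>y. norm (u y * indicator (cball 0 (R + 1)) y) \<partial>lborel)"
  have I: "I \<ge> 0" by (simp add: I_def)
  \<comment> \<open>The 1 stems from the mollification error and the quotient from Cauchy-Schwarz.
    It matters that \<open>K\<close> does not depend on \<open>t\<close>.\<close>
  define K where "K = 1 + L2_norm lborel \<psi> / c"
  have K: "K > 0" using c L2_norm_nonneg[of lborel \<psi>] by (simp add: K_def add_pos_nonneg)
  have main: "cmod (\<integral>x. u x * \<psi> x \<partial>lborel) \<le> t * K" if t: "t > 0" for t
  proof -
    \<comment> \<open>The commutator bound and the gradient bound will both be \<open>q\<close>, so
      the estimate reads \<open>(q + q) * N \<le> t\<^sup>2\<close>.\<close>
    define q where "q = t\<^sup>2 / (2 * (N + 1))"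
    have q: "q > 0" "2 * q * N \<le> t\<^sup>2" using t N by (auto simp: q_def field_simps)
    \<comment> \<open>Three demands on the dilation: \<open>s * R \<le> d\<close> keeps the cut-off
      above \<open>c\<close> on the ball of radius \<open>R\<close>, \<open>s \<le> 1\<close> allows
      replacing \<open>s\<^sup>2\<close> by \<open>s\<close>, and the quotient makes the squared
      gradient at most \<open>q\<close>.\<close>
    define s where "s = min (d / R) (min 1 (q / (Q + 1)))"
    have s: "s > 0" "s * R \<le> d" "s \<le> 1" "s * (Q + 1) \<le> q"
    proof -
      show "s > 0" "s \<le> 1" using d(1) R(1) q(1) Q by (auto simp: s_def)
      have "s \<le> d / R" "s \<le> q / (Q + 1)" by (auto simp: s_def)
      then show "s * R \<le> d" "s * (Q + 1) \<le> q" using R(1) Q by (simp_all add: pos_le_divide_eq)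
    qed
    define \<theta> where "\<theta> x = b (0 + s *\<^sub>R x)" for x
    have \<theta>s: "smooth \<theta>" unfolding \<theta>_def[abs_def] by (rule smooth_affine[OF bs])
    have \<theta>t: "(\<lambda>x. complex_of_real (\<theta> x)) \<in> test_functions"
      unfolding \<theta>_def[abs_def] using test_affine[OF bt, of s 0] s(1) by simp
    have \<theta>1: "\<bar>\<theta> x\<bar> \<le> 1" for x using b01[of "0 + s *\<^sub>R x"] by (simp add: \<theta>_def)
    have \<theta>c: "\<theta> x \<ge> c" if "norm x \<le> R" for x
    proof -
      have "norm (s *\<^sub>R x) \<le> s * R" using s(1) that by (simp add: mult_left_mono)
      then show ?thesis using d(2)[of "s *\<^sub>R x"] s(2) by (simp add: \<theta>_def)
    qed
    have G: "(\<Sum>j\<in>UNIV. (partial_deriv j \<theta> x)\<^sup>2) \<le> q" for x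
    proof -
      have "(partial_deriv j \<theta> x)\<^sup>2 \<le> s * (B j)\<^sup>2" for j
      proof -
        have "partial_deriv j \<theta> x = s * partial_deriv j b (s *\<^sub>R x)"
          using partial_deriv_affine(1)[OF smooth_imp_differentiable[OF bs], of j 0 s]
          by (simp add: \<theta>_def[abs_def])
        moreover have "(partial_deriv j b (s *\<^sub>R x))\<^sup>2 \<le> (B j)\<^sup>2"
          using B(2)[of j "s *\<^sub>R x"] B(1)[of j] by (simp add: abs_le_square_iff[symmetric])
        moreover have "s\<^sup>2 \<le> s" using s(1,3) by (simp add: power2_eq_square mult_left_le)
        ultimately show ?thesis using s(1) by (simp add: power_mult_distrib mult_mono)
      qed
      then have "(\<Sum>j\<in>UNIV. (partial_deriv j \<theta> x)\<^sup>2) \<le> s * Q"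
        unfolding Q_def sum_distrib_left by (intro sum_mono)
      also have "\<dots> \<le> q" using s(1,4) by (simp add: algebra_simps)
      finally show ?thesis .
    qed
    obtain L where L: "L > 0" "\<And>x. norm x > L \<Longrightarrow> complex_of_real (\<theta> x) = 0" using \<theta>t test_functionE by metis
    have "uniformly_continuous_on (cball 0 (L + 1)) (witten_potential a)"
      using smooth_imp_continuous[OF smooth_witten_potential[OF a]]
      by (intro compact_uniformly_continuous) (auto intro: continuous_on_subset)
    then obtain e1 where e1: "e1 > 0" "\<And>x y. x \<in> cball 0 (L + 1) \<Longrightarrow> y \<in> cball 0 (L + 1) \<Longrightarrow> dist y x < e1 \<Longrightarrow>
        dist (witten_potential a y) (witten_potential a x) < q"
      unfolding uniformly_continuous_on_def using q(1) by metis
    define \<omega> where "\<omega> = t / (I + 1)"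
    have \<omega>: "\<omega> > 0" "\<omega> * I \<le> t" using t I by (auto simp: \<omega>_def field_simps)
    obtain e2 where e2: "e2 > 0" "\<And>x y. norm (x - y) < e2 \<Longrightarrow> norm (\<psi> x - \<psi> y) < \<omega>"
      using test_uniformly_continuous[OF \<psi> \<omega>(1)] by metis
    \<comment> \<open>The radius depends on the cut-off: \<open>e1\<close> comes from uniform
      continuity of the potential on a ball containing the 1-neighbourhood of its support,
      \<open>e2\<close> from that of \<open>\<psi>\<close>.\<close>
    define \<epsilon> where "\<epsilon> = min 1 (min (e1/2) (e2/2))"
    have \<epsilon>: "\<epsilon> > 0" "\<epsilon> \<le> 1" "\<epsilon> < e1" "\<epsilon> < e2" using e1(1) e2(1) by (auto simp: \<epsilon>_def min_def)
    obtain m :: "real^'n \<Rightarrow> real" where m: "(\<lambda>x. complex_of_real (m x)) \<in> test_functions" "\<And>x. m x \<ge> 0"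
      "\<And>x. norm x > \<epsilon> \<Longrightarrow> m x = 0" "(\<integral>\<^sup>+x. ennreal (m x) \<partial>lborel) = 1" "continuous_on UNIV m"
      using mollifier_exists[OF \<epsilon>(1)] by metis
    define v where "v = conv u (\<lambda>x. complex_of_real (m x))"
    have vs: "smooth v" unfolding v_def by (rule smooth_conv[OF L2_locally_integrable[OF u] m(1)])
    have "(\<integral>x. (\<theta> x)\<^sup>2 * (cmod (v x))\<^sup>2 \<partial>lborel) \<le> (q + q) * N"
      unfolding v_def N_def
    proof (rule witten_mollified_estimate[OF a u eq m(1,2,4,5,3) \<theta>s \<theta>t \<theta>1 G])
      show "q \<ge> 0" using q by simp
      fix x y assume x: "\<theta> x \<noteq> 0" and xy: "norm (x - y) \<le> \<epsilon>"
      have "norm x \<le> L" using L(2)[of x] x by force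
      moreover have "norm y \<le> norm (x - y) + norm x" using norm_triangle_ineq4[of x "x - y"] by simp
      ultimately have "dist (witten_potential a y) (witten_potential a x) < q"
        using xy \<epsilon> by (intro e1(2)) (auto simp: dist_norm norm_minus_commute)
      then show "\<bar>witten_potential a x - witten_potential a y\<bar> \<le> q" by (simp add: dist_real_def abs_minus_commute)
    qed
    also have "\<dots> \<le> t\<^sup>2" using q(2) by simp
    finally have \<theta>v: "(\<integral>x. (\<theta> x)\<^sup>2 * (cmod (v x))\<^sup>2 \<partial>lborel) \<le> t\<^sup>2" .
    define p where "p x = complex_of_real (\<theta> x) * v x" for x
    have pt: "p \<in> test_functions" unfolding p_def[abs_def] by (rule test_mult2[OF vs \<theta>t])
    have p_norm: "L2_norm lborel p \<le> t"
    proof -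
      have "(L2_norm lborel p)\<^sup>2 \<le> t\<^sup>2"
        using \<theta>v by (simp add: L2_norm_square p_def norm_mult power_mult_distrib)
      then show ?thesis by (rule power2_le_imp_le) (use t in simp)
    qed
    have "cmod (\<integral>x. v x * \<psi> x \<partial>lborel) \<le> (\<integral>x. cmod (v x * \<psi> x) \<partial>lborel)"
      by (rule integral_norm_bound)
    also have "\<dots> \<le> (\<integral>x. (cmod (p x) * cmod (\<psi> x)) / c \<partial>lborel)"
    proof (rule integral_mono)
      show "integrable lborel (\<lambda>x. cmod (v x * \<psi> x))"
        by (intro integrable_norm test_integrable test_mult vs \<psi>)
      have "integrable lborel (\<lambda>x. cmod (p x * \<psi> x))"
        by (intro integrable_norm test_integrable test_mult test_function_smooth pt \<psi>)
      then show "integrable lborel (\<lambda>x. (cmod (p x) * cmod (\<psi> x)) / c)" by (simp add: norm_mult)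
      fix x
      show "cmod (v x * \<psi> x) \<le> (cmod (p x) * cmod (\<psi> x)) / c"
      proof (cases "norm x > R")
        case False
        then have "c * (cmod (v x) * cmod (\<psi> x)) \<le> \<bar>\<theta> x\<bar> * (cmod (v x) * cmod (\<psi> x))"
          using \<theta>c[of x] by (intro mult_right_mono) auto
        then show ?thesis using c by (simp add: p_def norm_mult pos_le_divide_eq mult_ac)
      qed (simp add: R(2))
    qed
    also have "\<dots> = (\<integral>x. cmod (p x) * cmod (\<psi> x) \<partial>lborel) / c" by simp
    also have "\<dots> \<le> (L2_norm lborel p * L2_norm lborel \<psi>) / c"
      using c by (intro divide_right_mono L2_Holder test_L2_lborel pt \<psi>) simp
    also have "\<dots> \<le> (t * L2_norm lborel \<psi>) / c"
      using c p_norm by (intro divide_right_mono mult_right_mono L2_norm_nonneg) simp_all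
    finally have 1: "cmod (\<integral>x. v x * \<psi> x \<partial>lborel) \<le> t * (L2_norm lborel \<psi> / c)" by simp
    have "cmod ((\<integral>x. v x * \<psi> x \<partial>lborel) - (\<integral>x. u x * \<psi> x \<partial>lborel)) \<le> \<omega> * I"
      unfolding v_def I_def
      by (rule mollification_weak_error[OF L2_locally_integrable[OF u] m(1,2,4,3) \<epsilon>(2) \<psi> R(2)])
        (use e2(2) \<epsilon>(4) in \<open>auto intro: less_imp_le\<close>)
    then have 2: "cmod ((\<integral>x. v x * \<psi> x \<partial>lborel) - (\<integral>x. u x * \<psi> x \<partial>lborel)) \<le> t" using \<omega>(2) by simp
    have "cmod (\<integral>x. u x * \<psi> x \<partial>lborel) \<le> t + t * (L2_norm lborel \<psi> / c)"
      using norm_triangle_sub[of "\<integral>x. u x * \<psi> x \<partial>lborel" "\<integral>x. v x * \<psi> x \<partial>lborel"] 1 2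
      by (simp add: norm_minus_commute)
    then show ?thesis by (simp add: K_def algebra_simps)
  qed
  show "(\<integral>x. u x * \<psi> x \<partial>lborel) = 0"
  proof (rule ccontr)
    assume ne: "(\<integral>x. u x * \<psi> x \<partial>lborel) \<noteq> 0"
    \<comment> \<open>The choice of \<open>t\<close> as the modulus divided by \<open>2 * K\<close>
      bounds the modulus by half of itself.\<close>
    then have "cmod (\<integral>x. u x * \<psi> x \<partial>lborel) \<le> cmod (\<integral>x. u x * \<psi> x \<partial>lborel) / (2 * K) * K"
      using K by (intro main) simp
    then show False using ne K by simp
  qed
qed

section \<open>Conjugation, complex scalars, and the passage from real to complex pairings\<close>

lemma Z_adj_cnj: "smooth f \<Longrightarrow> Z_adj a j (\<lambda>x. cnj (f x)) = (\<lambda>x. cnj (Z_adj a j f x))"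
  by (simp add: Z_adj_def partial_deriv_cnj fun_eq_iff)

lemma Z_op_cnj: "smooth f \<Longrightarrow> Z_op a j (\<lambda>x. cnj (f x)) = (\<lambda>x. cnj (Z_op a j f x))"
  by (simp add: Z_op_def partial_deriv_cnj fun_eq_iff)

lemma witten_cnj: "smooth a \<Longrightarrow> smooth f \<Longrightarrow> witten a (\<lambda>x. cnj (f x)) = (\<lambda>x. cnj (witten a f x))"
  by (simp add: witten_def Z_op_cnj Z_adj_cnj smooth_Z_op fun_eq_iff)

lemma Z_adj_cmult: "smooth f \<Longrightarrow> Z_adj a j (\<lambda>x. c * f x) = (\<lambda>x. c * Z_adj a j f x)"
  by (simp add: Z_adj_def partial_deriv_cmult fun_eq_iff algebra_simps)

lemma Z_op_cmult: "smooth f \<Longrightarrow> Z_op a j (\<lambda>x. c * f x) = (\<lambda>x. c * Z_op a j f x)"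
  by (simp add: Z_op_def partial_deriv_cmult fun_eq_iff algebra_simps)

lemma witten_cmult: "smooth a \<Longrightarrow> smooth f \<Longrightarrow> witten a (\<lambda>x. c * f x) = (\<lambda>x. c * witten a f x)"
  by (simp add: witten_def Z_op_cmult Z_adj_cmult smooth_Z_op fun_eq_iff sum_distrib_left)

text \<open>Testing with \<open>\<i> * \<eta>\<close> besides \<open>\<eta>\<close> recovers the
  imaginary part, and testing with the conjugate of \<open>\<eta>\<close> turns Hermitian into
  bilinear pairings. The last two hypotheses make \<open>F\<close> compatible with both
  operations.\<close>

lemma real_pairing_iff_complex_pairing:
  fixes u w :: "real^'n::finite \<Rightarrow> complex" and F :: "(real^'n \<Rightarrow> complex) \<Rightarrow> real^'n \<Rightarrow> complex"
  assumes u: "u \<in> L2 lebesgue" and w: "w \<in> L2 lebesgue"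
    and F: "\<And>\<eta>. \<eta> \<in> test_functions \<Longrightarrow> F \<eta> \<in> test_functions"
    and Fi: "\<And>\<eta>. \<eta> \<in> test_functions \<Longrightarrow> F (\<lambda>x. \<i> * \<eta> x) = (\<lambda>x. \<i> * F \<eta> x)"
    and Fc: "\<And>\<eta>. \<eta> \<in> test_functions \<Longrightarrow> F (\<lambda>x. cnj (\<eta> x)) = (\<lambda>x. cnj (F \<eta> x))"
  shows "(\<forall>\<eta>\<in>test_functions. inner (cls u) (cls \<eta>) = inner (cls w) (cls (F \<eta>))) \<longleftrightarrow>
    (\<forall>\<eta>\<in>test_functions. (\<integral>x. u x * \<eta> x \<partial>lebesgue) = (\<integral>x. w x * F \<eta> x \<partial>lebesgue))"
    (is "?A \<longleftrightarrow> ?B")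
proof -
  have A: "?A \<longleftrightarrow> (\<forall>\<eta>\<in>test_functions. Re (L2_inner lebesgue u \<eta>) = Re (L2_inner lebesgue w (F \<eta>)))"
    by (intro ball_cong refl) (simp add: inner_cls u w F test_L2)
  have B: "?B \<longleftrightarrow> (\<forall>\<eta>\<in>test_functions. L2_inner lebesgue u \<eta> = L2_inner lebesgue w (F \<eta>))" (is "_ \<longleftrightarrow> ?C")
  proof
    assume ?B
    show ?C
    proof
      fix \<eta> :: "real^'n \<Rightarrow> complex" assume \<eta>: "\<eta> \<in> test_functions"
      show "L2_inner lebesgue u \<eta> = L2_inner lebesgue w (F \<eta>)"
        using \<open>?B\<close>[rule_format, OF test_cnj[OF \<eta>]] by (simp add: L2_inner_def Fc[OF \<eta>])
    qed
  next
    assume ?C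
    show ?B
    proof
      fix \<eta> :: "real^'n \<Rightarrow> complex" assume \<eta>: "\<eta> \<in> test_functions"
      show "(\<integral>x. u x * \<eta> x \<partial>lebesgue) = (\<integral>x. w x * F \<eta> x \<partial>lebesgue)"
        using \<open>?C\<close>[rule_format, OF test_cnj[OF \<eta>]] by (simp add: L2_inner_def Fc[OF \<eta>])
    qed
  qed
  have i: "L2_inner lebesgue f (\<lambda>x. \<i> * \<eta> x) = - \<i> * L2_inner lebesgue f \<eta>" for f \<eta> :: "real^'n \<Rightarrow> complex"
  proof -
    have "(\<lambda>x. f x * cnj (\<i> * \<eta> x)) = (\<lambda>x. - \<i> * (f x * cnj (\<eta> x)))" by (simp add: fun_eq_iff)
    then show ?thesis unfolding L2_inner_def by (simp only: integral_mult_right_zero)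
  qed
  show ?thesis unfolding A B
  proof (intro iffI ballI)
    fix \<eta> :: "real^'n \<Rightarrow> complex" assume R: "\<forall>\<eta>\<in>test_functions. Re (L2_inner lebesgue u \<eta>) = Re (L2_inner lebesgue w (F \<eta>))"
      and \<eta>: "\<eta> \<in> test_functions"
    have "Re (- \<i> * L2_inner lebesgue u \<eta>) = Re (- \<i> * L2_inner lebesgue w (F \<eta>))"
      using R[rule_format, OF test_cmult[OF \<eta>, of \<i>]] by (simp only: Fi[OF \<eta>] i)
    then show "L2_inner lebesgue u \<eta> = L2_inner lebesgue w (F \<eta>)"
      using R[rule_format, OF \<eta>] by (simp add: complex_eq_iff)
  qed simp
qed

lemma cls_sum:
  assumes "finite I" "\<And>i. i \<in> I \<Longrightarrow> f i \<in> L2 lebesgue"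
  shows "cls (\<lambda>x. \<Sum>i\<in>I. f i x) = (\<Sum>i\<in>I. cls (f i))"
  using assms by (induction I) (simp_all add: cls_zero cls_add[symmetric] L2_sum)

text \<open>The fundamental lemma restated in the Hilbert space: the test functions have trivial
  orthogonal complement.\<close>

lemma test_total:
  fixes h :: "(real^'n::finite) l2"
  assumes "\<And>\<eta>. \<eta> \<in> test_functions \<Longrightarrow> inner h (cls \<eta>) = 0"
  shows "h = 0"
proof -
  obtain u where u: "u \<in> L2 lebesgue" "h = cls u" by (rule cls_cases)
  obtain v where v: "v \<in> borel_measurable borel" "v \<in> L2 lborel" "v \<in> L2 lebesgue"
    "AE x in lebesgue. u x = v x" by (rule L2_lebesgue_borel_representative[OF u(1)])
  have hv: "h = cls v" using u v cls_eq_iff by blast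
  have "\<forall>\<eta>\<in>test_functions. inner (cls v) (cls \<eta>) = inner (cls (\<lambda>x. 0)) (cls \<eta>)"
    using assms by (simp add: hv cls_zero)
  then have "\<forall>\<eta>\<in>test_functions. (\<integral>x. v x * \<eta> x \<partial>lebesgue) = (\<integral>x. 0 * \<eta> x \<partial>lebesgue)"
    using real_pairing_iff_complex_pairing[OF v(3) L2_zero, of "\<lambda>\<eta>. \<eta>"] by blast
  then have "(\<integral>x. v x * \<eta> x \<partial>lborel) = 0" if "\<eta> \<in> test_functions" for \<eta>
    using that v(1) test_measurable[OF that] integral_lebesgue_eq_lborel[of "\<lambda>x. v x * \<eta> x"] by simp
  then have "AE x in lborel. v x = 0" by (rule fundamental_lemma_borel[OF v(2)])
  then have "AE x in lebesgue. v x = 0" by (rule AE_completion)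
  then show ?thesis unfolding hv cls_zero[symmetric] using cls_eq_iff[OF v(3) L2_zero] by simp
qed

text \<open>Triviality of the kernel restated as density: nothing is orthogonal to the range of the
  operator plus 1 on test functions. This is the form in which essential self-adjointness is
  used.\<close>

lemma witten_range_total:
  fixes h :: "(real^'n::finite) l2"
  assumes a: "smooth a"
    and "\<And>\<eta>. \<eta> \<in> test_functions \<Longrightarrow> inner h (cls (\<lambda>x. witten a \<eta> x + \<eta> x)) = 0"
  shows "h = 0"
proof -
  obtain u where u: "u \<in> L2 lebesgue" "h = cls u" by (rule cls_cases)
  obtain v where v: "v \<in> borel_measurable borel" "v \<in> L2 lborel" "v \<in> L2 lebesgue"
    "AE x in lebesgue. u x = v x" by (rule L2_lebesgue_borel_representative[OF u(1)])
  have hv: "h = cls v" using u v cls_eq_iff by blast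
  let ?F = "\<lambda>\<eta> x. witten a \<eta> x + \<eta> x"
  have F: "?F \<eta> \<in> test_functions" if "\<eta> \<in> test_functions" for \<eta>
    by (intro test_add test_witten a that)
  have "\<forall>\<eta>\<in>test_functions. inner (cls (\<lambda>x. 0)) (cls \<eta>) = inner (cls v) (cls (?F \<eta>))"
    using assms(2) by (simp add: hv cls_zero)
  then have "\<forall>\<eta>\<in>test_functions. (\<integral>x. 0 * \<eta> x \<partial>lebesgue) = (\<integral>x. v x * ?F \<eta> x \<partial>lebesgue)"
    using real_pairing_iff_complex_pairing[OF L2_zero v(3), of ?F] F
    by (simp add: witten_cmult witten_cnj a test_function_smooth distrib_left)
  then have "(\<integral>x. v x * ?F \<eta> x \<partial>lborel) = 0" if "\<eta> \<in> test_functions" for \<eta>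
    using that v(1) test_measurable[OF F[OF that]] integral_lebesgue_eq_lborel[of "\<lambda>x. v x * ?F \<eta> x"] by simp
  then have "AE x in lborel. v x = 0" by (rule witten_kernel_trivial[OF a v(2)])
  then have "AE x in lebesgue. v x = 0" by (rule AE_completion)
  then show ?thesis unfolding hv cls_zero[symmetric] using cls_eq_iff[OF v(3) L2_zero] by simp
qed

section \<open>The form domain\<close>

text \<open>The graph of the weak operators \<open>Z_j\<close> on their maximal common domain. As a
  subset of the product Hilbert space it carries the form norm, and completeness of the form domain
  becomes closedness of a subspace.\<close>

definition energy_space :: "(real^'n::finite \<Rightarrow> real) \<Rightarrow> ((real^'n) l2 \<times> (((real^'n) l2)^'n)) set" where
  "energy_space a = {p. \<forall>\<eta>\<in>test_functions. \<forall>j.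
     inner (snd p $ j) (cls \<eta>) = inner (fst p) (cls (Z_adj a j \<eta>))}"

definition energy_embed :: "(real^'n::finite \<Rightarrow> real) \<Rightarrow> (real^'n \<Rightarrow> complex) \<Rightarrow> (real^'n) l2 \<times> (((real^'n) l2)^'n)" where
  "energy_embed a \<eta> = (cls \<eta>, \<chi> j. cls (Z_op a j \<eta>))"

lemma subspace_energy_space: "subspace (energy_space a)"
  by (auto simp: subspace_def energy_space_def inner_add_left inner_scaleR_left)

lemma closed_energy_space: "closed (energy_space a)"
proof -
  have "energy_space a = (\<Inter>\<eta>\<in>test_functions. \<Inter>j. {p.
     inner (snd p $ j) (cls \<eta>) = inner (fst p) (cls (Z_adj a j \<eta>))})"
    by (auto simp: energy_space_def)
  moreover have "closed {p :: (real^'a) l2 \<times> (((real^'a) l2)^'a).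
     inner (snd p $ j) (cls \<eta>) = inner (fst p) (cls (Z_adj a j \<eta>))}" for \<eta> j
    by (intro closed_Collect_eq continuous_intros)
  ultimately show ?thesis by (auto intro!: closed_INT)
qed

lemma energy_embed_in_energy_space:
  assumes a: "smooth a" and \<eta>: "\<eta> \<in> test_functions"
  shows "energy_embed a \<eta> \<in> energy_space a"
  unfolding energy_space_def
proof (intro CollectI ballI allI)
  fix \<zeta> j assume \<zeta>: "\<zeta> \<in> (test_functions :: (real^'a \<Rightarrow> complex) set)"
  have m: "(\<lambda>x. Z_op a j \<eta> x * cnj (\<zeta> x)) \<in> test_functions" "(\<lambda>x. \<eta> x * cnj (Z_adj a j \<zeta> x)) \<in> test_functions"
    by (intro test_mult test_Z_op test_function_smooth a \<eta> test_cnj \<zeta> test_Z_adj)+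
  have "L2_inner lebesgue (Z_op a j \<eta>) \<zeta> = L2_inner lebesgue \<eta> (Z_adj a j \<zeta>)"
    using Z_op_transpose[OF a test_function_smooth[OF \<eta>] test_cnj[OF \<zeta>], of j]
    unfolding L2_inner_def integral_lebesgue_eq_lborel[OF test_measurable[OF m(1)]]
      integral_lebesgue_eq_lborel[OF test_measurable[OF m(2)]]
    by (simp add: Z_adj_cnj test_function_smooth[OF \<zeta>])
  then show "inner (snd (energy_embed a \<eta>) $ j) (cls \<zeta>) = inner (fst (energy_embed a \<eta>)) (cls (Z_adj a j \<zeta>))"
    by (simp add: energy_embed_def inner_cls test_L2 test_Z_op test_Z_adj a \<eta> \<zeta>)
qed

text \<open>Each \<open>Z_op a j \<eta>\<close> is again a test function, so the weak definition of
  \<open>Z_j\<close> applies to it and moves both first-order factors onto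
  \<open>\<eta>\<close>.\<close>

lemma inner_energy_embed:
  assumes a: "smooth a" and \<eta>: "\<eta> \<in> test_functions" and p: "p \<in> energy_space a"
  shows "inner p (energy_embed a \<eta>) = inner (fst p) (cls (\<lambda>x. witten a \<eta> x + \<eta> x))"
proof -
  have t: "Z_adj a j (Z_op a j \<eta>) \<in> test_functions" for j by (intro test_Z_op test_Z_adj a \<eta>)
  have "inner p (energy_embed a \<eta>) = inner (fst p) (cls \<eta>) + (\<Sum>j\<in>UNIV. inner (snd p $ j) (cls (Z_op a j \<eta>)))"
    by (simp add: energy_embed_def inner_prod_def inner_vec_def)
  also have "\<dots> = inner (fst p) (cls \<eta>) + (\<Sum>j\<in>UNIV. inner (fst p) (cls (Z_adj a j (Z_op a j \<eta>))))"
    using p test_Z_op[OF a \<eta>] by (simp add: energy_space_def)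
  also have "\<dots> = inner (fst p) (cls (witten a \<eta>) + cls \<eta>)"
    unfolding witten_def[abs_def]
    by (simp add: cls_sum test_L2[OF t] inner_add_right inner_sum_right)
  also have "cls (witten a \<eta>) + cls \<eta> = cls (\<lambda>x. witten a \<eta> x + \<eta> x)"
    by (intro cls_add test_L2 test_witten a \<eta>)
  finally show ?thesis .
qed

definition energy_riesz :: "(real^'n::finite \<Rightarrow> real) \<Rightarrow> (real^'n) l2 \<Rightarrow> (real^'n) l2 \<times> (((real^'n) l2)^'n)" where
  "energy_riesz a g = (SOME p. p \<in> energy_space a \<and> (\<forall>s\<in>energy_space a. inner p s = inner g (fst s)))"

text \<open>The functional \<open>\<lambda>s. inner g (fst s)\<close> is the inner product with
  \<open>(g, 0)\<close>, so it is represented by the orthogonal projection of \<open>(g, 0)\<close>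
  onto the energy space.\<close>

lemma energy_riesz:
  "energy_riesz a g \<in> energy_space a"
  "s \<in> energy_space a \<Longrightarrow> inner (energy_riesz a g) s = inner g (fst s)"
proof -
  obtain p where p: "p \<in> energy_space a" "\<And>s. s \<in> energy_space a \<Longrightarrow> inner ((g, 0) - p) s = 0"
    using orthogonal_projection[OF subspace_energy_space closed_energy_space] by metis
  have "inner p s = inner g (fst s)" if "s \<in> energy_space a" for s
    using p(2)[OF that] by (simp add: inner_diff_left) (simp add: inner_prod_def)
  with p(1) have "\<exists>p. p \<in> energy_space a \<and> (\<forall>s\<in>energy_space a. inner p s = inner g (fst s))" by blast
  from someI_ex[OF this]
  have *: "energy_riesz a g \<in> energy_space a \<and> (\<forall>s\<in>energy_space a. inner (energy_riesz a g) s = inner g (fst s))"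
    unfolding energy_riesz_def .
  then show "energy_riesz a g \<in> energy_space a"
    "s \<in> energy_space a \<Longrightarrow> inner (energy_riesz a g) s = inner g (fst s)" by auto
qed

text \<open>Uniqueness of the representative: the discrepancy lies in the energy space and is
  orthogonal to it, hence to itself.\<close>

lemma energy_riesz_diff: "energy_riesz a (x - y) = energy_riesz a x - energy_riesz a y"
proof -
  let ?d = "energy_riesz a (x - y) - (energy_riesz a x - energy_riesz a y)"
  have d: "?d \<in> energy_space a"
    by (intro subspace_diff subspace_energy_space energy_riesz)
  have "inner ?d ?d = 0"
    using energy_riesz(2)[OF d, of "x - y"] energy_riesz(2)[OF d, of x] energy_riesz(2)[OF d, of y]
    by (simp only: inner_diff_left[of _ _ ?d]) (simp add: inner_diff_left)
  then show ?thesis by simp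
qed

lemma norm_energy_riesz_square: "(norm (energy_riesz a g))\<^sup>2 = inner g (fst (energy_riesz a g))"
  by (simp add: power2_norm_eq_inner energy_riesz)

lemma norm_fst_le_norm: "norm (fst p) \<le> norm p"
  by (simp add: norm_prod_def real_le_rsqrt)

lemma norm_energy_riesz: "norm (energy_riesz a g) \<le> norm g"
proof -
  have "(norm (energy_riesz a g))\<^sup>2 \<le> norm g * norm (energy_riesz a g)"
    unfolding norm_energy_riesz_square
    using norm_cauchy_schwarz[of g "fst (energy_riesz a g)"]
      mult_left_mono[OF norm_fst_le_norm[of "energy_riesz a g"] norm_ge_zero[of g]] by simp
  then show ?thesis
    by (cases "energy_riesz a g = 0") (simp_all add: power2_eq_square)
qed

text \<open>Both sides are the energy inner product of the two representatives.\<close>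

lemma energy_riesz_symmetric: "inner f (fst (energy_riesz a g)) = inner g (fst (energy_riesz a f))"
  using energy_riesz(2)[OF energy_riesz(1), of a f g] energy_riesz(2)[OF energy_riesz(1), of a g f]
  by (simp add: inner_commute)

text \<open>Essential self-adjointness enters here. An arbitrary weak solution in \<open>L2\<close>
  has the same pairings with a total set as the form solution and therefore equals it; in particular
  it belongs to the form domain.\<close>

lemma energy_riesz_eqI:
  assumes a: "smooth a"
    and eq: "\<And>\<eta>. \<eta> \<in> test_functions \<Longrightarrow> inner f (cls (\<lambda>x. witten a \<eta> x + \<eta> x)) = inner g (cls \<eta>)"
  shows "f = fst (energy_riesz a g)"
proof -
  have "f - fst (energy_riesz a g) = 0"
  proof (rule witten_range_total[OF a])
    fix \<eta> :: "real^'a \<Rightarrow> complex" assume \<eta>: "\<eta> \<in> test_functions"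
    have "inner (fst (energy_riesz a g)) (cls (\<lambda>x. witten a \<eta> x + \<eta> x)) = inner (energy_riesz a g) (energy_embed a \<eta>)"
      by (rule inner_energy_embed[OF a \<eta> energy_riesz(1), symmetric])
    also have "\<dots> = inner g (cls \<eta>)"
      using energy_riesz(2)[OF energy_embed_in_energy_space[OF a \<eta>]] by (simp add: energy_embed_def)
    finally show "inner (f - fst (energy_riesz a g)) (cls (\<lambda>x. witten a \<eta> x + \<eta> x)) = 0"
      using eq[OF \<eta>] by (simp add: inner_diff_left)
  qed
  then show ?thesis by simp
qed

section \<open>The self-adjoint operator\<close>

definition witten_operator :: "(real^'n::finite \<Rightarrow> real) \<Rightarrow> (real^'n) operator" where
  "witten_operator a = adjoint_operator lebesgue ((\<lambda>f. (f, witten a f)) ` test_functions)"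

lemma schrodinger_test_eq:
  assumes a: "smooth a" and V: "\<And>x. V x = witten_potential a x"
  shows "schrodinger_test V = (\<lambda>f. (f, witten a f)) ` test_functions"
  unfolding schrodinger_test_def
  by (intro image_cong refl) (simp add: witten_eq a test_function_smooth V fun_eq_iff)

lemma witten_operator_iff_weak:
  assumes a: "smooth a"
  shows "(f, k) \<in> witten_operator a \<longleftrightarrow> f \<in> L2 lebesgue \<and> k \<in> L2 lebesgue \<and>
    (\<forall>\<eta>\<in>test_functions. inner (cls k) (cls \<eta>) = inner (cls f) (cls (witten a \<eta>)))"
proof (cases "f \<in> L2 lebesgue \<and> k \<in> L2 lebesgue")
  case True
  have "(\<forall>\<eta>\<in>test_functions. inner (cls k) (cls \<eta>) = inner (cls f) (cls (witten a \<eta>))) \<longleftrightarrow>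
    (\<forall>\<eta>\<in>test_functions. (\<integral>x. k x * \<eta> x \<partial>lebesgue) = (\<integral>x. f x * witten a \<eta> x \<partial>lebesgue))"
    using True by (intro real_pairing_iff_complex_pairing)
      (auto simp: test_witten witten_cmult witten_cnj a test_function_smooth)
  also have "\<dots> \<longleftrightarrow> (\<forall>\<eta>\<in>test_functions. L2_inner lebesgue (witten a \<eta>) f = L2_inner lebesgue \<eta> k)" (is "?B \<longleftrightarrow> ?C")
  proof -
    have e: "L2_inner lebesgue \<eta> h = cnj (\<integral>x. h x * cnj (\<eta> x) \<partial>lebesgue)" for \<eta> h :: "real^'a \<Rightarrow> complex"
      by (subst L2_inner_commute) (simp add: L2_inner_def)
    have w: "witten a (\<lambda>x. cnj (\<eta> x)) = (\<lambda>x. cnj (witten a \<eta> x))" if "\<eta> \<in> test_functions" for \<eta>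
      by (rule witten_cnj[OF a test_function_smooth[OF that]])
    show ?thesis
    proof
      assume B: ?B
      show ?C
      proof
        fix \<eta> :: "real^'a \<Rightarrow> complex" assume \<eta>: "\<eta> \<in> test_functions"
        show "L2_inner lebesgue (witten a \<eta>) f = L2_inner lebesgue \<eta> k"
          using B[rule_format, OF test_cnj[OF \<eta>]] unfolding e w[OF \<eta>] by simp
      qed
    next
      assume C: ?C
      show ?B
      proof
        fix \<eta> :: "real^'a \<Rightarrow> complex" assume \<eta>: "\<eta> \<in> test_functions"
        show "(\<integral>x. k x * \<eta> x \<partial>lebesgue) = (\<integral>x. f x * witten a \<eta> x \<partial>lebesgue)"
          using C[rule_format, OF test_cnj[OF \<eta>]] unfolding e w[OF \<eta>] by simp
      qed
    qed
  qed
  finally show ?thesis using True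
    by (auto simp: witten_operator_def adjoint_operator_def)
qed (auto simp: witten_operator_def adjoint_operator_def)

text \<open>The graph is that of \<open>R^(-1) - 1\<close> for the map \<open>R\<close> formed by
  the first component of \<open>energy_riesz\<close>. Symmetry, resolvent and compactness of the
  operator thus become questions about \<open>R\<close>.\<close>

lemma witten_operator_iff:
  assumes a: "smooth a"
  shows "(f, k) \<in> witten_operator a \<longleftrightarrow> f \<in> L2 lebesgue \<and> k \<in> L2 lebesgue \<and>
    cls f = fst (energy_riesz a (cls f + cls k))"
proof (cases "f \<in> L2 lebesgue \<and> k \<in> L2 lebesgue")
  case True
  have add: "cls (\<lambda>x. witten a \<eta> x + \<eta> x) = cls (witten a \<eta>) + cls \<eta>" if "\<eta> \<in> test_functions" for \<eta>
    by (intro cls_add[symmetric] test_L2 test_witten a that)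
  show ?thesis
  proof
    assume "(f, k) \<in> witten_operator a"
    then have "\<forall>\<eta>\<in>test_functions. inner (cls k) (cls \<eta>) = inner (cls f) (cls (witten a \<eta>))"
      using witten_operator_iff_weak[OF a] by blast
    then have "cls f = fst (energy_riesz a (cls f + cls k))"
      by (intro energy_riesz_eqI a) (simp add: add inner_add_left inner_add_right)
    with True show "f \<in> L2 lebesgue \<and> k \<in> L2 lebesgue \<and> cls f = fst (energy_riesz a (cls f + cls k))" by blast
  next
    assume *: "f \<in> L2 lebesgue \<and> k \<in> L2 lebesgue \<and> cls f = fst (energy_riesz a (cls f + cls k))"
    let ?p = "energy_riesz a (cls f + cls k)"
    have "inner (cls k) (cls \<eta>) = inner (cls f) (cls (witten a \<eta>))" if \<eta>: "\<eta> \<in> test_functions" for \<eta>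
    proof -
      have "inner (cls f) (cls (witten a \<eta>) + cls \<eta>) = inner ?p (energy_embed a \<eta>)"
        using inner_energy_embed[OF a \<eta> energy_riesz(1)[of a "cls f + cls k"]] * by (simp only: add[OF \<eta>])
      also have "\<dots> = inner (cls f + cls k) (cls \<eta>)"
        using energy_riesz(2)[OF energy_embed_in_energy_space[OF a \<eta>]] by (simp add: energy_embed_def)
      finally show ?thesis by (simp add: inner_add_left inner_add_right)
    qed
    with True show "(f, k) \<in> witten_operator a" using witten_operator_iff_weak[OF a] by blast
  qed
qed (auto simp: witten_operator_def adjoint_operator_def)

text \<open>Symmetry on test functions, read off from the energy inner product of the two embedded
  functions.\<close>

lemma test_in_witten_operator:
  assumes a: "smooth a" and \<eta>: "\<eta> \<in> test_functions"
  shows "(\<eta>, witten a \<eta>) \<in> witten_operator a"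
  unfolding witten_operator_iff[OF a]
proof (intro conjI test_L2 test_witten a \<eta>)
  show "cls \<eta> = fst (energy_riesz a (cls \<eta> + cls (witten a \<eta>)))"
  proof (rule energy_riesz_eqI[OF a])
    fix \<zeta> :: "real^'a \<Rightarrow> complex" assume \<zeta>: "\<zeta> \<in> test_functions"
    note E = energy_embed_in_energy_space[OF a]
    have "inner (cls \<eta>) (cls (\<lambda>x. witten a \<zeta> x + \<zeta> x)) = inner (energy_embed a \<eta>) (energy_embed a \<zeta>)"
      using inner_energy_embed[OF a \<zeta> E[OF \<eta>]] by (simp add: energy_embed_def)
    also have "\<dots> = inner (cls \<zeta>) (cls (\<lambda>x. witten a \<eta> x + \<eta> x))"
      using inner_energy_embed[OF a \<eta> E[OF \<zeta>]] by (subst inner_commute) (simp add: energy_embed_def)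
    also have "cls (\<lambda>x. witten a \<eta> x + \<eta> x) = cls \<eta> + cls (witten a \<eta>)"
      by (subst add.commute) (intro cls_add[symmetric] test_L2 test_witten a \<eta>)
    finally show "inner (cls \<eta>) (cls (\<lambda>x. witten a \<zeta> x + \<zeta> x)) = inner (cls \<eta> + cls (witten a \<eta>)) (cls \<zeta>)"
      by (simp add: inner_commute)
  qed
qed

section \<open>Density of the test functions and self-adjointness\<close>

lemma subspace_closure:
  fixes S :: "'a::real_normed_vector set"
  assumes "subspace S"
  shows "subspace (closure S)"
  unfolding subspace_def
proof (intro conjI ballI allI)
  show "0 \<in> closure S" using subspace_0[OF assms] closure_subset by blast
next
  fix x y assume "x \<in> closure S" "y \<in> closure S"
  then obtain f g where "\<And>n. f n \<in> S" "f \<longlonglongrightarrow> x" "\<And>n. g n \<in> S" "g \<longlonglongrightarrow> y"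
    unfolding closure_sequential by blast
  then have "\<forall>n. f n + g n \<in> S" "(\<lambda>n. f n + g n) \<longlonglongrightarrow> x + y"
    using subspace_add[OF assms] by (auto intro: tendsto_add)
  then show "x + y \<in> closure S"
    unfolding closure_sequential by (intro exI[of _ "\<lambda>n. f n + g n"] conjI)
next
  fix c x assume "x \<in> closure S"
  then obtain f where "\<And>n. f n \<in> S" "f \<longlonglongrightarrow> x"
    unfolding closure_sequential by blast
  then have "\<forall>n. c *\<^sub>R f n \<in> S" "(\<lambda>n. c *\<^sub>R f n) \<longlonglongrightarrow> c *\<^sub>R x"
    using subspace_scale[OF assms] by (auto intro: tendsto_scaleR)
  then show "c *\<^sub>R x \<in> closure S"
    unfolding closure_sequential by (intro exI[of _ "\<lambda>n. c *\<^sub>R f n"] conjI)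
qed

lemma test_dense:
  fixes h :: "(real^'n::finite) l2"
  shows "h \<in> closure (cls ` test_functions)"
proof -
  let ?D = "cls ` test_functions :: (real^'n) l2 set"
  have "subspace ?D"
    unfolding subspace_def
  proof (intro conjI ballI allI)
    show "0 \<in> ?D" using cls_zero by (metis image_eqI test_zero)
  next
    fix x y assume "x \<in> ?D" "y \<in> ?D"
    then obtain f g where "f \<in> test_functions" "g \<in> test_functions" "x = cls f" "y = cls g" by blast
    then show "x + y \<in> ?D" using cls_add[of f g] test_add[of f g] test_L2 by auto
  next
    fix c :: real and x assume "x \<in> ?D"
    then obtain f where "f \<in> test_functions" "x = cls f" by blast
    then show "c *\<^sub>R x \<in> ?D" using cls_scaleR[of f c] test_cmult[of f "of_real c"] test_L2 by auto
  qed
  then have "subspace (closure ?D)" by (rule subspace_closure)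
  then obtain p where p: "p \<in> closure ?D" "\<And>s. s \<in> closure ?D \<Longrightarrow> inner (h - p) s = 0"
    using orthogonal_projection[of "closure ?D" h] by auto
  have "h - p = 0"
    using p(2) closure_subset by (intro test_total) blast
  with p(1) show ?thesis by simp
qed

lemma witten_operator_cmult:
  assumes a: "smooth a" and "(f, k) \<in> witten_operator a"
  shows "(\<lambda>x. c * f x, \<lambda>x. c * k x) \<in> witten_operator a"
proof -
  have "L2_inner M w (\<lambda>x. c * v x) = cnj c * L2_inner M w v" for M and w v :: "real^'a \<Rightarrow> complex"
  proof -
    have "(\<lambda>x. w x * cnj (c * v x)) = (\<lambda>x. cnj c * (w x * cnj (v x)))" by (simp add: fun_eq_iff)
    then show ?thesis unfolding L2_inner_def by (simp only: integral_mult_right_zero)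
  qed
  with assms(2) show ?thesis
    by (auto simp: witten_operator_def adjoint_operator_def L2_cmult)
qed

lemma witten_operator_diff:
  assumes a: "smooth a" and "(f, k) \<in> witten_operator a" "(g, h) \<in> witten_operator a"
  shows "(\<lambda>x. f x - g x, \<lambda>x. k x - h x) \<in> witten_operator a"
  using assms(2,3) unfolding witten_operator_iff_weak[OF a]
  by (auto simp: L2_diff cls_diff[symmetric] inner_diff_left)

lemma adjoint_operator_antimono: "A \<subseteq> B \<Longrightarrow> adjoint_operator M B \<subseteq> adjoint_operator M A"
  by (auto simp: adjoint_operator_def)

text \<open>Density comes from the test functions. The operator extends its restriction to test
  functions and is the adjoint of that restriction, so its own adjoint is contained in it; the
  opposite inclusion is the symmetry of the Riesz map.\<close>

lemma self_adjoint_witten_operator: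
  fixes a :: "real^'n::finite \<Rightarrow> real"
  assumes a: "smooth a"
  shows "self_adjoint lebesgue (witten_operator a)"
  unfolding self_adjoint_def
proof
  show "densely_defined lebesgue (witten_operator a)"
    unfolding densely_defined_def
  proof (intro ballI allI impI)
    fix f :: "real^'n \<Rightarrow> complex" and e :: real assume f: "f \<in> L2 lebesgue" and e: "e > 0"
    obtain \<eta> where \<eta>: "\<eta> \<in> test_functions" "dist (cls f) (cls \<eta>) < e"
      using test_dense[of "cls f"] e unfolding closure_approachable by (auto simp: dist_commute)
    then have "L2_norm lebesgue (\<lambda>x. f x - \<eta> x) < e"
      by (simp add: dist_norm cls_diff norm_cls f test_L2 L2_diff)
    then show "\<exists>u\<in>Domain (witten_operator a) \<inter> L2 lebesgue. L2_norm lebesgue (\<lambda>x. f x - u x) < e"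
      using \<eta>(1) test_L2 test_in_witten_operator[OF a \<eta>(1)] by blast
  qed
  show "adjoint_operator lebesgue (witten_operator a) = witten_operator a"
  proof
    have "(\<lambda>f. (f, witten a f)) ` test_functions \<subseteq> witten_operator a"
      using test_in_witten_operator[OF a] by blast
    from adjoint_operator_antimono[OF this, of lebesgue]
    show "adjoint_operator lebesgue (witten_operator a) \<subseteq> witten_operator a"
      by (simp only: witten_operator_def[of a, symmetric])
    show "witten_operator a \<subseteq> adjoint_operator lebesgue (witten_operator a)"
    proof
      fix q assume "q \<in> witten_operator a"
      then obtain g h where q: "q = (g, h)" and gh: "(g, h) \<in> witten_operator a" by (cases q) auto
      have gh': "g \<in> L2 lebesgue" "h \<in> L2 lebesgue" "cls g = fst (energy_riesz a (cls g + cls h))"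
        using gh witten_operator_iff[OF a] by auto
      have re: "Re (L2_inner lebesgue k g) = Re (L2_inner lebesgue f h)" if fk: "(f, k) \<in> witten_operator a" for f k
      proof -
        have fk': "f \<in> L2 lebesgue" "k \<in> L2 lebesgue" "cls f = fst (energy_riesz a (cls f + cls k))"
          using fk witten_operator_iff[OF a] by auto
        have "inner (cls f + cls k) (cls g) = inner (cls g + cls h) (cls f)"
          using energy_riesz_symmetric[of "cls f + cls k" a "cls g + cls h"]
          by (simp only: gh'(3)[symmetric] fk'(3)[symmetric])
        then have "inner (cls k) (cls g) = inner (cls f) (cls h)"
          unfolding inner_add_left inner_commute[of "cls g" "cls f"] inner_commute[of "cls h" "cls f"]
          by simp
        then show ?thesis by (simp add: inner_cls gh'(1,2) fk'(1,2))
      qed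
      have "L2_inner lebesgue k g = L2_inner lebesgue f h" if fk: "(f, k) \<in> witten_operator a" for f k
      proof (rule complex_eqI)
        show "Re (L2_inner lebesgue k g) = Re (L2_inner lebesgue f h)" by (rule re[OF fk])
        \<comment> \<open>The graph is closed under complex multiples, so the identity of real parts
          applied to \<open>\<i> * f\<close> supplies the imaginary parts.\<close>
        have "L2_inner lebesgue (\<lambda>x. \<i> * w x) v = \<i> * L2_inner lebesgue w v" for w v :: "real^'n \<Rightarrow> complex"
          unfolding L2_inner_def by (simp add: mult.assoc)
        then show "Im (L2_inner lebesgue k g) = Im (L2_inner lebesgue f h)"
          using re[OF witten_operator_cmult[OF a fk, of \<i>]] by simp
      qed
      then show "q \<in> adjoint_operator lebesgue (witten_operator a)"
        using gh'(1,2) by (auto simp: q adjoint_operator_def)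
    qed
  qed
qed

text \<open>A self-adjoint extension of the operator on test functions is contained in the adjoint
  of the latter. Taking adjoints once more reverses the inclusion between two self-adjoint graphs,
  which settles the uniqueness demanded by \<open>THE\<close>.\<close>

lemma schrodinger_operator_eq:
  assumes a: "smooth a" and V: "\<And>x. V x = witten_potential a x"
  shows "schrodinger_operator V = witten_operator a"
  unfolding schrodinger_operator_def
proof (rule the_equality)
  note T = schrodinger_test_eq[OF a V]
  show "self_adjoint lebesgue (witten_operator a) \<and> schrodinger_test V \<subseteq> witten_operator a"
    unfolding T using self_adjoint_witten_operator[OF a] test_in_witten_operator[OF a] by blast
  fix A assume A: "self_adjoint lebesgue A \<and> schrodinger_test V \<subseteq> A"
  then have "adjoint_operator lebesgue A \<subseteq> witten_operator a"
    unfolding witten_operator_def T[symmetric] by (intro adjoint_operator_antimono) simp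
  then have 1: "A \<subseteq> witten_operator a" using A by (simp add: self_adjoint_def)
  from adjoint_operator_antimono[OF 1, of lebesgue] have "witten_operator a \<subseteq> A"
    using A self_adjoint_witten_operator[OF a] by (simp add: self_adjoint_def)
  with 1 show "A = witten_operator a" by blast
qed

section \<open>Compactness of the form domain and of the resolvent\<close>

text \<open>The middle term between the weighted embedding and the resolvent. Sequences consist of
  graph elements, so boundedness in the product norm is boundedness in the form norm, while
  convergence concerns the first component only.\<close>

definition compact_form_embedding :: "(real^'n::finite \<Rightarrow> real) \<Rightarrow> bool" where
  "compact_form_embedding a \<longleftrightarrow> (\<forall>s :: nat \<Rightarrow> (real^'n) l2 \<times> (((real^'n) l2)^'n).
    (\<forall>k. s k \<in> energy_space a) \<and> bounded (range s) \<longrightarrow>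
      (\<exists>r l. strict_mono (r :: nat \<Rightarrow> nat) \<and> (\<lambda>k. fst (s (r k))) \<longlonglongrightarrow> l))"

lemma tendsto_cls_iff:
  assumes "\<And>k. f k \<in> L2 lebesgue" "g \<in> L2 lebesgue"
  shows "(\<lambda>k. cls (f k)) \<longlonglongrightarrow> cls g \<longleftrightarrow> (\<lambda>k. L2_norm lebesgue (\<lambda>x. f k x - g x)) \<longlonglongrightarrow> 0"
  using assms by (subst LIM_zero_iff[symmetric], subst tendsto_norm_zero_iff[symmetric])
      (simp add: cls_diff norm_cls L2_diff)

lemma witten_operator_resolvent:
  assumes a: "smooth a" and f: "f \<in> L2 lebesgue" and g: "g \<in> L2 lebesgue"
  shows "(f, \<lambda>x. g x - f x) \<in> witten_operator a \<longleftrightarrow> cls f = fst (energy_riesz a (cls g))"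
  using f g by (simp add: witten_operator_iff[OF a] L2_diff cls_add)

text \<open>Surjectivity is the existence of Riesz representatives; the inverse has bound 1 because
  the Riesz map is a contraction.\<close>

lemma minus_one_in_resolvent_set:
  assumes a: "smooth a"
  shows "- 1 \<in> resolvent_set lebesgue (witten_operator a)"
  unfolding resolvent_set_def
proof (intro CollectI conjI ballI)
  fix g :: "real^'a \<Rightarrow> complex" assume g: "g \<in> L2 lebesgue"
  obtain f where f: "f \<in> L2 lebesgue" "fst (energy_riesz a (cls g)) = cls f" by (rule cls_cases)
  then have "(f, \<lambda>x. g x - f x) \<in> witten_operator a" using witten_operator_resolvent[OF a f(1) g] by simp
  then have "(f, \<lambda>x. g x + - 1 * f x) \<in> witten_operator a" by simp
  then show "\<exists>f. (f, \<lambda>x. g x + - 1 * f x) \<in> witten_operator a" by (rule exI[of _ f])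
next
  have "L2_norm lebesgue f \<le> 1 * L2_norm lebesgue (\<lambda>x. k x - - 1 * f x)" if "(f, k) \<in> witten_operator a" for f k
  proof -
    have fk: "f \<in> L2 lebesgue" "k \<in> L2 lebesgue" "cls f = fst (energy_riesz a (cls f + cls k))"
      using that witten_operator_iff[OF a] by auto
    have "norm (cls f) \<le> norm (cls f + cls k)"
      using norm_fst_le_norm[of "energy_riesz a (cls f + cls k)"] norm_energy_riesz[of a "cls f + cls k"] fk(3)
      by simp
    then show ?thesis using fk by (simp add: cls_add norm_cls L2_add add.commute)
  qed
  then show "\<exists>C. \<forall>(f, k)\<in>witten_operator a. L2_norm lebesgue f \<le> C * L2_norm lebesgue (\<lambda>x. k x - - 1 * f x)"
    by (intro exI[of _ 1]) blast
qed

text \<open>One direction works at \<open>-1\<close>, where the resolvent is the Riesz map. In the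
  other, compactness is given at some unspecified \<open>z\<close> and has to be transferred to
  \<open>-1\<close> before the interpolation inequality can be used.\<close>

lemma compact_resolvent_iff_compact_form_embedding:
  fixes a :: "real^'n::finite \<Rightarrow> real"
  assumes a: "smooth a"
  shows "has_compact_resolvent lebesgue (witten_operator a) \<longleftrightarrow> compact_form_embedding a"
proof
  let ?A = "witten_operator a"
  assume emb: "compact_form_embedding a"
  have "compact_operator (L2 lebesgue) (L2_norm lebesgue) (resolvent ?A (- 1)) lebesgue"
    unfolding compact_operator_def
  proof (intro allI impI)
    fix u :: "nat \<Rightarrow> real^'n \<Rightarrow> complex"
    assume u: "(\<forall>k. u k \<in> L2 lebesgue) \<and> bounded (range (\<lambda>k. L2_norm lebesgue (u k)))"
    then obtain C where "\<forall>x\<in>range (\<lambda>k. L2_norm lebesgue (u k)). norm x \<le> C"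
      unfolding bounded_iff by blast
    then have C: "L2_norm lebesgue (u k) \<le> C" for k
      using abs_ge_self[of "L2_norm lebesgue (u k)"] by (auto intro: order_trans)
    define s where "s k = energy_riesz a (cls (u k))" for k
    have "norm (s k) \<le> C" for k
      using norm_energy_riesz[of a "cls (u k)"] C[of k] u by (simp add: s_def norm_cls)
    then have "bounded (range s)" unfolding bounded_iff by blast
    moreover have "s k \<in> energy_space a" for k unfolding s_def by (rule energy_riesz)
    ultimately obtain r l where rl: "strict_mono (r :: nat \<Rightarrow> nat)" "(\<lambda>k. fst (s (r k))) \<longlonglongrightarrow> l"
      using emb unfolding compact_form_embedding_def by blast
    obtain g where g: "g \<in> L2 lebesgue" "l = cls g" by (rule cls_cases)
    have res: "resolvent ?A (- 1) (u k) \<in> L2 lebesgue" "cls (resolvent ?A (- 1) (u k)) = fst (s k)" for k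
    proof -
      have "\<exists>f. (f, \<lambda>x. u k x + - 1 * f x) \<in> ?A"
        using minus_one_in_resolvent_set[OF a] u unfolding resolvent_set_def by blast
      from someI_ex[OF this]
      have *: "(resolvent ?A (- 1) (u k), \<lambda>x. u k x - resolvent ?A (- 1) (u k) x) \<in> ?A"
        unfolding resolvent_def by simp
      then show L: "resolvent ?A (- 1) (u k) \<in> L2 lebesgue" using witten_operator_iff[OF a] by blast
      show "cls (resolvent ?A (- 1) (u k)) = fst (s k)"
        using * witten_operator_resolvent[OF a L] u unfolding s_def by blast
    qed
    have "(\<lambda>k. L2_norm lebesgue (\<lambda>x. resolvent ?A (- 1) (u (r k)) x - g x)) \<longlonglongrightarrow> 0"
      using rl(2) tendsto_cls_iff[of "\<lambda>k. resolvent ?A (- 1) (u (r k))" g] res g by simp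
    then show "\<exists>r. \<exists>g\<in>L2 lebesgue. strict_mono (r :: nat \<Rightarrow> nat) \<and>
        (\<lambda>k. L2_norm lebesgue (\<lambda>x. resolvent ?A (- 1) (u (r k)) x - g x)) \<longlonglongrightarrow> 0"
      using rl(1) g(1) by blast
  qed
  then show "has_compact_resolvent lebesgue ?A"
    unfolding has_compact_resolvent_def spectrum_of_def using minus_one_in_resolvent_set[OF a] by blast
next
  let ?A = "witten_operator a"
  let ?R = "\<lambda>x. fst (energy_riesz a x)"
  assume "has_compact_resolvent lebesgue ?A"
  then obtain z where z: "z \<in> resolvent_set lebesgue ?A"
    "compact_operator (L2 lebesgue) (L2_norm lebesgue) (resolvent ?A z) lebesgue"
    unfolding has_compact_resolvent_def spectrum_of_def by auto
  obtain C0 where C0: "\<And>f k. (f, k) \<in> ?A \<Longrightarrow> L2_norm lebesgue f \<le> C0 * L2_norm lebesgue (\<lambda>x. k x - z * f x)"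
    using z(1) unfolding resolvent_set_def by blast
  show "compact_form_embedding a"
    unfolding compact_form_embedding_def
  proof (intro allI impI)
    fix s :: "nat \<Rightarrow> (real^'n) l2 \<times> (((real^'n) l2)^'n)"
    assume s: "(\<forall>k. s k \<in> energy_space a) \<and> bounded (range s)"
    then obtain C where C: "C > 0" "\<And>k. norm (s k) \<le> C"
      unfolding bounded_pos by blast
    define w where "w k = fst (s k)" for k
    have w: "norm (w k) \<le> C" for k
      using norm_fst_le_norm[of "s k"] C(2)[of k] by (simp add: w_def)
    have "\<exists>u. \<forall>k. u k \<in> L2 lebesgue \<and> w k = cls (u k)"
      by (intro choice allI) (metis cls_cases)
    then obtain u where u: "\<And>k. u k \<in> L2 lebesgue" "\<And>k. w k = cls (u k)" by blast
    have "\<exists>f. \<forall>k. f k \<in> L2 lebesgue \<and> ?R (w k) = cls (f k)"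
      by (intro choice allI) (metis cls_cases)
    then obtain f where f: "\<And>k. f k \<in> L2 lebesgue" "\<And>k. ?R (w k) = cls (f k)" by blast
    \<comment> \<open>Resolvent identity: \<open>(A + 1) f = u\<close> is the same as
      \<open>(A - z) f = u - (1 + z) f\<close>. Hence the Riesz images are values of the resolvent
      at \<open>z\<close> on the bounded sequence \<open>h\<close>.\<close>
    define h where "h k x = u k x - (1 + z) * f k x" for k x
    have h: "h k \<in> L2 lebesgue" for k
      unfolding h_def by (intro L2_diff L2_cmult u f)
    have h_bound: "L2_norm lebesgue (h k) \<le> C + cmod (1 + z) * C" for k
    proof -
      have "cls (h k) = cls (u k) - cls (\<lambda>x. (1 + z) * f k x)"
        unfolding h_def[abs_def] by (intro cls_diff[symmetric] u L2_cmult f)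
      then have "norm (cls (h k)) \<le> norm (cls (u k)) + norm (cls (\<lambda>x. (1 + z) * f k x))"
        by (simp add: norm_triangle_ineq4)
      also have "norm (cls (\<lambda>x. (1 + z) * f k x)) = cmod (1 + z) * norm (cls (f k))"
        by (simp add: norm_cls L2_cmult f L2_norm_def norm_mult power_mult_distrib real_sqrt_mult)
      also have "norm (cls (f k)) \<le> C"
        using norm_fst_le_norm[of "energy_riesz a (w k)"] norm_energy_riesz[of a "w k"] w[of k] f(2)[of k] by simp
      finally show ?thesis using w[of k] by (simp add: norm_cls h u mult_left_mono)
    qed
    have "bounded (range (\<lambda>k. L2_norm lebesgue (h k)))"
      unfolding bounded_iff using h_bound
      by (intro exI[of _ "C + cmod (1 + z) * C"]) (auto simp: L2_norm_nonneg)
    with z(2) h obtain r g where rg: "strict_mono (r :: nat \<Rightarrow> nat)" "g \<in> L2 lebesgue"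
      "(\<lambda>k. L2_norm lebesgue (\<lambda>x. resolvent ?A z (h (r k)) x - g x)) \<longlonglongrightarrow> 0"
      unfolding compact_operator_def by blast
    have res: "resolvent ?A z (h k) \<in> L2 lebesgue" "cls (resolvent ?A z (h k)) = ?R (w k)" for k
    proof -
      let ?F = "resolvent ?A z (h k)"
      have "\<exists>f. (f, \<lambda>x. h k x + z * f x) \<in> ?A"
        using z(1) h unfolding resolvent_set_def by blast
      from someI_ex[OF this] have F: "(?F, \<lambda>x. h k x + z * ?F x) \<in> ?A"
        unfolding resolvent_def .
      then show L: "?F \<in> L2 lebesgue" using witten_operator_iff[OF a] by blast
      have "(f k, \<lambda>x. u k x - f k x) \<in> ?A"
        using witten_operator_resolvent[OF a f(1) u(1)] f(2) u(2) by metis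
      moreover have "(\<lambda>x. u k x - f k x) = (\<lambda>x. h k x + z * f k x)"
        by (simp add: h_def fun_eq_iff algebra_simps)
      ultimately have "(f k, \<lambda>x. h k x + z * f k x) \<in> ?A" by simp
      \<comment> \<open>\<open>resolvent\<close> merely chooses some solution. The bound defining
        the resolvent set, applied to the difference of two solutions, shows that the choice agrees
        with \<open>f k\<close> almost everywhere.\<close>
      from C0[OF witten_operator_diff[OF a F this]]
      have "L2_norm lebesgue (\<lambda>x. ?F x - f k x) \<le> C0 * L2_norm lebesgue (\<lambda>x :: real^'n. 0)"
        by (simp add: algebra_simps)
      also have "\<dots> = 0" by (simp add: L2_norm_def)
      finally have "norm (cls ?F - cls (f k)) \<le> 0" by (simp add: cls_diff norm_cls L f L2_diff)
      then show "cls ?F = ?R (w k)" using f(2) by simp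
    qed
    have "(\<lambda>k. ?R (w (r k))) \<longlonglongrightarrow> cls g"
      using tendsto_cls_iff[of "\<lambda>k. resolvent ?A z (h (r k))" g] res rg by simp
    then have CR: "Cauchy (\<lambda>k. ?R (w (r k)))" by (rule LIMSEQ_imp_Cauchy)
    \<comment> \<open>Differences of elements bounded by \<open>C\<close> are bounded by
      \<open>2 * C\<close>. The constant is \<open>2 * C\<close> for the \<open>L2\<close> norm
      times \<open>(2 * C)\<^sup>2\<close> for the square of the form norm.\<close>
    have key: "(norm (w m - w n)) ^ 4 \<le> 8 * C ^ 3 * norm (?R (w m) - ?R (w n))" for m n
    proof -
      let ?x = "w m - w n" and ?y = "s m - s n"
      have y: "?y \<in> energy_space a" using s by (intro subspace_diff subspace_energy_space) auto
      have ny: "norm ?y \<le> 2 * C" using norm_triangle_ineq4[of "s m" "s n"] C(2)[of m] C(2)[of n] by linarith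
      have nx: "norm ?x \<le> 2 * C" using norm_triangle_ineq4[of "w m" "w n"] w[of m] w[of n] by linarith
      have "(norm ?x)\<^sup>2 = inner (energy_riesz a ?x) ?y"
        using energy_riesz(2)[OF y, of ?x] by (simp add: power2_norm_eq_inner w_def)
      also have "\<dots> \<le> norm (energy_riesz a ?x) * norm ?y" by (rule norm_cauchy_schwarz)
      finally have "((norm ?x)\<^sup>2)\<^sup>2 \<le> (norm (energy_riesz a ?x) * norm ?y)\<^sup>2"
        by (rule power_mono) simp
      also have "\<dots> = inner ?x (?R ?x) * (norm ?y)\<^sup>2"
        by (simp only: power_mult_distrib norm_energy_riesz_square)
      also have "\<dots> \<le> (norm ?x * norm (?R ?x)) * (norm ?y)\<^sup>2"
        by (intro mult_right_mono norm_cauchy_schwarz) simp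
      also have "\<dots> \<le> ((2 * C) * norm (?R ?x)) * (2 * C)\<^sup>2"
        using nx ny C(1) by (intro mult_mono power_mono mult_nonneg_nonneg) auto
      also have "\<dots> = 8 * C ^ 3 * norm (?R (w m) - ?R (w n))"
        by (simp add: energy_riesz_diff power2_eq_square power3_eq_cube)
      finally show ?thesis by (simp flip: power_mult)
    qed
    have "Cauchy (\<lambda>k. w (r k))"
    proof (rule CauchyI)
      fix e :: real assume e: "e > 0"
      then have "e ^ 4 / (8 * C ^ 3) > 0" using C(1) by simp
      from CauchyD[OF CR this] obtain M where M: "\<And>m n. m \<ge> M \<Longrightarrow> n \<ge> M \<Longrightarrow>
          norm (?R (w (r m)) - ?R (w (r n))) < e ^ 4 / (8 * C ^ 3)" by blast
      have "norm (w (r m) - w (r n)) < e" if "m \<ge> M" "n \<ge> M" for m n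
      proof -
        have "8 * C ^ 3 * norm (?R (w (r m)) - ?R (w (r n))) < e ^ 4"
          using M[OF that] C(1) by (simp add: pos_less_divide_eq mult.commute)
        with key[of "r m" "r n"] have "(norm (w (r m) - w (r n))) ^ 4 < e ^ 4" by linarith
        then show ?thesis by (rule power_less_imp_less_base) (use e in simp)
      qed
      then show "\<exists>M. \<forall>m\<ge>M. \<forall>n\<ge>M. norm (w (r m) - w (r n)) < e" by blast
    qed
    then obtain l where "(\<lambda>k. w (r k)) \<longlonglongrightarrow> l" using Cauchy_convergent convergent_def by blast
    with rg(1) show "\<exists>r l. strict_mono (r :: nat \<Rightarrow> nat) \<and> (\<lambda>k. fst (s (r k))) \<longlonglongrightarrow> l"
      unfolding w_def by blast
  qed
qed

section \<open>The weighted Sobolev spaces\<close>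

definition unweight :: "(real^'n::finite \<Rightarrow> real) \<Rightarrow> (real^'n \<Rightarrow> complex) \<Rightarrow> real^'n \<Rightarrow> complex" where
  "unweight \<phi> f x = of_real (exp (- \<phi> x / 2)) * f x"

lemma exp_half_cancel:
  "complex_of_real (exp (- (t / 2))) * complex_of_real (exp (t / 2)) = 1"
  "complex_of_real (exp (t / 2)) * complex_of_real (exp (- (t / 2))) = 1"
  unfolding of_real_mult[symmetric] exp_add[symmetric] by simp_all

lemma unweight_inverse: "unweight \<phi> (\<lambda>x. of_real (exp (\<phi> x / 2)) * f x) = f"
  by (simp add: unweight_def fun_eq_iff mult.assoc[symmetric] exp_half_cancel)

lemma cmod_unweight: "(cmod (unweight \<phi> f x))\<^sup>2 = exp (- \<phi> x) * (cmod (f x))\<^sup>2"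
proof -
  have "(exp (- \<phi> x / 2))\<^sup>2 = exp (- \<phi> x)" by (simp add: power2_eq_square exp_add[symmetric])
  then show ?thesis by (simp add: unweight_def norm_mult power_mult_distrib)
qed

lemma
  fixes \<phi> :: "real^'n::finite \<Rightarrow> real"
  assumes "continuous_on UNIV \<phi>"
  shows L2_weighted_iff: "f \<in> L2 (weighted \<phi>) \<longleftrightarrow> unweight \<phi> f \<in> L2 lebesgue"
    and L2_norm_weighted: "f \<in> borel_measurable lebesgue \<Longrightarrow> L2_norm (weighted \<phi>) f = L2_norm lebesgue (unweight \<phi> f)"
proof -
  have [measurable]: "\<phi> \<in> borel_measurable lebesgue"
    by (intro borel_imp_lebesgue_measurable borel_measurable_continuous_onI assms)
  have m: "f \<in> borel_measurable (weighted \<phi>) \<longleftrightarrow> f \<in> borel_measurable lebesgue" for f :: "real^'n \<Rightarrow> complex"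
    unfolding weighted_def by (intro iffI; simp add: measurable_def)
  have gm: "unweight \<phi> f \<in> borel_measurable lebesgue \<longleftrightarrow> f \<in> borel_measurable lebesgue"
  proof
    assume [measurable]: "unweight \<phi> f \<in> borel_measurable lebesgue"
    have "f = (\<lambda>x. of_real (exp (\<phi> x / 2)) * unweight \<phi> f x)"
      by (simp add: unweight_def fun_eq_iff mult.assoc[symmetric] exp_half_cancel)
    moreover have "(\<lambda>x. of_real (exp (\<phi> x / 2)) * unweight \<phi> f x) \<in> borel_measurable lebesgue" by measurable
    ultimately show "f \<in> borel_measurable lebesgue" by simp
  next
    assume [measurable]: "f \<in> borel_measurable lebesgue"
    show "unweight \<phi> f \<in> borel_measurable lebesgue" unfolding unweight_def[abs_def] by measurable
  qed
  have "f \<in> borel_measurable lebesgue \<Longrightarrow> integrable (weighted \<phi>) (\<lambda>x. (cmod (f x))\<^sup>2) \<longleftrightarrow>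
      integrable lebesgue (\<lambda>x. (cmod (unweight \<phi> f x))\<^sup>2)"
    unfolding weighted_def by (subst integrable_density) (auto simp: cmod_unweight)
  then show "f \<in> L2 (weighted \<phi>) \<longleftrightarrow> unweight \<phi> f \<in> L2 lebesgue"
    using m gm by (auto simp: L2_def)
  show "f \<in> borel_measurable lebesgue \<Longrightarrow> L2_norm (weighted \<phi>) f = L2_norm lebesgue (unweight \<phi> f)"
    unfolding L2_norm_def weighted_def by (subst integral_density) (auto simp: cmod_unweight)
qed

lemma L2_weighted_measurable: "f \<in> L2 (weighted \<phi>) \<Longrightarrow> f \<in> borel_measurable lebesgue"
  unfolding weighted_def by (auto simp: L2_def measurable_def)

lemma energy_space_iff:
  assumes a: "smooth a" and v: "v \<in> L2 lebesgue" and w: "\<And>j. w j \<in> L2 lebesgue"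
  shows "(cls v, \<chi> j. cls (w j)) \<in> energy_space a \<longleftrightarrow>
    (\<forall>j. \<forall>\<eta>\<in>test_functions. (\<integral>x. w j x * \<eta> x \<partial>lebesgue) = (\<integral>x. v x * Z_adj a j \<eta> x \<partial>lebesgue))"
proof -
  have "(\<forall>\<eta>\<in>test_functions. inner (cls (w j)) (cls \<eta>) = inner (cls v) (cls (Z_adj a j \<eta>))) \<longleftrightarrow>
     (\<forall>\<eta>\<in>test_functions. (\<integral>x. w j x * \<eta> x \<partial>lebesgue) = (\<integral>x. v x * Z_adj a j \<eta> x \<partial>lebesgue))" for j
    by (rule real_pairing_iff_complex_pairing[OF w v])
      (auto simp: test_Z_adj a Z_adj_cmult Z_adj_cnj test_function_smooth)
  then show ?thesis unfolding energy_space_def by auto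
qed

text \<open>A common treatment of both weighted spaces: \<open>D\<close> stands for the
  distributional operators, and the hypothesis on it says that removing the weight turns them into
  the weak \<open>Z_j\<close>. Then \<open>J\<close> preserves norms and maps the weighted space
  onto the energy space, so bounded sequences and their limits can be carried in both
  directions.\<close>

lemma compact_weighted_embedding_iff:
  fixes \<phi> a :: "real^'n::finite \<Rightarrow> real"
    and D :: "'n \<Rightarrow> (real^'n \<Rightarrow> complex) \<Rightarrow> 'n distribution"
  assumes \<phi>: "continuous_on UNIV \<phi>" and a: "smooth a"
    and D: "\<And>f g j. f \<in> L2 (weighted \<phi>) \<Longrightarrow> g \<in> L2 (weighted \<phi>) \<Longrightarrow> represents g (D j f) \<longleftrightarrow>
      (\<forall>\<eta>\<in>test_functions. (\<integral>x. unweight \<phi> g x * \<eta> x \<partial>lebesgue) = (\<integral>x. unweight \<phi> f x * Z_adj a j \<eta> x \<partial>lebesgue))"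
  defines "X \<equiv> {f \<in> L2 (weighted \<phi>). \<forall>j. dist_in_L2 (weighted \<phi>) (D j f)}"
    and "N \<equiv> \<lambda>f. sqrt ((L2_norm (weighted \<phi>) f)\<^sup>2 +
      (\<Sum>j\<in>UNIV. (L2_norm (weighted \<phi>) (dist_rep (weighted \<phi>) (D j f)))\<^sup>2))"
  shows "compact_operator X N (\<lambda>f. f) (weighted \<phi>) \<longleftrightarrow> compact_form_embedding a"
proof -
  note L2w = L2_weighted_iff[OF \<phi>]
  have Nw: "L2_norm (weighted \<phi>) f = norm (cls (unweight \<phi> f))" if "f \<in> L2 (weighted \<phi>)" for f
    using that L2_norm_weighted[OF \<phi> L2_weighted_measurable[OF that]] L2w by (simp add: norm_cls)
  define J where "J f = (cls (unweight \<phi> f), \<chi> j. cls (unweight \<phi> (dist_rep (weighted \<phi>) (D j f))))" for f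
  have rep: "dist_rep (weighted \<phi>) (D j f) \<in> L2 (weighted \<phi>)" "represents (dist_rep (weighted \<phi>) (D j f)) (D j f)"
    if "f \<in> X" for f j
  proof -
    have "\<exists>g. g \<in> L2 (weighted \<phi>) \<and> represents g (D j f)"
      using that unfolding X_def dist_in_L2_def by blast
    from someI_ex[OF this]
    show "dist_rep (weighted \<phi>) (D j f) \<in> L2 (weighted \<phi>)" "represents (dist_rep (weighted \<phi>) (D j f)) (D j f)"
      unfolding dist_rep_def by auto
  qed
  have XL: "f \<in> L2 (weighted \<phi>)" if "f \<in> X" for f using that by (simp add: X_def)
  have JE: "J f \<in> energy_space a" if "f \<in> X" for f
    unfolding J_def using that rep[OF that] D[OF XL[OF that] rep(1)[OF that]] XL[OF that] L2w
    by (subst energy_space_iff[OF a]) auto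
  have NJ: "norm (J f) = N f" if "f \<in> X" for f
    unfolding J_def N_def norm_prod_def norm_vec_def L2_set_def
    using Nw[OF XL[OF that]] Nw[OF rep(1)[OF that]] by (simp add: sum_nonneg)
  have J_surj: "\<exists>f\<in>X. J f = p" if p: "p \<in> energy_space a" for p
  proof -
    obtain v where v: "v \<in> L2 lebesgue" "fst p = cls v" by (rule cls_cases)
    have "\<exists>w. \<forall>j. w j \<in> L2 lebesgue \<and> snd p $ j = cls (w j)"
      by (intro choice allI) (metis cls_cases)
    then obtain w where w: "\<And>j. w j \<in> L2 lebesgue" "\<And>j. snd p $ j = cls (w j)" by blast
    have p_eq: "p = (cls v, \<chi> j. cls (w j))"
      using v(2) w(2) by (simp add: prod_eq_iff vec_eq_iff)
    define f where "f x = of_real (exp (\<phi> x / 2)) * v x" for x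
    define g where "g j x = of_real (exp (\<phi> x / 2)) * w j x" for j x
    have gf: "unweight \<phi> f = v" "unweight \<phi> (g j) = w j" for j
      unfolding f_def[abs_def] g_def[abs_def] by (rule unweight_inverse)+
    have L: "f \<in> L2 (weighted \<phi>)" "g j \<in> L2 (weighted \<phi>)" for j
      using v(1) w(1) by (simp_all add: L2w gf)
    have "represents (g j) (D j f)" for j
      using p unfolding D[OF L] gf p_eq energy_space_iff[OF a v(1) w(1)] by blast
    then have fX: "f \<in> X" unfolding X_def dist_in_L2_def using L by blast
    \<comment> \<open>The representative chosen by \<open>dist_rep\<close> may differ from
      \<open>g j\<close> on a null set. Both have the same pairings with test functions, so their
      classes agree.\<close>
    have "cls (unweight \<phi> (dist_rep (weighted \<phi>) (D j f))) = cls (w j)" for j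
    proof -
      let ?h = "dist_rep (weighted \<phi>) (D j f)"
      have h: "unweight \<phi> ?h \<in> L2 lebesgue" using rep(1)[OF fX] by (simp add: L2w)
      have "\<forall>\<eta>\<in>test_functions. (\<integral>x. unweight \<phi> ?h x * \<eta> x \<partial>lebesgue) = (\<integral>x. w j x * \<eta> x \<partial>lebesgue)"
        using rep(2)[OF fX, of j] \<open>represents (g j) (D j f)\<close>
        unfolding D[OF L(1) rep(1)[OF fX]] D[OF L] gf by simp
      then have "\<forall>\<eta>\<in>test_functions. inner (cls (unweight \<phi> ?h)) (cls \<eta>) = inner (cls (w j)) (cls \<eta>)"
        using real_pairing_iff_complex_pairing[OF h w(1)[of j], of "\<lambda>\<eta>. \<eta>"] by blast
      then have "cls (unweight \<phi> ?h) - cls (w j) = 0"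
        by (intro test_total) (simp add: inner_diff_left)
      then show ?thesis by simp
    qed
    then have "J f = p" by (simp add: J_def gf p_eq)
    with fX show ?thesis by blast
  qed
  have conv: "(\<lambda>k. L2_norm (weighted \<phi>) (\<lambda>x. f k x - g x)) \<longlonglongrightarrow> 0 \<longleftrightarrow> (\<lambda>k. fst (J (f k))) \<longlonglongrightarrow> cls (unweight \<phi> g)"
    if "\<And>k. f k \<in> L2 (weighted \<phi>)" "g \<in> L2 (weighted \<phi>)" for f :: "nat \<Rightarrow> real^'n \<Rightarrow> complex" and g
  proof -
    have "L2_norm (weighted \<phi>) (\<lambda>x. f k x - g x) = L2_norm lebesgue (\<lambda>x. unweight \<phi> (f k) x - unweight \<phi> g x)" for k
      using L2_norm_weighted[OF \<phi> L2_weighted_measurable[OF L2_diff[OF that]]]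
      by (simp add: unweight_def[abs_def] algebra_simps)
    then show ?thesis
      using that tendsto_cls_iff[of "\<lambda>k. unweight \<phi> (f k)" "unweight \<phi> g"] by (simp add: L2w J_def)
  qed
  show ?thesis
  proof
    assume C: "compact_operator X N (\<lambda>f. f) (weighted \<phi>)"
    show "compact_form_embedding a"
      unfolding compact_form_embedding_def
    proof (intro allI impI)
      fix s :: "nat \<Rightarrow> (real^'n) l2 \<times> (((real^'n) l2)^'n)"
      assume s: "(\<forall>k. s k \<in> energy_space a) \<and> bounded (range s)"
      then have "\<exists>f. \<forall>k. f k \<in> X \<and> J (f k) = s k"
        by (intro choice allI) (metis J_surj)
      then obtain f where f: "\<And>k. f k \<in> X" "\<And>k. J (f k) = s k" by blast
      have "N (f k) = norm (s k)" for k using NJ[OF f(1)] f(2) by simp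
      then have "bounded (range (\<lambda>k. N (f k)))" using s by (auto simp: bounded_iff)
      then obtain r g where rg: "strict_mono (r :: nat \<Rightarrow> nat)" "g \<in> L2 (weighted \<phi>)"
        "(\<lambda>k. L2_norm (weighted \<phi>) (\<lambda>x. f (r k) x - g x)) \<longlonglongrightarrow> 0"
        using C f(1) unfolding compact_operator_def by blast
      then have "(\<lambda>k. fst (s (r k))) \<longlonglongrightarrow> cls (unweight \<phi> g)"
        using conv[of "\<lambda>k. f (r k)" g] XL f by simp
      with rg(1) show "\<exists>r l. strict_mono (r :: nat \<Rightarrow> nat) \<and> (\<lambda>k. fst (s (r k))) \<longlonglongrightarrow> l" by blast
    qed
  next
    assume C: "compact_form_embedding a"
    show "compact_operator X N (\<lambda>f. f) (weighted \<phi>)"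
      unfolding compact_operator_def
    proof (intro allI impI)
      fix f :: "nat \<Rightarrow> real^'n \<Rightarrow> complex"
      assume f: "(\<forall>k. f k \<in> X) \<and> bounded (range (\<lambda>k. N (f k)))"
      then obtain B where "\<forall>x\<in>range (\<lambda>k. N (f k)). norm x \<le> B"
        unfolding bounded_iff by blast
      then have "norm (J (f k)) \<le> B" for k
        using f abs_ge_self[of "N (f k)"] by (auto simp: NJ intro: order_trans)
      then have "bounded (range (\<lambda>k. J (f k)))" unfolding bounded_iff by blast
      then obtain r l where rl: "strict_mono (r :: nat \<Rightarrow> nat)" "(\<lambda>k. fst (J (f (r k)))) \<longlonglongrightarrow> l"
        using C[unfolded compact_form_embedding_def, rule_format, of "\<lambda>k. J (f k)"] f JE by blast
      obtain g' where g': "g' \<in> L2 lebesgue" "l = cls g'" by (rule cls_cases)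
      define g where "g x = of_real (exp (\<phi> x / 2)) * g' x" for x
      have gg: "unweight \<phi> g = g'" unfolding g_def[abs_def] by (rule unweight_inverse)
      then have gL: "g \<in> L2 (weighted \<phi>)" using g' by (simp add: L2w)
      have "(\<lambda>k. L2_norm (weighted \<phi>) (\<lambda>x. f (r k) x - g x)) \<longlonglongrightarrow> 0"
        using conv[of "\<lambda>k. f (r k)" g] XL f gL rl(2) g' gg by simp
      with rl(1) gL show "\<exists>r. \<exists>g\<in>L2 (weighted \<phi>). strict_mono (r :: nat \<Rightarrow> nat) \<and>
          (\<lambda>k. L2_norm (weighted \<phi>) (\<lambda>x. f (r k) x - g x)) \<longlonglongrightarrow> 0" by blast
    qed
  qed
qed

section \<open>Distributional derivatives after removal of the weight: multiplication by
  \<open>exp(-\<phi>/2)\<close> permutes the test functions, with inverse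
  \<open>exp(\<phi>/2)\<close>\<close>

lemma represents_iff_unweight:
  fixes \<phi> :: "real^'n::finite \<Rightarrow> real"
  assumes \<phi>: "smooth \<phi>"
  shows "represents g T \<longleftrightarrow> (\<forall>\<eta>\<in>test_functions.
    T (\<lambda>x. of_real (exp (- \<phi> x / 2)) * \<eta> x) = (\<integral>x. unweight \<phi> g x * \<eta> x \<partial>lebesgue))"
proof -
  have sm: "smooth (\<lambda>x. complex_of_real (exp (c * \<phi> x)))" for c
    by (intro smooth_of_real smooth_exp smooth_mult smooth_const \<phi>)
  have eq: "unweight \<phi> g x * \<eta> x = g x * (of_real (exp (- \<phi> x / 2)) * \<eta> x)" for \<eta> x
    by (simp add: unweight_def)
  show ?thesis unfolding represents_def regular_dist_def eq
  proof (intro iffI ballI)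
    fix \<eta> assume R: "\<forall>\<psi>\<in>test_functions. T \<psi> = (\<integral>x. g x * \<psi> x \<partial>lebesgue)" and \<eta>: "\<eta> \<in> (test_functions :: (real^'n \<Rightarrow> complex) set)"
    have "(\<lambda>x. of_real (exp (- \<phi> x / 2)) * \<eta> x) \<in> test_functions"
      using test_mult[OF sm[of "- 1/2"] \<eta>] by simp
    from R[rule_format, OF this]
    show "T (\<lambda>x. of_real (exp (- \<phi> x / 2)) * \<eta> x) = (\<integral>x. g x * (of_real (exp (- \<phi> x / 2)) * \<eta> x) \<partial>lebesgue)" .
  next
    fix \<psi> assume R: "\<forall>\<eta>\<in>test_functions. T (\<lambda>x. of_real (exp (- \<phi> x / 2)) * \<eta> x) =
        (\<integral>x. g x * (of_real (exp (- \<phi> x / 2)) * \<eta> x) \<partial>lebesgue)" and \<psi>: "\<psi> \<in> (test_functions :: (real^'n \<Rightarrow> complex) set)"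
    have t: "(\<lambda>x. of_real (exp (\<phi> x / 2)) * \<psi> x) \<in> test_functions"
      using test_mult[OF sm[of "1/2"] \<psi>] by simp
    have "of_real (exp (- \<phi> x / 2)) * (of_real (exp (\<phi> x / 2)) * \<psi> x) = \<psi> x" for x
      by (simp add: mult.assoc[symmetric] exp_half_cancel)
    with R[rule_format, OF t] show "T \<psi> = (\<integral>x. g x * \<psi> x \<partial>lebesgue)" by (simp only:)
  qed
qed

lemma partial_deriv_unweight:
  fixes \<phi> :: "real^'n::finite \<Rightarrow> real" and \<eta> :: "real^'n \<Rightarrow> complex"
  assumes \<phi>: "smooth \<phi>" and \<eta>: "smooth \<eta>"
  shows "partial_deriv j (\<lambda>x. of_real (exp (- \<phi> x / 2)) * \<eta> x) x =
    of_real (exp (- \<phi> x / 2)) * (partial_deriv j \<eta> x - of_real (partial_deriv j \<phi> x / 2) * \<eta> x)"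
proof -
  have s: "smooth (\<lambda>x. (- 1/2) * \<phi> x)" by (intro smooth_mult smooth_const \<phi>)
  have "partial_deriv j (\<lambda>x. complex_of_real (exp ((- 1/2) * \<phi> x)) * \<eta> x) x =
    of_real (exp ((- 1/2) * \<phi> x)) * (partial_deriv j \<eta> x - of_real (partial_deriv j \<phi> x / 2) * \<eta> x)"
    unfolding partial_deriv_mult[OF smooth_of_real[OF smooth_exp[OF s]] \<eta>]
      partial_deriv_of_real[OF smooth_exp[OF s]] partial_deriv_exp[OF s] partial_deriv_cmult[OF \<phi>]
    by (simp add: algebra_simps)
  then show ?thesis by simp
qed

text \<open>Differentiating \<open>exp(-\<phi>/2) \<eta>\<close> brings down half the gradient of
  \<open>\<phi>\<close>; with the sign from the distributional derivative this is
  \<open>exp(-\<phi>/2)\<close> times \<open>Z_adj\<close> of \<open>\<eta>\<close> for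
  \<open>a = \<phi>/2\<close>.\<close>

lemma represents_dist_partial:
  fixes \<phi> :: "real^'n::finite \<Rightarrow> real"
  assumes \<phi>: "smooth \<phi>"
  shows "represents g (dist_partial j (regular_dist f)) \<longleftrightarrow>
    (\<forall>\<eta>\<in>test_functions. (\<integral>x. unweight \<phi> g x * \<eta> x \<partial>lebesgue) =
      (\<integral>x. unweight \<phi> f x * Z_adj (\<lambda>x. \<phi> x / 2) j \<eta> x \<partial>lebesgue))"
proof -
  have pd: "partial_deriv j (\<lambda>x. \<phi> x / 2) = (\<lambda>x. partial_deriv j \<phi> x / 2)"
    using partial_deriv_cmult[OF \<phi>, of j "1/2"] by simp
  have "dist_partial j (regular_dist f) (\<lambda>x. of_real (exp (- \<phi> x / 2)) * \<eta> x) =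
     (\<integral>x. unweight \<phi> f x * Z_adj (\<lambda>x. \<phi> x / 2) j \<eta> x \<partial>lebesgue)" if \<eta>: "\<eta> \<in> test_functions" for \<eta>
    unfolding dist_partial_def regular_dist_def Z_adj_def pd
      partial_deriv_unweight[OF \<phi> test_function_smooth[OF \<eta>]] unweight_def integral_minus[symmetric]
    by (intro Bochner_Integration.integral_cong refl) (simp add: algebra_simps)
  then show ?thesis unfolding represents_iff_unweight[OF \<phi>] by (metis (no_types, lifting))
qed

text \<open>Subtracting the whole gradient of \<open>\<phi>\<close> from the half just produced
  reverses its sign, hence \<open>a = -\<phi>/2\<close>. Here two integrals are merged, and
  square-integrability of \<open>f\<close> makes each of them exist.\<close>

lemma represents_dist_X:
  fixes \<phi> :: "real^'n::finite \<Rightarrow> real"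
  assumes \<phi>: "smooth \<phi>" and f: "f \<in> L2 (weighted \<phi>)"
  shows "represents g (dist_X \<phi> j (regular_dist f)) \<longleftrightarrow>
    (\<forall>\<eta>\<in>test_functions. (\<integral>x. unweight \<phi> g x * \<eta> x \<partial>lebesgue) =
      (\<integral>x. unweight \<phi> f x * Z_adj (\<lambda>x. - \<phi> x / 2) j \<eta> x \<partial>lebesgue))"
proof -
  have pd: "partial_deriv j (\<lambda>x. - \<phi> x / 2) = (\<lambda>x. - partial_deriv j \<phi> x / 2)"
    using partial_deriv_cmult[OF \<phi>, of j "-1/2"] by simp
  have v: "unweight \<phi> f \<in> L2 lebesgue" using f L2_weighted_iff[OF smooth_imp_continuous[OF \<phi>]] by blast
  have "dist_X \<phi> j (regular_dist f) (\<lambda>x. of_real (exp (- \<phi> x / 2)) * \<eta> x) =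
     (\<integral>x. unweight \<phi> f x * Z_adj (\<lambda>x. - \<phi> x / 2) j \<eta> x \<partial>lebesgue)" if \<eta>: "\<eta> \<in> test_functions" for \<eta>
  proof -
    let ?p = "\<lambda>x. partial_deriv j \<eta> x - of_real (partial_deriv j \<phi> x / 2) * \<eta> x"
    let ?q = "\<lambda>x. of_real (partial_deriv j \<phi> x) * \<eta> x"
    have t: "?p \<in> test_functions" "?q \<in> test_functions"
    proof -
      have "(\<lambda>x. of_real ((1/2) * partial_deriv j \<phi> x) * \<eta> x) \<in> test_functions"
        by (intro test_mult smooth_of_real smooth_mult smooth_const smooth_partial_deriv \<phi> \<eta>)
      then show "?p \<in> test_functions" by (intro test_diff test_partial_deriv \<eta>) simp
      show "?q \<in> test_functions"
        by (intro test_mult smooth_of_real smooth_partial_deriv \<phi> \<eta>)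
    qed
    have "dist_X \<phi> j (regular_dist f) (\<lambda>x. of_real (exp (- \<phi> x / 2)) * \<eta> x) =
      - (\<integral>x. unweight \<phi> f x * ?p x \<partial>lebesgue) - (\<integral>x. unweight \<phi> f x * ?q x \<partial>lebesgue)"
      unfolding dist_X_def dist_partial_def dist_mult_def regular_dist_def unweight_def
        partial_deriv_unweight[OF \<phi> test_function_smooth[OF \<eta>]]
      by (simp only: mult_ac)
    also have "\<dots> = (\<integral>x. - (unweight \<phi> f x * ?p x) - unweight \<phi> f x * ?q x \<partial>lebesgue)"
      using L2_integrable_mult[OF v test_L2[OF t(1)]] L2_integrable_mult[OF v test_L2[OF t(2)]] by simp
    also have "\<dots> = (\<integral>x. unweight \<phi> f x * Z_adj (\<lambda>x. - \<phi> x / 2) j \<eta> x \<partial>lebesgue)"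
      unfolding Z_adj_def pd
      by (intro Bochner_Integration.integral_cong refl) (simp add: field_simps)
    finally show ?thesis .
  qed
  then show ?thesis unfolding represents_iff_unweight[OF \<phi>] by (metis (no_types, lifting))
qed

text \<open>Used with \<open>c = 1/2\<close> and \<open>c = -1/2\<close>: the gradient term is even
  in \<open>c\<close> and the Laplacian term odd, which is the only difference between the two
  potentials.\<close>

lemma witten_potential_scaled:
  fixes \<phi> :: "real^'n::finite \<Rightarrow> real"
  assumes \<phi>: "smooth \<phi>"
  shows "witten_potential (\<lambda>x. c * \<phi> x) x = c\<^sup>2 * (norm (grad \<phi> x))\<^sup>2 - c * laplacian \<phi> x"
proof -
  have "(norm (grad \<phi> x))\<^sup>2 = (\<Sum>j\<in>UNIV. (partial_deriv j \<phi> x)\<^sup>2)"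
    by (simp add: norm_vec_def L2_set_def grad_def sum_nonneg)
  then show ?thesis
    by (simp add: witten_potential_def laplacian_def partial_deriv_cmult \<phi> smooth_partial_deriv
        sum_subtractf sum_distrib_left power_mult_distrib)
qed

theorem proposition1p3:
  fixes \<phi> :: "real^'n::finite \<Rightarrow> real"
    and V1 V2 :: "real^'n \<Rightarrow> real"
  assumes "smooth \<phi>"
    and "\<And>x. V1 x = 1/4 * (norm (grad \<phi> x))\<^sup>2 - 1/2 * laplacian \<phi> x"
    and "\<And>x. V2 x = 1/4 * (norm (grad \<phi> x))\<^sup>2 + 1/2 * laplacian \<phi> x"
  shows "(compact_operator (H1 \<phi>) (H1_norm \<phi>) (\<lambda>f. f) (weighted \<phi>) \<longleftrightarrow>
            has_compact_resolvent lebesgue (schrodinger_operator V1)) \<and>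
         (compact_operator (H1_grad \<phi>) (H1_grad_norm \<phi>) (\<lambda>f. f) (weighted \<phi>) \<longleftrightarrow>
            has_compact_resolvent lebesgue (schrodinger_operator V2))"
proof
  note c = smooth_imp_continuous[OF assms(1)]
  have s1: "smooth (\<lambda>x. \<phi> x / 2)" and s2: "smooth (\<lambda>x. - \<phi> x / 2)"
    using smooth_mult[OF smooth_const assms(1), of "1/2"] smooth_mult[OF smooth_const assms(1), of "-1/2"] by simp_all
  have "V1 x = witten_potential (\<lambda>x. \<phi> x / 2) x" for x
    using witten_potential_scaled[OF assms(1), of "1/2" x] assms(2)[of x] by (simp add: power2_eq_square)
  then have 1: "schrodinger_operator V1 = witten_operator (\<lambda>x. \<phi> x / 2)"
    by (rule schrodinger_operator_eq[OF s1])
  show "compact_operator (H1 \<phi>) (H1_norm \<phi>) (\<lambda>f. f) (weighted \<phi>) \<longleftrightarrow>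
      has_compact_resolvent lebesgue (schrodinger_operator V1)"
    unfolding 1 compact_resolvent_iff_compact_form_embedding[OF s1] H1_def H1_norm_def[abs_def]
    by (rule compact_weighted_embedding_iff[OF c s1 represents_dist_partial[OF assms(1)]])
  have "V2 x = witten_potential (\<lambda>x. - \<phi> x / 2) x" for x
    using witten_potential_scaled[OF assms(1), of "-1/2" x] assms(3)[of x] by (simp add: power2_eq_square)
  then have 2: "schrodinger_operator V2 = witten_operator (\<lambda>x. - \<phi> x / 2)"
    by (rule schrodinger_operator_eq[OF s2])
  show "compact_operator (H1_grad \<phi>) (H1_grad_norm \<phi>) (\<lambda>f. f) (weighted \<phi>) \<longleftrightarrow>
      has_compact_resolvent lebesgue (schrodinger_operator V2)"
    unfolding 2 compact_resolvent_iff_compact_form_embedding[OF s2] H1_grad_def H1_grad_norm_def[abs_def]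
    by (rule compact_weighted_embedding_iff[OF c s2 represents_dist_X[OF assms(1)]])
qed

end
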